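(* Let $N\ge3$ and let $\Omega\subset\mathbb{R}^N$ be a bounded domain containing $0$. If $(v_n)$ is a bounded sequence in $\widetilde{\mathcal H}$, then $u_n=|x|^{-(N-2)/2}v_n$ is a bounded sequence in $\mathcal H$, and for every $1\le q<\frac{2N}{N-2}$, up to a subsequence, $u_n$ converges in $L^q(\Omega)$ to some $u$. Thus one has the compact imbeddings $$\widetilde{\mathcal H}\hookrightarrow L^q\big(|x|^{-q(N-2)/2}dx,\Omega\big)\qquad\text{for any } 1\le q<\frac{2N}{N-2},$$ and, further, for every $0\le s\le\frac{N-2}{2}q$, the compact imbeddings $$\widetilde{\mathcal H}\hookrightarrow L^q\big(|x|^{-s}dx,\Omega\big)\qquad\text{for any } 1\le q<\frac{2N}{N-2}.$$
   Context: $\widetilde{\mathcal H}=W^{1,2}_0(|x|^{-(N-2)}dx,\Omega)$ is the completion of $C_0^\infty(\Omega)$ under $\|v\|_{\widetilde{\mathcal H}}^2=\int_\Omega|x|^{-(N-2)}|\nabla v|^2dx$. $\mathcal H$ is the completion of $\{|x|^{-(N-2)/2}v: v\in C_0^\infty(\Omega)\}$ under $\|u\|_{\mathcal H}^2=\int_\Omega|x|^{-(N-2)}|\nabla(|x|^{\frac{N-2}{2}}u)|^2dx$. The weighted space $L^q(w(x)\,dx,\Omega)$ is the closure of $C_0^\infty(\Omega)$ under the norm $\big(\int_\Omega w(x)|\phi|^q\,dx\big)^{1/q}$. *)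

theory Defs
  imports "HOL-Analysis.Analysis"
begin

section \<open>Test functions\<close>

definition partial_deriv :: "'n::finite \<Rightarrow> (real^'n \<Rightarrow> real) \<Rightarrow> real^'n \<Rightarrow> real" where
  "partial_deriv i f x = frechet_derivative f (at x) (axis i 1)"

definition grad :: "(real^'n::finite \<Rightarrow> real) \<Rightarrow> real^'n \<Rightarrow> real^'n" where
  "grad f x = (\<chi> i. partial_deriv i f x)"

primrec C_k :: "nat \<Rightarrow> (real^'n::finite \<Rightarrow> real) \<Rightarrow> bool" where
  "C_k 0 f \<longleftrightarrow> continuous_on UNIV f"
| "C_k (Suc k) f \<longleftrightarrow> (\<forall>x. f differentiable (at x)) \<and> (\<forall>i. C_k k (partial_deriv i f))"

text \<open>Functions on \<open>\<Omega>\<close> with compact support in \<open>\<Omega>\<close> are taken with their extension by zero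
  to the whole space.\<close>

definition C0_inf :: "(real^'n::finite) set \<Rightarrow> (real^'n \<Rightarrow> real) set" where
  "C0_inf \<Omega> = {f. (\<forall>k. C_k k f) \<and> compact (closure {x. f x \<noteq> 0}) \<and> closure {x. f x \<noteq> 0} \<subseteq> \<Omega>}"

section \<open>Abstract completion of a normed function space\<close>

text \<open>The completion of \<open>A\<close> under \<open>p\<close> is the set of \<open>p\<close>-Cauchy sequences in \<open>A\<close>
  modulo \<open>p\<close>-null sequences; \<open>completion_norm\<close> is the norm of such a class.\<close>

type_synonym 'n fun_seq = "nat \<Rightarrow> real^'n \<Rightarrow> real"

definition Cauchy_seqs ::
  "(real^'n \<Rightarrow> real) set \<Rightarrow> ((real^'n \<Rightarrow> real) \<Rightarrow> real) \<Rightarrow> 'n::finite fun_seq set" where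
  "Cauchy_seqs A p = {V. (\<forall>k. V k \<in> A) \<and>
     (\<forall>e>0. \<exists>K. \<forall>j\<ge>K. \<forall>k\<ge>K. p (\<lambda>x. V j x - V k x) < e)}"

definition completion_rel ::
  "(real^'n \<Rightarrow> real) set \<Rightarrow> ((real^'n \<Rightarrow> real) \<Rightarrow> real) \<Rightarrow> ('n::finite fun_seq \<times> 'n fun_seq) set" where
  "completion_rel A p = {(V, W). V \<in> Cauchy_seqs A p \<and> W \<in> Cauchy_seqs A p \<and>
     (\<lambda>k. p (\<lambda>x. V k x - W k x)) \<longlonglongrightarrow> 0}"

definition completion ::
  "(real^'n \<Rightarrow> real) set \<Rightarrow> ((real^'n \<Rightarrow> real) \<Rightarrow> real) \<Rightarrow> 'n::finite fun_seq set set" where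
  "completion A p = Cauchy_seqs A p // completion_rel A p"

definition completion_norm ::
  "((real^'n \<Rightarrow> real) \<Rightarrow> real) \<Rightarrow> 'n::finite fun_seq set \<Rightarrow> real" where
  "completion_norm p X = (THE r. \<forall>V\<in>X. (\<lambda>k. p (V k)) \<longlonglongrightarrow> r)"

definition bounded_seq_in ::
  "(real^'n \<Rightarrow> real) set \<Rightarrow> ((real^'n \<Rightarrow> real) \<Rightarrow> real) \<Rightarrow> (nat \<Rightarrow> 'n::finite fun_seq set) \<Rightarrow> bool" where
  "bounded_seq_in A p X \<longleftrightarrow>
     (\<forall>n. X n \<in> completion A p) \<and> (\<exists>C. \<forall>n. completion_norm p (X n) \<le> C)"

section \<open>The spaces \<open>\<H>~\<close> and \<open>\<H>\<close>\<close>

definition norm_Ht :: "(real^'n::finite) set \<Rightarrow> (real^'n \<Rightarrow> real) \<Rightarrow> real" where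
  "norm_Ht \<Omega> v = sqrt (LINT x:\<Omega>|lebesgue.
     norm x powr (- (real CARD('n) - 2)) * (norm (grad v x))\<^sup>2)"

definition norm_H :: "(real^'n::finite) set \<Rightarrow> (real^'n \<Rightarrow> real) \<Rightarrow> real" where
  "norm_H \<Omega> u = norm_Ht \<Omega> (\<lambda>x. norm x powr ((real CARD('n) - 2) / 2) * u x)"

definition to_u :: "(real^'n::finite \<Rightarrow> real) \<Rightarrow> real^'n \<Rightarrow> real" where
  "to_u v = (\<lambda>x. norm x powr (- (real CARD('n) - 2) / 2) * v x)"

definition core_H :: "(real^'n::finite) set \<Rightarrow> (real^'n \<Rightarrow> real) set" where
  "core_H \<Omega> = to_u ` C0_inf \<Omega>"

text \<open>The map \<open>v \<mapsto> |x|\<^bsup>-(N-2)/2\<^esup> v\<close> from \<open>\<H>~\<close> to \<open>\<H>\<close>, acting termwise on Cauchy sequences.\<close>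

definition to_u_class ::
  "(real^'n::finite) set \<Rightarrow> 'n fun_seq set \<Rightarrow> 'n fun_seq set" where
  "to_u_class \<Omega> X = completion_rel (core_H \<Omega>) (norm_H \<Omega>) `` ((\<lambda>V k. to_u (V k)) ` X)"

section \<open>Weighted Lebesgue spaces\<close>

definition Lq_norm ::
  "(real^'n::finite) set \<Rightarrow> (real^'n \<Rightarrow> real) \<Rightarrow> real \<Rightarrow> (real^'n \<Rightarrow> real) \<Rightarrow> real" where
  "Lq_norm \<Omega> w q f = (LINT x:\<Omega>|lebesgue. w x * \<bar>f x\<bar> powr q) powr (1 / q)"

text \<open>Integrability is required explicitly because the Bochner integral of a
  non-integrable function is \<open>0\<close>.\<close>

definition Lq_finite ::
  "(real^'n::finite) set \<Rightarrow> (real^'n \<Rightarrow> real) \<Rightarrow> real \<Rightarrow> (real^'n \<Rightarrow> real) \<Rightarrow> bool" where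
  "Lq_finite \<Omega> w q f \<longleftrightarrow> set_borel_measurable lebesgue \<Omega> f \<and>
     set_integrable lebesgue \<Omega> (\<lambda>x. w x * \<bar>f x\<bar> powr q)"

definition Lq_space ::
  "(real^'n::finite) set \<Rightarrow> (real^'n \<Rightarrow> real) \<Rightarrow> real \<Rightarrow> (real^'n \<Rightarrow> real) set" where
  "Lq_space \<Omega> w q = {f. Lq_finite \<Omega> w q f \<and>
     (\<forall>e>0. \<exists>\<phi>\<in>C0_inf \<Omega>. Lq_finite \<Omega> w q (\<lambda>x. f x - \<phi> x) \<and> Lq_norm \<Omega> w q (\<lambda>x. f x - \<phi> x) < e)}"

definition Lq_conv ::
  "(real^'n::finite) set \<Rightarrow> (real^'n \<Rightarrow> real) \<Rightarrow> real \<Rightarrow> 'n fun_seq \<Rightarrow> (real^'n \<Rightarrow> real) \<Rightarrow> bool" where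
  "Lq_conv \<Omega> w q F f \<longleftrightarrow> (\<forall>k. F k \<in> Lq_space \<Omega> w q) \<and> f \<in> Lq_space \<Omega> w q \<and>
     (\<lambda>k. Lq_norm \<Omega> w q (\<lambda>x. F k x - f x)) \<longlonglongrightarrow> 0"

section \<open>Compact imbeddings\<close>

text \<open>An element \<open>X\<close> of a completion is identified with the function \<open>f\<close> (unique almost
  everywhere where \<open>w > 0\<close>) to which its representing sequences converge in \<open>L\<^sup>q(w dx, \<Omega>)\<close>.
  This is the extension by continuity of the identity on the underlying functions, and hence
  linear.\<close>

definition represents ::
  "(real^'n::finite) set \<Rightarrow> (real^'n \<Rightarrow> real) \<Rightarrow> real \<Rightarrow> 'n fun_seq set \<Rightarrow> (real^'n \<Rightarrow> real) \<Rightarrow> bool" where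
  "represents \<Omega> w q X f \<longleftrightarrow> (\<forall>V\<in>X. Lq_conv \<Omega> w q V f)"

text \<open>The four conjuncts: the identification is defined on the whole completion, bounded,
  injective, and maps bounded sequences to sequences with a convergent subsequence.\<close>

definition compact_imbedding ::
  "(real^'n::finite \<Rightarrow> real) set \<Rightarrow> ((real^'n \<Rightarrow> real) \<Rightarrow> real) \<Rightarrow>
   (real^'n) set \<Rightarrow> (real^'n \<Rightarrow> real) \<Rightarrow> real \<Rightarrow> bool" where
  "compact_imbedding A p \<Omega> w q \<longleftrightarrow>
     (\<forall>X\<in>completion A p. \<exists>f. represents \<Omega> w q X f) \<and>
     (\<exists>C. \<forall>X\<in>completion A p. \<forall>f. represents \<Omega> w q X f \<longrightarrow>
        Lq_norm \<Omega> w q f \<le> C * completion_norm p X) \<and>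
     (\<forall>X\<in>completion A p. \<forall>Y\<in>completion A p. \<forall>f.
        represents \<Omega> w q X f \<and> represents \<Omega> w q Y f \<longrightarrow> X = Y) \<and>
     (\<forall>X f. bounded_seq_in A p X \<and> (\<forall>n. represents \<Omega> w q (X n) (f n)) \<longrightarrow>
        (\<exists>r u. strict_mono r \<and> Lq_conv \<Omega> w q (f \<circ> r) u))"

end

theory Submission
  imports Defs "HOL-Complex_Analysis.Great_Picard"
begin

text \<open>
  Put \<open>a = (N - 2) / 2\<close>, so that the energy of a test function \<open>v\<close> is the integral of \<open>h\<^sup>2\<close> with
  \<open>h = |x| powr - a * |grad v|\<close>, while \<open>u = |x| powr - a * v\<close>.

  The estimates rest on the recovery of \<open>v\<close> from its gradient: up to a constant, \<open>v(x)\<close> is the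
  integral of \<open>|y - x| powr - N * ((x - y) \<bullet> grad v(y))\<close> (\<open>potential_representation\<close>). Hence
  \<open>|u|\<close> is bounded by the image of \<open>h \<in> L\<^sup>2\<close> under the integral operator with kernel
  \<open>|x| powr - a * |y| powr a * |x - y| powr (1 - N)\<close>. An argument of the kind that proves Young's
  convolution inequality, together with \<open>|y| \<le> |x| + |x - y|\<close>, shows that this operator
  maps into \<open>L\<^sup>q\<close>, \<open>q \<ge> 2\<close>, as soon as \<open>|z| powr - \<gamma>\<close> is locally integrable for some \<open>\<gamma> > a q\<close>; that is the condition
  \<open>q < 2 N / (N - 2)\<close> (\<open>weighted_Sobolev_bound\<close>).

  For compactness, replace the singular kernel \<open>|z| powr - N * z\<close> by a continuous one. In \<open>L\<^sup>1\<close> this changes the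
  potentials of functions of bounded energy uniformly little, and the regularised potentials are
  equicontinuous; so a sequence of bounded energy has a subsequence that converges in \<open>L\<^sup>1\<close>
  (\<open>L1_compactness\<close>). The bound on \<open>u\<close> in a slightly higher space \<open>L\<^sup>q\<close> excludes concentration, both
  of large values and at the origin, and upgrades this to convergence in the weighted spaces
  (\<open>weighted_compactness\<close>).

  An imbedding of the completion also has to be injective: a Cauchy sequence for the energy that
  tends to zero in \<open>L\<^sup>1\<close> must tend to zero in energy. With the weight \<open>|x| powr - 2 a\<close> replaced by the
  smooth \<open>(|x|\<^sup>2 + \<epsilon>) powr - a\<close>, integration by parts moves the derivatives to a fixed
  test function, so the energy product with any fixed test function tends to zero; for a Cauchy
  sequence this suffices (\<open>norm_Ht_closable\<close>).

  The rest is independent of the weight: a locale deals with completions of a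
  seminormed space of functions whose elements satisfy such a bound and such a compactness property.
  It is applied twice, to the test functions and to the functions \<open>u\<close>. The
  map \<open>v \<mapsto> u\<close> is isometric (\<open>norm_H_to_u\<close>), so the second application inherits its estimates
  from the first.
\<close>

section \<open>Functions of class \<open>C\<^sup>k\<close> and test functions\<close>

lemma partial_deriv_eq:
  assumes "(f has_derivative f') (at x)"
  shows "partial_deriv i f x = f' (axis i 1)"
  using frechet_derivative_at[OF assms] by (simp add: partial_deriv_def)

lemma has_derivative_frechet:
  "f differentiable (at x) \<Longrightarrow> (f has_derivative frechet_derivative f (at x)) (at x)"
  by (simp add: frechet_derivative_works)

lemma C_k_continuous: "C_k k f \<Longrightarrow> continuous_on UNIV f"
  by (cases k) (auto simp: continuous_on_eq_continuous_at intro: differentiable_imp_continuous_within)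

lemma C_k_SucD: "C_k (Suc k) f \<Longrightarrow> C_k k f"
proof (induction k arbitrary: f)
  case 0
  then show ?case using C_k_continuous[of "Suc 0" f] by simp
qed auto

lemma partial_deriv_const: "partial_deriv i (\<lambda>x. c) = (\<lambda>x. 0)"
  by (rule ext, subst partial_deriv_eq[where f'="\<lambda>_. 0"]) auto

lemma C_k_const: "C_k k (\<lambda>x. c)"
  by (induction k arbitrary: c) (auto simp: partial_deriv_const)

lemma partial_deriv_coord: "partial_deriv i (\<lambda>x. x $ j - c) = (\<lambda>x. if i = j then 1 else 0)"
proof (rule ext)
  fix x :: "real^'a"
  have "((\<lambda>x::real^'a. x $ j - c) has_derivative (\<lambda>h. h $ j)) (at x)"
    by (auto intro!: derivative_eq_intros bounded_linear.has_derivative[OF bounded_linear_vec_nth])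
  from partial_deriv_eq[OF this, of i]
  show "partial_deriv i (\<lambda>x. x $ j - c) x = (if i = j then 1 else 0)"
    by (simp add: axis_def)
qed

lemma C_k_coord: "C_k k (\<lambda>x. x $ j - c)"
proof (cases k)
  case (Suc m)
  have "(\<lambda>x::real^'a. x $ j - c) differentiable (at x)" for x
    by (intro differentiable_diff differentiable_const bounded_linear_imp_differentiable bounded_linear_vec_nth)
  then show ?thesis using Suc by (simp add: partial_deriv_coord C_k_const)
qed (auto intro!: continuous_intros)

lemma partial_deriv_add:
  assumes "\<And>x. f differentiable (at x)" "\<And>x. g differentiable (at x)"
  shows "partial_deriv i (\<lambda>x. f x + g x) = (\<lambda>x. partial_deriv i f x + partial_deriv i g x)"
  by (rule ext, subst partial_deriv_eq[OF has_derivative_add[OF has_derivative_frechet[OF assms(1)] has_derivative_frechet[OF assms(2)]]])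
    (simp add: partial_deriv_def)

lemma partial_deriv_mult:
  assumes "f differentiable (at x)" "g differentiable (at x)"
  shows "partial_deriv i (\<lambda>x. f x * g x) x = f x * partial_deriv i g x + partial_deriv i f x * g x"
  by (subst partial_deriv_eq[OF has_derivative_mult[OF has_derivative_frechet[OF assms(1)] has_derivative_frechet[OF assms(2)]]])
    (simp add: partial_deriv_def)

lemma C_k_add: "C_k k f \<Longrightarrow> C_k k g \<Longrightarrow> C_k k (\<lambda>x. f x + g x)"
  by (induction k arbitrary: f g) (auto intro: continuous_intros simp: partial_deriv_add)

lemma C_k_mult: "C_k k f \<Longrightarrow> C_k k g \<Longrightarrow> C_k k (\<lambda>x. f x * g x)"
proof (induction k arbitrary: f g)
  case (Suc k)
  have "partial_deriv i (\<lambda>x. f x * g x) = (\<lambda>x. f x * partial_deriv i g x + partial_deriv i f x * g x)" for i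
    using Suc.prems by (auto intro!: ext partial_deriv_mult)
  then show ?case
    using Suc C_k_SucD[OF Suc.prems(1)] C_k_SucD[OF Suc.prems(2)] by (auto intro!: C_k_add)
qed (auto intro: continuous_intros)

lemma C_k_diff: "C_k k f \<Longrightarrow> C_k k g \<Longrightarrow> C_k k (\<lambda>x. f x - g x)"
  using C_k_add[of k f "\<lambda>x. (-1) * g x"] C_k_mult[OF C_k_const, of k g "-1"] by simp

lemma C_k_differentiable: "C_k (Suc k) f \<Longrightarrow> f differentiable (at x)" by simp

lemma C_k_partial: "C_k (Suc k) f \<Longrightarrow> C_k k (partial_deriv i f)" by simp

lemma partial_deriv_diff:
  assumes "f differentiable (at x)" "g differentiable (at x)"
  shows "partial_deriv i (\<lambda>x. f x - g x) x = partial_deriv i f x - partial_deriv i g x"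
  by (subst partial_deriv_eq[OF has_derivative_diff[OF has_derivative_frechet[OF assms(1)] has_derivative_frechet[OF assms(2)]]])
    (simp add: partial_deriv_def)

lemma partial_deriv_cmult:
  assumes "f differentiable (at x)"
  shows "partial_deriv i (\<lambda>x. c * f x) x = c * partial_deriv i f x"
  by (subst partial_deriv_eq[OF has_derivative_mult_right[OF has_derivative_frechet[OF assms]]])
    (simp add: partial_deriv_def)

lemma grad_diff:
  assumes "f differentiable (at x)" "g differentiable (at x)"
  shows "grad (\<lambda>x. f x - g x) x = grad f x - grad g x"
  using assms by (simp add: grad_def vec_eq_iff partial_deriv_diff)

lemma grad_cmult:
  assumes "f differentiable (at x)"
  shows "grad (\<lambda>x. c * f x) x = c *\<^sub>R grad f x"
  using assms by (simp add: grad_def vec_eq_iff partial_deriv_cmult)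

lemma continuous_grad: "C_k (Suc 0) f \<Longrightarrow> continuous_on UNIV (grad f)"
  unfolding grad_def by (intro continuous_intros) auto

text \<open>For \<open>b \<le> 0\<close> a smooth minorant of the singular power \<open>norm (x - c) powr (2 * b)\<close>, to which it
  increases as \<open>\<epsilon>\<close> decreases to \<open>0\<close>. All singular powers below are regularised with it.\<close>

definition reg_powr :: "real^'n::finite \<Rightarrow> real \<Rightarrow> real \<Rightarrow> real^'n \<Rightarrow> real" where
  "reg_powr c \<epsilon> b x = ((norm (x - c))\<^sup>2 + \<epsilon>) powr b"

lemma has_derivative_reg_powr:
  assumes "\<epsilon> > 0"
  shows "(reg_powr c \<epsilon> b has_derivative
    (\<lambda>h. 2 * b * ((x - c) \<bullet> h) * reg_powr c \<epsilon> (b - 1) x)) (at x)"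
proof -
  have pos: "(x - c) \<bullet> (x - c) + \<epsilon> > 0" for x
    using assms by (meson add_nonneg_pos inner_ge_zero)
  have "((\<lambda>x. ((x - c) \<bullet> (x - c) + \<epsilon>) powr b) has_derivative
    (\<lambda>h. 2 * b * ((x - c) \<bullet> h) * (((x - c) \<bullet> (x - c) + \<epsilon>) powr (b - 1)))) (at x)"
  proof (rule has_derivative_eq_rhs[OF DERIV_compose_FDERIV[where f="\<lambda>z. z powr b" and g="\<lambda>x. (x - c) \<bullet> (x - c) + \<epsilon>"]])
    show "((\<lambda>x. (x - c) \<bullet> (x - c) + \<epsilon>) has_derivative (\<lambda>h. 2 * ((x - c) \<bullet> h))) (at x)"
      by (auto intro!: derivative_eq_intros simp: inner_commute)
  qed (use has_real_derivative_powr[OF pos] in auto)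
  then show ?thesis by (simp add: reg_powr_def[abs_def] power2_norm_eq_inner)
qed

text \<open>Each derivative is a coordinate times the same kind of function with \<open>b\<close> lowered by one, so
  the induction has to cover all exponents at once.\<close>

lemma C_k_reg_powr:
  assumes "\<epsilon> > 0"
  shows "C_k k (reg_powr c \<epsilon> b)"
proof (induction k arbitrary: b)
  case 0
  then show ?case using has_derivative_reg_powr[OF assms]
    by (auto simp: continuous_on_eq_continuous_at intro: has_derivative_continuous)
next
  case (Suc k)
  have "partial_deriv i (reg_powr c \<epsilon> b) = (\<lambda>x. 2 * b * ((x $ i - c $ i) * reg_powr c \<epsilon> (b - 1) x))" for i
    by (rule ext, subst partial_deriv_eq[OF has_derivative_reg_powr[OF assms]]) (simp add: inner_axis)
  moreover have "reg_powr c \<epsilon> b differentiable (at x)" for x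
    unfolding differentiable_def using has_derivative_reg_powr[OF assms] by blast
  ultimately show ?case using Suc
    by (auto intro!: C_k_mult C_k_const C_k_coord)
qed

lemma closure_support_eq0: "x \<notin> closure {x. f x \<noteq> 0} \<Longrightarrow> f x = 0"
  by (meson closure_subset mem_Collect_eq subsetD)

lemma partial_deriv_eq_0:
  assumes "x \<notin> closure {x. f x \<noteq> 0}" shows "partial_deriv i f x = 0"
proof -
  have "open (- closure {x. f x \<noteq> 0})" by auto
  have "(f has_derivative (\<lambda>h. 0)) (at x)"
  proof (rule has_derivative_transform_within_open[OF has_derivative_const[of 0] \<open>open (- closure {x. f x \<noteq> 0})\<close>])
    show "x \<in> - closure {x. f x \<noteq> 0}" using assms by blast
    show "y \<in> - closure {x. f x \<noteq> 0} \<Longrightarrow> 0 = f y" for y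
      using closure_support_eq0[of y f] by (metis ComplD)
  qed
  then show ?thesis by (rule partial_deriv_eq)
qed

lemma C0_inf_zero: "(\<lambda>x. 0) \<in> C0_inf \<Omega>" by (simp add: C0_inf_def C_k_const)

lemma compact_closure_subset:
  fixes A K :: "'a::t2_space set"
  assumes "compact K" "closure A \<subseteq> K" shows "compact (closure A)"
  using compact_Int_closed[OF assms(1) closed_closure[of A]] assms(2) by (simp add: Int_absorb1)

lemma C0_inf_subset_support:
  assumes "f \<in> C0_inf \<Omega>" "\<And>k. C_k k g" "closure {x. g x \<noteq> 0} \<subseteq> closure {x. f x \<noteq> 0}"
  shows "g \<in> C0_inf \<Omega>"
  using assms compact_closure_subset[OF _ assms(3)] unfolding C0_inf_def by blast

lemma C0_inf_mult:
  assumes "f \<in> C0_inf \<Omega>" "\<And>k. C_k k g" shows "(\<lambda>x. g x * f x) \<in> C0_inf \<Omega>"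
  by (rule C0_inf_subset_support[OF assms(1)])
    (use assms in \<open>auto simp: C0_inf_def intro!: C_k_mult closure_mono\<close>)

lemma C0_inf_diff:
  assumes "f \<in> C0_inf \<Omega>" "g \<in> C0_inf \<Omega>" shows "(\<lambda>x. f x - g x) \<in> C0_inf \<Omega>"
proof -
  have sub: "closure {x. f x - g x \<noteq> 0} \<subseteq> closure {x. f x \<noteq> 0} \<union> closure {x. g x \<noteq> 0}"
    unfolding closure_Un[symmetric] by (rule closure_mono) auto
  have "compact (closure {x. f x - g x \<noteq> 0})"
    by (rule compact_closure_subset[OF _ sub]) (use assms in \<open>auto simp: C0_inf_def\<close>)
  with assms sub show ?thesis by (auto simp: C0_inf_def intro: C_k_diff)
qed

lemma C0_inf_D:
  assumes "f \<in> C0_inf \<Omega>"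
  shows "C_k k f" "compact (closure {x. f x \<noteq> 0})" "closure {x. f x \<noteq> 0} \<subseteq> \<Omega>"
    "x \<notin> \<Omega> \<Longrightarrow> f x = 0" "x \<notin> \<Omega> \<Longrightarrow> grad f x = 0" "f differentiable (at x)"
    "continuous_on UNIV f" "continuous_on UNIV (grad f)"
proof -
  show 1: "C_k k f" "compact (closure {x. f x \<noteq> 0})" "closure {x. f x \<noteq> 0} \<subseteq> \<Omega>" for k
    using assms by (auto simp: C0_inf_def)
  show "f x = 0" if "x \<notin> \<Omega>"
    using closure_support_eq0[of x f] 1(3) that by blast
  show "grad f x = 0" if "x \<notin> \<Omega>"
  proof -
    have "partial_deriv i f x = 0" for i using partial_deriv_eq_0[of x f i] 1(3) that by blast
    then show ?thesis by (simp add: grad_def vec_eq_iff)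
  qed
  show "f differentiable (at x)" using 1(1)[of "Suc 0"] by simp
  show "continuous_on UNIV f" "continuous_on UNIV (grad f)"
    using 1(1)[of "Suc 0"] C_k_continuous continuous_grad by blast+
qed

section \<open>Integration by parts\<close>

lemma bounded_supp_cball:
  assumes "bounded {x. f x \<noteq> (0::real)}"
  obtains R where "R > 0" "\<And>x. norm x > R \<Longrightarrow> f x = 0"
proof -
  obtain R where "\<And>x. f x \<noteq> 0 \<Longrightarrow> norm x \<le> R" using assms by (auto simp: bounded_iff)
  then show ?thesis using that[of "max R 1"] by force
qed

lemma bounded_compact_supp:
  fixes f :: "'a::euclidean_space \<Rightarrow> real"
  assumes "continuous_on UNIV f" "bounded {x. f x \<noteq> 0}"
  obtains M where "M > 0" "\<And>x. \<bar>f x\<bar> \<le> M"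
proof -
  obtain R where R: "R > 0" "\<And>x. norm x > R \<Longrightarrow> f x = 0" using bounded_supp_cball[OF assms(2)] by metis
  have "compact (f ` cball 0 R)" using assms(1) by (intro compact_continuous_image) (auto intro: continuous_on_subset)
  then obtain M where M: "\<And>x. x \<in> cball 0 R \<Longrightarrow> \<bar>f x\<bar> \<le> M" by (force dest!: compact_imp_bounded simp: bounded_iff)
  have "\<bar>f x\<bar> \<le> max M 1" for x
    using M[of x] R(2)[of x] by (cases "norm x \<le> R") (auto simp: max_def)
  then show ?thesis using that[of "max M 1"] by simp
qed

lemma integrable_compact_supp:
  fixes f :: "'a::euclidean_space \<Rightarrow> real"
  assumes "continuous_on UNIV f" "bounded {x. f x \<noteq> 0}"
  shows "integrable lborel f"
proof -
  obtain R where R: "R > 0" "\<And>x. norm x > R \<Longrightarrow> f x = 0" using bounded_supp_cball[OF assms(2)] by metis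
  have "integrable lborel (\<lambda>x. indicator (cball 0 R) x *\<^sub>R f x)"
    using assms(1) by (intro borel_integrable_compact) (auto intro: continuous_on_subset)
  also have "(\<lambda>x. indicator (cball 0 R) x *\<^sub>R f x) = f"
    using R(2) by (auto simp: indicator_def fun_eq_iff not_le)
  finally show ?thesis .
qed

lemma integral_lborel_shift:
  fixes f :: "'a::euclidean_space \<Rightarrow> real"
  assumes [measurable]: "f \<in> borel_measurable borel"
  shows "(\<integral>x. f (c + x) \<partial>lborel) = (\<integral>x. f x \<partial>lborel)"
  by (subst (2) lborel_distr_plus[of c, symmetric]) (simp add: integral_distr)

lemma integrable_lborel_shift:
  fixes f :: "'a::euclidean_space \<Rightarrow> real"
  assumes "integrable lborel f"
  shows "integrable lborel (\<lambda>x. f (c + x))"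
  using integrable_distr[of "(+) c" lborel lborel f] assms by (simp add: lborel_distr_plus cong: distr_cong)

lemma bounded_supp_partial_deriv:
  assumes "bounded {x. f x \<noteq> 0}" shows "bounded {x. partial_deriv i f x \<noteq> 0}"
  by (rule bounded_subset[OF bounded_closure[OF assms]]) (use partial_deriv_eq_0[of _ f i] in blast)

lemma line_derivative:
  assumes "f differentiable (at (x + t *\<^sub>R axis i 1))"
  shows "((\<lambda>s. f (x + s *\<^sub>R axis i 1)) has_real_derivative partial_deriv i f (x + t *\<^sub>R axis i 1)) (at t)"
proof -
  let ?e = "axis i 1 :: real^'a" and ?D = "frechet_derivative f (at (x + t *\<^sub>R axis i 1))"
  have d: "((\<lambda>s. f (x + s *\<^sub>R ?e)) has_derivative (\<lambda>s. ?D (s *\<^sub>R ?e))) (at t)"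
    by (rule has_derivative_compose[where g=f and f="\<lambda>s. x + s *\<^sub>R ?e", OF _ has_derivative_frechet[OF assms]])
       (auto intro!: derivative_eq_intros)
  have "?D (s *\<^sub>R ?e) = s * partial_deriv i f (x + t *\<^sub>R axis i 1)" for s
    using linear_frechet_derivative[OF assms] by (simp add: partial_deriv_def linear_scale)
  then show ?thesis by (intro has_derivative_imp_has_field_derivative[OF d]) simp
qed

text \<open>The difference quotients have integral zero by translation invariance, and they converge
  dominatedly to the partial derivative.\<close>

lemma integral_partial_deriv_0:
  fixes f :: "real^'n::finite \<Rightarrow> real"
  assumes f: "C_k (Suc 0) f" and bd: "bounded {x. f x \<noteq> 0}"
  shows "(\<integral>x. partial_deriv i f x \<partial>lborel) = 0"
proof -
  let ?e = "axis i 1 :: real^'n"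
  define h :: "nat \<Rightarrow> real" where "h n = inverse (Suc n)" for n
  have h: "0 < h n" "h n \<le> 1" for n by (auto simp: h_def field_simps)
  have h0: "h \<longlonglongrightarrow> 0" unfolding h_def by (rule LIMSEQ_inverse_real_of_nat)
  define s where "s n x = (f (h n *\<^sub>R ?e + x) - f x) / h n" for n x
  have cf: "continuous_on UNIV f" "continuous_on UNIV (partial_deriv i f)"
    using C_k_continuous[OF f] f by auto
  have [measurable]: "f \<in> borel_measurable borel" "partial_deriv i f \<in> borel_measurable borel"
    using cf by (auto intro: borel_measurable_continuous_onI)
  have int: "integrable lborel f" by (rule integrable_compact_supp[OF cf(1) bd])
  obtain R where R: "R > 0" "\<And>x. norm x > R \<Longrightarrow> f x = 0" using bounded_supp_cball[OF bd] by metis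
  obtain M where M: "M > 0" "\<And>x. \<bar>partial_deriv i f x\<bar> \<le> M"
    using bounded_compact_supp[OF cf(2) bounded_supp_partial_deriv[OF bd]] by metis
  have "(\<lambda>n. \<integral>x. s n x \<partial>lborel) \<longlonglongrightarrow> (\<integral>x. partial_deriv i f x \<partial>lborel)"
  proof (rule integral_dominated_convergence[where w="\<lambda>x. M * indicator (cball 0 (R + 1)) x"])
    show "integrable lborel (\<lambda>x. M * indicator (cball 0 (R + 1)) x :: real)"
      using emeasure_lborel_cball_finite by (intro integrable_mult_right integrable_real_indicator) auto
    show "s n \<in> borel_measurable lborel" for n unfolding s_def by measurable
    show "AE x in lborel. (\<lambda>n. s n x) \<longlonglongrightarrow> partial_deriv i f x"
    proof (intro AE_I2)
      fix x
      have "((\<lambda>s. f (x + s *\<^sub>R ?e)) has_real_derivative partial_deriv i f x) (at 0)"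
        using line_derivative[of f x 0 i] f by simp
      then have "((\<lambda>s. (f (x + s *\<^sub>R ?e) - f x) / s) \<longlongrightarrow> partial_deriv i f x) (at 0)"
        by (simp add: DERIV_def)
      moreover have "filterlim h (at 0) sequentially"
        using h0 h(1) by (auto simp: filterlim_at less_imp_neq[THEN not_sym])
      ultimately show "(\<lambda>n. s n x) \<longlonglongrightarrow> partial_deriv i f x"
        unfolding s_def by (subst add.commute) (rule filterlim_compose)
    qed
    show "AE x in lborel. norm (s n x) \<le> M * indicator (cball 0 (R + 1)) x" for n
    proof (intro AE_I2)
      fix x
      show "norm (s n x) \<le> M * indicator (cball 0 (R + 1)) x"
      proof (cases "norm x \<le> R + 1")
        case True
        have "\<exists>z. 0 < z \<and> z < h n \<and> f (x + h n *\<^sub>R ?e) - f (x + 0 *\<^sub>R ?e) = (h n - 0) * partial_deriv i f (x + z *\<^sub>R ?e)"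
          by (rule MVT2[OF h(1)]) (rule line_derivative, use f in simp)
        then obtain z where "f (x + h n *\<^sub>R ?e) - f x = h n * partial_deriv i f (x + z *\<^sub>R ?e)" by auto
        then have "s n x = partial_deriv i f (x + z *\<^sub>R ?e)"
          using h(1)[of n] by (simp add: s_def add.commute)
        then show ?thesis using M True by simp
      next
        case False
        have "norm x \<le> norm (h n *\<^sub>R ?e + x) + norm (h n *\<^sub>R ?e)" using norm_triangle_ineq4[of "h n *\<^sub>R ?e + x" "h n *\<^sub>R ?e"] by simp
        then have "norm (h n *\<^sub>R ?e + x) > R" using False h[of n] by (simp add: norm_axis_1)
        then show ?thesis using False R by (simp add: s_def)
      qed
    qed
  qed auto
  moreover have "(\<integral>x. s n x \<partial>lborel) = 0" for n
    unfolding s_def using int integrable_lborel_shift[OF int, of "h n *\<^sub>R ?e"]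
    by (simp add: integral_lborel_shift)
  ultimately show ?thesis by (simp add: LIMSEQ_const_iff)
qed

lemma integral_by_parts:
  fixes f g :: "real^'n::finite \<Rightarrow> real"
  assumes f: "C_k (Suc 0) f" and g: "C_k (Suc 0) g" and bd: "bounded {x. g x \<noteq> 0}"
  shows "(\<integral>x. f x * partial_deriv i g x \<partial>lborel) = - (\<integral>x. partial_deriv i f x * g x \<partial>lborel)"
proof -
  have c: "continuous_on UNIV f" "continuous_on UNIV (partial_deriv i f)"
     "continuous_on UNIV g" "continuous_on UNIV (partial_deriv i g)"
    using C_k_continuous[OF f] C_k_continuous[OF g] f g by auto
  have 1: "integrable lborel (\<lambda>x. f x * partial_deriv i g x)"
    using c bounded_supp_partial_deriv[OF bd, of i]
    by (intro integrable_compact_supp continuous_intros) (auto elim: bounded_subset)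
  have 2: "integrable lborel (\<lambda>x. partial_deriv i f x * g x)"
    using c bd by (intro integrable_compact_supp continuous_intros) (auto elim: bounded_subset)
  have "0 = (\<integral>x. partial_deriv i (\<lambda>x. f x * g x) x \<partial>lborel)"
    by (rule integral_partial_deriv_0[symmetric, OF C_k_mult[OF f g]]) (auto intro: bounded_subset[OF bd])
  also have "\<dots> = (\<integral>x. f x * partial_deriv i g x + partial_deriv i f x * g x \<partial>lborel)"
    using f g by (intro Bochner_Integration.integral_cong refl partial_deriv_mult) auto
  also have "\<dots> = (\<integral>x. f x * partial_deriv i g x \<partial>lborel) + (\<integral>x. partial_deriv i f x * g x \<partial>lborel)"
    using 1 2 by simp
  finally show ?thesis by simp
qed

section \<open>Integrability of radial powers\<close>

text \<open>The sum of the multiples \<open>a j\<close> of the indicators of the balls of radius \<open>r j\<close> dominates \<open>f\<close>, and the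
  integral of this sum is the given series times the volume of the unit ball. With \<open>r j\<close> shrinking this handles a
  singularity at the origin, with \<open>r j\<close> growing the decay at infinity.\<close>

lemma nn_integral_dyadic_finite:
  fixes f :: "'a::euclidean_space \<Rightarrow> real" and a r :: "nat \<Rightarrow> real"
  assumes a: "\<And>j. a j \<ge> 0" and r: "\<And>j. r j \<ge> 0" and sm: "summable (\<lambda>j. a j * r j ^ DIM('a))"
    and cov: "\<And>x. x \<noteq> 0 \<Longrightarrow> f x > 0 \<Longrightarrow> \<exists>j. norm x < r j \<and> f x \<le> a j"
  shows "(\<integral>\<^sup>+x. ennreal (f x) \<partial>lborel) < \<infinity>"
proof -
  have "AE x in lborel. ennreal (f x) \<le> (\<Sum>j. ennreal (a j) * indicator (ball 0 (r j)) x)"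
    using AE_lborel_singleton[of "0::'a"]
  proof eventually_elim
    case (elim x)
    show ?case
    proof (cases "f x > 0")
      case True
      then obtain j where "norm x < r j" "f x \<le> a j" using cov[OF elim] by blast
      then have "ennreal (f x) \<le> ennreal (a j) * indicator (ball 0 (r j)) x" by (simp add: ennreal_leI)
      also have "\<dots> \<le> (\<Sum>j. ennreal (a j) * indicator (ball 0 (r j)) x)"
        using sum_le_suminf[of "\<lambda>j. ennreal (a j) * indicator (ball 0 (r j)) x" "{j}"]
        by (simp only: finite.intros summableI zero_le simp_thms sum.empty empty_iff sum.insert add_0_right)
      finally show ?thesis .
    qed (simp add: ennreal_neg)
  qed
  then have "(\<integral>\<^sup>+x. ennreal (f x) \<partial>lborel) \<le> (\<integral>\<^sup>+x. (\<Sum>j. ennreal (a j) * indicator (ball 0 (r j)) x) \<partial>(lborel::'a measure))"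
    by (rule nn_integral_mono_AE)
  also have "\<dots> = (\<Sum>j. \<integral>\<^sup>+x. ennreal (a j) * indicator (ball 0 (r j)) x \<partial>(lborel::'a measure))"
    by (rule nn_integral_suminf) (intro borel_measurable_times_ennreal borel_measurable_const borel_measurable_indicator, auto)
  also have "\<dots> = (\<Sum>j. ennreal (unit_ball_vol (real DIM('a)) * (a j * r j ^ DIM('a))))"
  proof (intro arg_cong[where f=suminf] ext)
    fix j
    have "(\<integral>\<^sup>+x. ennreal (a j) * indicator (ball 0 (r j)) x \<partial>(lborel::'a measure)) = ennreal (a j) * emeasure lborel (ball (0::'a) (r j))"
      by (rule nn_integral_cmult_indicator) simp
    also have "\<dots> = ennreal (a j) * ennreal (unit_ball_vol (real DIM('a)) * r j ^ DIM('a))"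
      using r by (simp add: emeasure_ball)
    also have "\<dots> = ennreal (unit_ball_vol (real DIM('a)) * (a j * r j ^ DIM('a)))"
      by (subst ennreal_mult'[OF a, symmetric]) (simp add: mult_ac)
    finally show "(\<integral>\<^sup>+x. ennreal (a j) * indicator (ball 0 (r j)) x \<partial>(lborel::'a measure)) =
      ennreal (unit_ball_vol (real DIM('a)) * (a j * r j ^ DIM('a)))" .
  qed
  also have "\<dots> < \<infinity>"
    using a r sm by (subst suminf_ennreal2) (auto intro!: summable_mult)
  finally show ?thesis .
qed

lemma nn_integral_norm_powr_ball:
  fixes R \<alpha> :: real
  assumes "0 \<le> \<alpha>" "\<alpha> < DIM('a::euclidean_space)"
  shows "(\<integral>\<^sup>+x. ennreal (indicator (ball 0 R) x * norm (x::'a) powr - \<alpha>) \<partial>lborel) < \<infinity>"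
proof (cases "R > 0")
  case R: True
  \<comment> \<open>the ratio of the geometric series below\<close>
  have q: "0 < (2::real) powr (\<alpha> - DIM('a))" "(2::real) powr (\<alpha> - DIM('a)) < 1"
    using assms by (auto simp: powr_less_one)
  define r where "r j = R * (1/2) ^ j" for j :: nat
  have r: "r j > 0" for j using R by (simp add: r_def)
  show ?thesis
  proof (rule nn_integral_dyadic_finite[where a="\<lambda>j. (r (Suc j)) powr - \<alpha>" and r=r])
    have "(r (Suc j)) powr - \<alpha> * r j ^ DIM('a) = (R/2) powr -\<alpha> * R ^ DIM('a) * (2 powr (\<alpha> - DIM('a))) ^ j" for j
    proof -
      have "r (Suc j) powr - \<alpha> = (R/2) powr -\<alpha> * ((1/2)^j) powr -\<alpha>"
        using R by (simp add: r_def flip: powr_mult)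
      also have "((1/2::real)^j) powr -\<alpha> = (2 powr \<alpha>) ^ j"
        by (simp add: powr_realpow[symmetric] powr_powr powr_divide powr_minus divide_simps mult.commute)
      finally have 1: "r (Suc j) powr - \<alpha> = (R/2) powr -\<alpha> * (2 powr \<alpha>) ^ j" .
      have 2: "r j ^ DIM('a) = R ^ DIM('a) * ((1/2) ^ DIM('a)) ^ j"
        by (simp add: r_def power_mult_distrib mult.commute flip: power_mult)
      have 3: "2 powr (\<alpha> - DIM('a)) = 2 powr \<alpha> * (1/2::real) ^ DIM('a)"
        by (simp add: powr_diff powr_realpow power_divide)
      show ?thesis unfolding 1 2 3 by (simp add: power_mult_distrib)
    qed
    then show "summable (\<lambda>j. (r (Suc j)) powr - \<alpha> * r j ^ DIM('a))"
      using q by (simp add: summable_mult summable_geometric)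
  next
    fix x :: 'a assume x: "x \<noteq> 0" and "indicator (ball 0 R) x * norm x powr - \<alpha> > 0"
    then have xR: "norm x < R" by (cases "norm x < R") auto
    have "\<exists>n. r n \<le> norm x"
    proof -
      obtain n where "(1/2) ^ n < norm x / R" using real_arch_pow_inv[of "norm x / R" "1/2"] x R by auto
      then show ?thesis using R by (intro exI[of _ n]) (simp add: r_def field_simps)
    qed
    define n where "n = (LEAST n. r n \<le> norm x)"
    have n: "r n \<le> norm x" unfolding n_def by (rule LeastI_ex) fact
    have "n \<noteq> 0" using n xR by (auto simp: r_def intro!: Nat.gr0I)
    then obtain j where j: "n = Suc j" using not0_implies_Suc by blast
    have "norm x < r j" using not_less_Least[of j "\<lambda>n. r n \<le> norm x"] j n_def by (simp add: not_le)
    moreover have "norm x powr - \<alpha> \<le> r (Suc j) powr - \<alpha>"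
      using n j r assms by (intro powr_mono2') auto
    ultimately show "\<exists>j. norm x < r j \<and> indicator (ball 0 R) x * norm x powr - \<alpha> \<le> r (Suc j) powr - \<alpha>"
      using xR by auto
  qed (use r in \<open>auto intro: less_imp_le\<close>)
qed (simp add: ball_empty)

lemma integrable_norm_powr_ball:
  fixes R \<alpha> :: real
  assumes "0 \<le> \<alpha>" "\<alpha> < DIM('a::euclidean_space)"
  shows "integrable lborel (\<lambda>x::'a. indicator (ball 0 R) x * norm x powr - \<alpha>)"
proof (rule integrableI_nonneg)
  show "(\<lambda>x::'a. indicator (ball 0 R) x * norm x powr - \<alpha>) \<in> borel_measurable lborel"
    by (intro borel_measurable_times borel_measurable_indicator powr_real_measurable) auto
qed (use nn_integral_norm_powr_ball[OF assms, of R] in auto)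

lemma integrable_one_plus_norm_powr:
  shows "integrable lborel (\<lambda>x::'a::euclidean_space. ((norm x)\<^sup>2 + 1) powr (- real DIM('a) / 2 - 1))"
proof (rule integrableI_nonneg)
  let ?N = "real DIM('a)"
  define r where "r j = (2::real) ^ j" for j :: nat
  show "(\<integral>\<^sup>+x. ennreal (((norm (x::'a))\<^sup>2 + 1) powr (- ?N / 2 - 1)) \<partial>lborel) < \<infinity>"
  proof (rule nn_integral_dyadic_finite[where a="\<lambda>j. 2 powr (?N + 2) * (r j) powr (- ?N - 2)" and r=r])
    have "2 powr (?N + 2) * (r j) powr (- ?N - 2) * r j ^ DIM('a) = 2 powr (?N + 2) * (1/4) ^ j" for j
    proof -
      have "(r j) powr (- ?N - 2) * r j ^ DIM('a) = (r j) powr (- ?N - 2) * r j powr ?N"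
        by (simp add: powr_realpow r_def)
      also have "\<dots> = r j powr (-2)" by (simp flip: powr_add)
      also have "\<dots> = (1/4)^j"
      proof -
        have "(4::real)^j = (2^j)\<^sup>2" by (simp add: power2_eq_square flip: power_mult_distrib)
        then show ?thesis by (simp add: r_def powr_minus power_divide divide_simps)
      qed
      finally show ?thesis by simp
    qed
    then show "summable (\<lambda>j. 2 powr (?N + 2) * (r j) powr (- ?N - 2) * r j ^ DIM('a))"
      by (simp add: summable_mult summable_geometric mult.assoc)
  next
    fix x :: 'a assume "x \<noteq> 0"
    have ex: "\<exists>n. norm x < r n" unfolding r_def by (rule real_arch_pow) simp
    define n where "n = (LEAST n. norm x < r n)"
    have n: "norm x < r n" unfolding n_def by (rule LeastI_ex) fact
    have "((norm x)\<^sup>2 + 1) powr (- ?N / 2 - 1) \<le> 2 powr (?N + 2) * r n powr (- ?N - 2)"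
    proof -
      have "r n / 2 > 0" by (simp add: r_def)
      have "(r n / 2)\<^sup>2 \<le> (norm x)\<^sup>2 + 1"
      proof (cases n)
        case 0 then show ?thesis by (simp add: r_def power2_eq_square add_increasing)
      next
        case (Suc j)
        have "r j \<le> norm x" using not_less_Least[of j "\<lambda>n. norm x < r n"] Suc n_def by (simp add: not_less)
        then have "(r n / 2)\<^sup>2 \<le> (norm x)\<^sup>2" by (intro power_mono) (auto simp: r_def Suc)
        then show ?thesis by simp
      qed
      then have "((norm x)\<^sup>2 + 1) powr (- ?N / 2 - 1) \<le> ((r n / 2)\<^sup>2) powr (- ?N / 2 - 1)"
        using \<open>r n / 2 > 0\<close> by (intro powr_mono2') auto
      also have "\<dots> = (r n / 2) powr (- ?N - 2)"
        using \<open>r n / 2 > 0\<close> by (simp add: powr_powr algebra_simps flip: powr_numeral)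
      also have "\<dots> = 2 powr (?N + 2) * r n powr (- ?N - 2)"
        by (simp add: powr_divide r_def powr_minus_divide[of 2 "?N+2", simplified] field_simps flip: powr_minus)
      finally show ?thesis .
    qed
    with n show "\<exists>j. norm x < r j \<and> ((norm x)\<^sup>2 + 1) powr (- ?N / 2 - 1) \<le> 2 powr (?N + 2) * r j powr (- ?N - 2)" by blast
  qed (auto simp: r_def)
qed auto

section \<open>The potential representation\<close>

text \<open>The area of the unit sphere, in the form in which it arises here: as the total divergence
  of the field \<open>z * (|z|\<^sup>2 + 1) powr (- N / 2)\<close>, which approaches \<open>z * |z| powr - N\<close> far away from the origin.\<close>

definition newton_const :: "'n::finite itself \<Rightarrow> real" where
  "newton_const _ = real CARD('n) *
     (\<integral>z. ((norm (z::real^'n))\<^sup>2 + 1) powr (- real CARD('n) / 2 - 1) \<partial>lborel)"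

lemma newton_const_pos: "newton_const TYPE('n::finite) > 0"
proof -
  let ?f = "\<lambda>z::real^'n. ((norm z)\<^sup>2 + 1) powr (- real CARD('n) / 2 - 1)"
  have int: "integrable lborel ?f"
    using integrable_one_plus_norm_powr[where 'a="real^'n"] by simp
  have pos: "?f z > 0" for z by (simp add: add_nonneg_pos[THEN less_imp_neq, THEN not_sym])
  have "integral\<^sup>L lborel ?f \<noteq> 0"
  proof
    assume "integral\<^sup>L lborel ?f = 0"
    then have "AE z in lborel. ?f z = 0"
      using integral_nonneg_eq_0_iff_AE[OF int] by simp
    then have "AE z in (lborel :: (real^'n) measure). False"
      by eventually_elim (use pos in \<open>metis less_irrefl\<close>)
    then show False
      using AE_iff_null[of "lborel :: (real^'n) measure" "\<lambda>_. False"] by (simp add: null_sets_def)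
  qed
  moreover have "integral\<^sup>L lborel ?f \<ge> 0" by (rule Bochner_Integration.integral_nonneg) simp
  ultimately have "integral\<^sup>L lborel ?f > 0" by linarith
  then show ?thesis unfolding newton_const_def by (intro mult_pos_pos) auto
qed

text \<open>Integration by parts of \<open>v\<close> against the field \<open>(y - x) * (|y - x|\<^sup>2 + \<epsilon>) powr (- N / 2)\<close>, a
  regularisation of the gradient of the fundamental solution of the Laplacian, whose divergence is
  \<open>N * \<epsilon> * (|y - x|\<^sup>2 + \<epsilon>) powr (- N / 2 - 1)\<close>.\<close>

lemma regularised_representation:
  fixes v :: "real^'n::finite \<Rightarrow> real"
  assumes v: "C_k (Suc 0) v" and bd: "bounded {x. v x \<noteq> 0}" and e: "\<epsilon> > 0"
  defines "N \<equiv> real CARD('n)"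
  shows "(\<integral>y. N * \<epsilon> * reg_powr x \<epsilon> (- N / 2 - 1) y * v y \<partial>lborel) =
    - (\<integral>y. reg_powr x \<epsilon> (- N / 2) y * ((y - x) \<bullet> grad v y) \<partial>lborel)"
proof -
  define g where "g i y = (y $ i - x $ i) * reg_powr x \<epsilon> (- N / 2) y" for i y
  have g: "C_k (Suc 0) (g i)" for i
    unfolding g_def by (intro C_k_mult C_k_coord C_k_reg_powr e)
  have dr: "reg_powr x \<epsilon> b differentiable (at y)" for b y
    by (rule C_k_differentiable[OF C_k_reg_powr[OF e]])
  have pr: "partial_deriv i (reg_powr x \<epsilon> b) y = 2 * b * (y $ i - x $ i) * reg_powr x \<epsilon> (b - 1) y" for i b y
    by (subst partial_deriv_eq[OF has_derivative_reg_powr[OF e]]) (simp add: inner_axis)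
  have dc: "(\<lambda>y. y $ i - x $ i) differentiable (at y)" for i and y :: "real^'n"
    using C_k_coord[of "Suc 0" i "x $ i"] by simp
  have dg: "partial_deriv i (g i) y =
      reg_powr x \<epsilon> (- N / 2) y - N * (y $ i - x $ i)\<^sup>2 * reg_powr x \<epsilon> (- N / 2 - 1) y" for i y
    unfolding g_def by (subst partial_deriv_mult[OF dc dr])
      (simp add: pr partial_deriv_coord power2_eq_square algebra_simps)
  have div: "(\<Sum>i\<in>UNIV. partial_deriv i (g i) y) = N * \<epsilon> * reg_powr x \<epsilon> (- N / 2 - 1) y" for y
  proof -
    let ?A = "(norm (y - x))\<^sup>2 + \<epsilon>"
    have A: "?A > 0" using e by (simp add: add_nonneg_pos)
    have nn: "(\<Sum>i\<in>UNIV. (y $ i - x $ i)\<^sup>2) = (norm (y - x))\<^sup>2"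
      unfolding power2_norm_eq_inner by (simp add: inner_vec_def power2_eq_square)
    have "reg_powr x \<epsilon> (- N / 2) y = ?A * reg_powr x \<epsilon> (- N / 2 - 1) y"
      using A by (simp add: reg_powr_def powr_diff)
    then have "(\<Sum>i\<in>UNIV. partial_deriv i (g i) y) =
       N * (?A * reg_powr x \<epsilon> (- N / 2 - 1) y) - N * (\<Sum>i\<in>UNIV. (y $ i - x $ i)\<^sup>2) * reg_powr x \<epsilon> (- N / 2 - 1) y"
      by (simp add: dg sum_subtractf N_def sum_distrib_left sum_distrib_right)
    also have "\<dots> = N * \<epsilon> * reg_powr x \<epsilon> (- N / 2 - 1) y" unfolding nn by (simp add: algebra_simps)
    finally show ?thesis .
  qed
  have cv: "continuous_on UNIV v" "continuous_on UNIV (partial_deriv i v)" for i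
    using C_k_continuous[OF v] v by auto
  have cg: "continuous_on UNIV (g i)" "continuous_on UNIV (partial_deriv i (g i))" for i
    using C_k_continuous[OF g] g[of i] by auto
  have i1: "integrable lborel (\<lambda>y. partial_deriv i (g i) y * v y)" for i
    using cv cg by (intro integrable_compact_supp continuous_intros) (auto intro: bounded_subset[OF bd])
  have i2: "integrable lborel (\<lambda>y. g i y * partial_deriv i v y)" for i
    using cv cg by (intro integrable_compact_supp continuous_intros)
      (auto intro: bounded_subset[OF bounded_supp_partial_deriv[OF bd, of i]])
  have "(\<integral>y. N * \<epsilon> * reg_powr x \<epsilon> (- N / 2 - 1) y * v y \<partial>lborel) =
      (\<integral>y. (\<Sum>i\<in>UNIV. partial_deriv i (g i) y * v y) \<partial>lborel)"
    by (simp add: div flip: sum_distrib_right)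
  also have "\<dots> = (\<Sum>i\<in>UNIV. \<integral>y. partial_deriv i (g i) y * v y \<partial>lborel)"
    using i1 by (intro Bochner_Integration.integral_sum) auto
  also have "\<dots> = (\<Sum>i\<in>UNIV. - (\<integral>y. g i y * partial_deriv i v y \<partial>lborel))"
    using integral_by_parts[OF g v bd] by simp
  also have "\<dots> = - (\<integral>y. (\<Sum>i\<in>UNIV. g i y * partial_deriv i v y) \<partial>lborel)"
    using i2 by (simp add: Bochner_Integration.integral_sum sum_negf)
  also have "(\<lambda>y. \<Sum>i\<in>UNIV. g i y * partial_deriv i v y) = (\<lambda>y. reg_powr x \<epsilon> (- N / 2) y * ((y - x) \<bullet> grad v y))"
    by (auto simp: fun_eq_iff g_def grad_def inner_vec_def sum_distrib_left mult_ac)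
  finally show ?thesis .
qed

lemma integral_lborel_affine:
  fixes f :: "'a::euclidean_space \<Rightarrow> real"
  assumes [measurable]: "f \<in> borel_measurable borel" and "c > 0"
  shows "(\<integral>x. f x \<partial>lborel) = c ^ DIM('a) * (\<integral>x. f (t + c *\<^sub>R x) \<partial>lborel)"
  using assms(2) by (subst lborel_affine[of c t]) (simp_all add: integral_density integral_distr)

text \<open>The divergences of the regularised fields concentrate at \<open>x\<close>: under the substitution
  \<open>y = x + h * z\<close>, with \<open>\<epsilon> = h\<^sup>2\<close>, the factors \<open>h\<close> cancel and only the argument of \<open>v\<close> still depends on \<open>h\<close>.\<close>

lemma approximate_identity:
  fixes v :: "real^'n::finite \<Rightarrow> real" and h :: "nat \<Rightarrow> real"
  assumes cv: "continuous_on UNIV v" and bd: "bounded {x. v x \<noteq> 0}"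
    and h: "\<And>n. h n > 0" "h \<longlonglongrightarrow> 0"
  defines "N \<equiv> real CARD('n)"
  shows "(\<lambda>n. \<integral>y. N * (h n)\<^sup>2 * reg_powr x ((h n)\<^sup>2) (- N / 2 - 1) y * v y \<partial>lborel)
    \<longlonglongrightarrow> newton_const TYPE('n) * v x"
proof -
  let ?f = "\<lambda>z::real^'n. ((norm z)\<^sup>2 + 1) powr (- N / 2 - 1)"
  have int: "integrable lborel ?f"
    using integrable_one_plus_norm_powr[where 'a="real^'n"] by (simp add: N_def)
  have [measurable]: "v \<in> borel_measurable borel" using cv by (rule borel_measurable_continuous_onI)
  have mr[measurable]: "reg_powr x \<epsilon> b \<in> borel_measurable borel" for \<epsilon> b
    unfolding reg_powr_def[abs_def] by measurable
  obtain M where M: "M > 0" "\<And>x. \<bar>v x\<bar> \<le> M" using bounded_compact_supp[OF cv bd] by metis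
  have eq: "(\<integral>y. N * (h n)\<^sup>2 * reg_powr x ((h n)\<^sup>2) (- N / 2 - 1) y * v y \<partial>lborel) =
    N * (\<integral>z. ?f z * v (x + h n *\<^sub>R z) \<partial>lborel)" for n
  proof -
    have 1: "h n ^ CARD('n) * (N * (h n)\<^sup>2 * reg_powr x ((h n)\<^sup>2) (- N / 2 - 1) (x + h n *\<^sub>R z) * v (x + h n *\<^sub>R z))
       = N * (?f z * v (x + h n *\<^sub>R z))" for z
    proof -
      have "reg_powr x ((h n)\<^sup>2) (- N / 2 - 1) (x + h n *\<^sub>R z) = ((h n)\<^sup>2 * ((norm z)\<^sup>2 + 1)) powr (- N / 2 - 1)"
        by (simp add: reg_powr_def power_mult_distrib algebra_simps)
      also have "\<dots> = ((h n)\<^sup>2) powr (- N / 2 - 1) * ?f z"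
        by (rule powr_mult)
      also have "((h n)\<^sup>2) powr (- N / 2 - 1) = h n powr (- N - 2)"
        using h(1)[of n] by (simp add: powr_powr algebra_simps flip: powr_numeral)
      finally have 2: "reg_powr x ((h n)\<^sup>2) (- N / 2 - 1) (x + h n *\<^sub>R z) = h n powr (- N - 2) * ?f z" .
      have "h n ^ CARD('n) = h n powr N" "(h n)\<^sup>2 = h n powr 2"
        using powr_realpow[OF h(1), of n "CARD('n)"] powr_realpow[OF h(1), of n 2] by (simp_all add: N_def)
      then have "h n ^ CARD('n) * (h n)\<^sup>2 * h n powr (- N - 2) = h n powr (N + 2 + (- N - 2))"
        by (simp only: powr_add)
      also have "\<dots> = 1" using h(1)[of n] by simp
      finally have "h n ^ CARD('n) * (h n)\<^sup>2 * h n powr (- N - 2) = 1" .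
      then show ?thesis unfolding 2 by (simp add: mult_ac)
    qed
    have "(\<integral>y. N * (h n)\<^sup>2 * reg_powr x ((h n)\<^sup>2) (- N / 2 - 1) y * v y \<partial>lborel) = h n ^ CARD('n) *
       (\<integral>z. N * (h n)\<^sup>2 * reg_powr x ((h n)\<^sup>2) (- N / 2 - 1) (x + h n *\<^sub>R z) * v (x + h n *\<^sub>R z) \<partial>lborel)"
      by (subst integral_lborel_affine[OF _ h(1), where t=x]) simp_all
    also have "\<dots> = (\<integral>z. N * (?f z * v (x + h n *\<^sub>R z)) \<partial>lborel)"
      by (subst 1[symmetric]) simp
    finally show ?thesis by simp
  qed
  have "(\<lambda>n. \<integral>z. ?f z * v (x + h n *\<^sub>R z) \<partial>lborel) \<longlonglongrightarrow> (\<integral>z. ?f z * v x \<partial>lborel)"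
  proof (rule integral_dominated_convergence[where w="\<lambda>z. M * ?f z"])
    show "AE z in lborel. (\<lambda>n. ?f z * v (x + h n *\<^sub>R z)) \<longlonglongrightarrow> ?f z * v x"
    proof (intro AE_I2 tendsto_intros)
      fix z
      have "(\<lambda>n. x + h n *\<^sub>R z) \<longlonglongrightarrow> x + 0 *\<^sub>R z" by (intro tendsto_intros h)
      moreover have "isCont v x" using cv by (simp add: continuous_on_eq_continuous_at)
      ultimately show "(\<lambda>n. v (x + h n *\<^sub>R z)) \<longlonglongrightarrow> v x"
        using isCont_tendsto_compose[of x v "\<lambda>n. x + h n *\<^sub>R z" sequentially] by simp
    qed
    show "AE z in lborel. norm (?f z * v (x + h n *\<^sub>R z)) \<le> M * ?f z" for n
      using M by (intro AE_I2) (auto simp: abs_mult mult.commute[of M] intro!: mult_left_mono)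
  qed (use int in auto)
  then show ?thesis unfolding eq newton_const_def by (simp add: N_def tendsto_mult_left mult.assoc)
qed

lemma integrable_shifted_kernel:
  assumes "0 \<le> \<alpha>" "\<alpha> < real DIM('a::euclidean_space)"
  shows "integrable lborel (\<lambda>y::'a. indicator (ball x R) y * norm (y - x) powr - \<alpha>)"
proof -
  have "integrable lborel (\<lambda>y::'a. indicator (ball 0 R) (- x + y) * norm (- x + y) powr - \<alpha>)"
    by (rule integrable_lborel_shift[OF integrable_norm_powr_ball[OF assms]])
  also have "(\<lambda>y::'a. indicator (ball 0 R) (- x + y) * norm (- x + y) powr - \<alpha>) =
     (\<lambda>y. indicator (ball x R) y * norm (y - x) powr - \<alpha>)"
    by (auto simp: fun_eq_iff indicator_def dist_norm norm_minus_commute)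
  finally show ?thesis .
qed

lemma reg_powr_le:
  assumes "\<epsilon> \<ge> 0" "b \<le> 0" "y \<noteq> x"
  shows "reg_powr x \<epsilon> b y \<le> norm (y - x) powr (2 * b)"
proof -
  have "reg_powr x \<epsilon> b y \<le> ((norm (y - x))\<^sup>2) powr b"
    unfolding reg_powr_def using assms by (intro powr_mono2') auto
  also have "\<dots> = norm (y - x) powr (2 * b)"
    using assms by (simp add: powr_powr flip: powr_numeral)
  finally show ?thesis .
qed

lemma tendsto_reg_powr:
  assumes "h \<longlonglongrightarrow> 0" "y \<noteq> x"
  shows "(\<lambda>n. reg_powr x ((h n)\<^sup>2) b y) \<longlonglongrightarrow> norm (y - x) powr (2 * b)"
proof -
  have "(\<lambda>n. ((norm (y - x))\<^sup>2 + (h n)\<^sup>2) powr b) \<longlonglongrightarrow> ((norm (y - x))\<^sup>2 + 0\<^sup>2) powr b"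
    using assms by (intro tendsto_intros) auto
  then show ?thesis using assms by (simp add: reg_powr_def powr_powr flip: powr_numeral)
qed

lemma kernel_bound:
  fixes y x g :: "'a::euclidean_space"
  assumes "k \<ge> 0" "k \<le> norm (y - x) powr - \<beta>" "y \<noteq> x"
  shows "\<bar>k * ((y - x) \<bullet> g)\<bar> \<le> norm (y - x) powr (1 - \<beta>) * norm g"
proof -
  have "\<bar>k * ((y - x) \<bullet> g)\<bar> \<le> norm (y - x) powr - \<beta> * (norm (y - x) * norm g)"
    unfolding abs_mult using assms by (intro mult_mono Cauchy_Schwarz_ineq2) auto
  also have "\<dots> = norm (y - x) powr (1 - \<beta>) * norm g"
    using assms by (simp add: powr_diff powr_minus field_simps)
  finally show ?thesis .
qed

lemma grad_bounded_supp:
  assumes v: "C_k (Suc 0) v" and bd: "bounded {x. v x \<noteq> 0}"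
  obtains M R where "M > 0" "R > 0" "\<And>y. norm (grad v y) \<le> M * indicator (ball x R) y"
proof -
  have c: "continuous_on UNIV (\<lambda>y. norm (grad v y))"
    using continuous_grad[OF v] by (intro continuous_intros)
  have "{y. norm (grad v y) \<noteq> 0} \<subseteq> closure {x. v x \<noteq> 0}"
    using partial_deriv_eq_0[of _ v] by (auto simp: grad_def vec_eq_iff)
  then have bd': "bounded {y. norm (grad v y) \<noteq> 0}"
    using bounded_closure[OF bd] bounded_subset by blast
  obtain M where M: "M > 0" "\<And>y. \<bar>norm (grad v y)\<bar> \<le> M" using bounded_compact_supp[OF c bd'] by metis
  obtain R where R: "R > 0" "\<And>y. norm y > R \<Longrightarrow> norm (grad v y) = 0" using bounded_supp_cball[OF bd'] by metis
  have "norm (grad v y) \<le> M * indicator (ball x (norm x + R + 1)) y" for y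
  proof (cases "y \<in> ball x (norm x + R + 1)")
    case False
    then have "norm (x - y) \<ge> norm x + R + 1" by (simp add: dist_norm)
    then have "norm y > R" using norm_triangle_ineq4[of x y] by linarith
    then show ?thesis using R(2)[of y] M(1) by simp
  qed (use M in simp)
  then show ?thesis using that[of M "norm x + R + 1"] M(1) R(1) by (smt (verit) norm_ge_zero)
qed

text \<open>The limit of \<open>regularised_representation\<close> as \<open>\<epsilon>\<close> tends to zero. The right-hand sides are
  dominated by \<open>|y - x| powr (1 - N)\<close> times the bounded, compactly supported gradient.\<close>

lemma potential_representation:
  fixes v :: "real^'n::finite \<Rightarrow> real"
  assumes v: "C_k (Suc 0) v" and bd: "bounded {x. v x \<noteq> 0}"
  defines "N \<equiv> real CARD('n)"
  shows "integrable lborel (\<lambda>y. norm (y - x) powr - N * ((y - x) \<bullet> grad v y))" (is ?A)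
    and "newton_const TYPE('n) * v x = - (\<integral>y. norm (y - x) powr - N * ((y - x) \<bullet> grad v y) \<partial>lborel)" (is ?B)
proof -
  obtain M R where MR: "M > 0" "R > 0" "\<And>y. norm (grad v y) \<le> M * indicator (ball x R) y"
    using grad_bounded_supp[OF v bd, of x] by metis
  have N: "N \<ge> 1" by (simp add: N_def)
  have [measurable]: "grad v \<in> borel_measurable borel"
    using continuous_grad[OF v] by (rule borel_measurable_continuous_onI)
  have mr[measurable]: "reg_powr x \<epsilon> b \<in> borel_measurable borel" for \<epsilon> b
    unfolding reg_powr_def[abs_def] by measurable
  let ?w = "\<lambda>y. M * (indicator (ball x R) y * norm (y - x) powr - (N - 1))"
  have w: "integrable lborel ?w"
    using N by (intro integrable_mult_right integrable_shifted_kernel) (auto simp: N_def)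
  have bnd: "\<bar>k * ((y - x) \<bullet> grad v y)\<bar> \<le> ?w y" if "k \<ge> 0" "k \<le> norm (y - x) powr - N" "y \<noteq> x" for k y
  proof -
    have "\<bar>k * ((y - x) \<bullet> grad v y)\<bar> \<le> norm (y - x) powr (1 - N) * norm (grad v y)"
      by (rule kernel_bound[OF that])
    also have "\<dots> \<le> norm (y - x) powr (1 - N) * (M * indicator (ball x R) y)"
      by (intro mult_left_mono MR) simp
    finally show ?thesis by (simp add: mult_ac)
  qed
  show ?A
  proof (rule Bochner_Integration.integrable_bound[OF w])
    show "AE y in lborel. norm (norm (y - x) powr - N * ((y - x) \<bullet> grad v y)) \<le> norm (?w y)"
      using AE_lborel_singleton[of x]
    proof eventually_elim
      case (elim y)
      have "\<bar>norm (y - x) powr - N * ((y - x) \<bullet> grad v y)\<bar> \<le> ?w y"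
        using elim by (intro bnd) auto
      then show ?case unfolding real_norm_def by (rule order_trans[OF _ abs_ge_self])
    qed
  qed measurable
  define h :: "nat \<Rightarrow> real" where "h n = inverse (Suc n)" for n
  have h: "0 < h n" for n by (auto simp: h_def field_simps)
  have h0: "h \<longlonglongrightarrow> 0" unfolding h_def by (rule LIMSEQ_inverse_real_of_nat)
  have "(\<lambda>n. \<integral>y. reg_powr x ((h n)\<^sup>2) (- N / 2) y * ((y - x) \<bullet> grad v y) \<partial>lborel) \<longlonglongrightarrow>
     (\<integral>y. norm (y - x) powr - N * ((y - x) \<bullet> grad v y) \<partial>lborel)"
  proof (rule integral_dominated_convergence[OF _ _ w])
    show "AE y in lborel. (\<lambda>n. reg_powr x ((h n)\<^sup>2) (- N / 2) y * ((y - x) \<bullet> grad v y)) \<longlonglongrightarrow>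
      norm (y - x) powr - N * ((y - x) \<bullet> grad v y)"
      using AE_lborel_singleton[of x]
    proof eventually_elim
      case (elim y)
      show ?case using tendsto_reg_powr[OF h0 elim, of "- N / 2"] by (intro tendsto_intros) simp
    qed
    show "AE y in lborel. norm (reg_powr x ((h n)\<^sup>2) (- N / 2) y * ((y - x) \<bullet> grad v y)) \<le> ?w y" for n
      using AE_lborel_singleton[of x]
    proof eventually_elim
      case (elim y)
      show ?case using reg_powr_le[of "(h n)\<^sup>2" "- N / 2" y x] N elim
        unfolding real_norm_def by (intro bnd) (auto simp: reg_powr_def)
    qed
  qed auto
  then have "(\<lambda>n. \<integral>y. N * (h n)\<^sup>2 * reg_powr x ((h n)\<^sup>2) (- N / 2 - 1) y * v y \<partial>lborel) \<longlonglongrightarrow>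
     - (\<integral>y. norm (y - x) powr - N * ((y - x) \<bullet> grad v y) \<partial>lborel)"
    using regularised_representation[OF v bd, of "(h _)\<^sup>2" x] h
    by (simp add: N_def tendsto_minus less_imp_neq[THEN not_sym])
  moreover have "(\<lambda>n. \<integral>y. N * (h n)\<^sup>2 * reg_powr x ((h n)\<^sup>2) (- N / 2 - 1) y * v y \<partial>lborel)
     \<longlonglongrightarrow> newton_const TYPE('n) * v x"
    unfolding N_def using approximate_identity[OF C_k_continuous[OF v] bd h h0] .
  ultimately show ?B using LIMSEQ_unique by blast
qed

lemma potential_bound:
  fixes v :: "real^'n::finite \<Rightarrow> real"
  assumes v: "C_k (Suc 0) v" and bd: "bounded {x. v x \<noteq> 0}"
  shows "ennreal (newton_const TYPE('n) * \<bar>v x\<bar>) \<le>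
    (\<integral>\<^sup>+y. ennreal (norm (y - x) powr (1 - real CARD('n)) * norm (grad v y)) \<partial>lborel)"
proof -
  let ?F = "\<lambda>y. norm (y - x) powr - real CARD('n) * ((y - x) \<bullet> grad v y)"
  have "newton_const TYPE('n) * \<bar>v x\<bar> = \<bar>integral\<^sup>L lborel ?F\<bar>"
  proof -
    have "newton_const TYPE('n) * \<bar>v x\<bar> = \<bar>newton_const TYPE('n) * v x\<bar>"
      using newton_const_pos[where 'n='n] by (simp add: abs_mult)
    then show ?thesis unfolding potential_representation(2)[OF v bd] by simp
  qed
  also have "ennreal \<dots> \<le> (\<integral>\<^sup>+y. ennreal (norm (?F y)) \<partial>lborel)"
    using integral_norm_bound_ennreal[OF potential_representation(1)[OF v bd, of x]] by simp
  also have "\<dots> \<le> (\<integral>\<^sup>+y. ennreal (norm (y - x) powr (1 - real CARD('n)) * norm (grad v y)) \<partial>lborel)"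
  proof (intro nn_integral_mono ennreal_leI)
    fix y show "norm (?F y) \<le> norm (y - x) powr (1 - real CARD('n)) * norm (grad v y)"
      unfolding real_norm_def by (cases "y = x") (simp, intro kernel_bound, auto)
  qed
  finally show ?thesis .
qed

section \<open>The energy\<close>

definition energy_density :: "(real^'n::finite \<Rightarrow> real) \<Rightarrow> real^'n \<Rightarrow> real" where
  "energy_density v y = norm y powr (- (real CARD('n) - 2)) * (norm (grad v y))\<^sup>2"

lemma energy_density_nonneg: "energy_density v y \<ge> 0" by (simp add: energy_density_def)

lemma borel_measurable_C0_inf:
  assumes "v \<in> C0_inf \<Omega>"
  shows "v \<in> borel_measurable borel" "grad v \<in> borel_measurable borel"
  using C0_inf_D(7,8)[OF assms] by (auto intro: borel_measurable_continuous_onI)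

lemma borel_measurable_energy_density:
  assumes "v \<in> C0_inf \<Omega>"
  shows "energy_density v \<in> borel_measurable borel"
  using borel_measurable_C0_inf(2)[OF assms] unfolding energy_density_def[abs_def] by measurable

lemma bounded_supp_C0_inf: "v \<in> C0_inf \<Omega> \<Longrightarrow> bounded {x. v x \<noteq> 0}"
  using C0_inf_D(2)[of v \<Omega>] compact_imp_bounded bounded_subset closure_subset by blast

lemma integrable_energy_density:
  fixes v :: "real^'n::finite \<Rightarrow> real"
  assumes v: "v \<in> C0_inf \<Omega>" and N: "CARD('n) \<ge> 3"
  shows "integrable lborel (energy_density v)"
proof -
  obtain M R where MR: "M > 0" "\<And>y. norm (grad v y) \<le> M * indicator (ball 0 R) y"
    using grad_bounded_supp[OF C0_inf_D(1)[OF v] bounded_supp_C0_inf[OF v], of 0] by metis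
  show ?thesis
  proof (rule Bochner_Integration.integrable_bound)
    show "integrable lborel (\<lambda>y::real^'n. M\<^sup>2 * (indicator (ball 0 R) y * norm y powr - (real CARD('n) - 2)))"
      using N by (intro integrable_mult_right integrable_norm_powr_ball) auto
    show "energy_density v \<in> borel_measurable lborel" using borel_measurable_energy_density[OF v] by simp
    show "AE y in lborel. norm (energy_density v y) \<le> norm (M\<^sup>2 * (indicator (ball 0 R) y * norm y powr - (real CARD('n) - 2)))"
    proof (intro AE_I2)
      fix y
      have "(norm (grad v y))\<^sup>2 \<le> (M * indicator (ball 0 R) y)\<^sup>2"
        by (intro power_mono MR) simp
      also have "\<dots> = M\<^sup>2 * indicator (ball 0 R) y" by (simp add: power_mult_distrib indicator_def)
      finally have "norm y powr (- (real CARD('n) - 2)) * (norm (grad v y))\<^sup>2 \<le>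
        norm y powr (- (real CARD('n) - 2)) * (M\<^sup>2 * indicator (ball 0 R) y)" by (intro mult_left_mono) simp_all
      then show "norm (energy_density v y) \<le> norm (M\<^sup>2 * (indicator (ball 0 R) y * norm y powr - (real CARD('n) - 2)))"
        by (simp add: energy_density_def abs_mult mult_ac)
    qed
  qed
qed

lemma norm_Ht_eq:
  fixes v :: "real^'n::finite \<Rightarrow> real"
  assumes v: "v \<in> C0_inf \<Omega>"
  shows "norm_Ht \<Omega> v = sqrt (\<integral>y. energy_density v y \<partial>lborel)"
proof -
  have "(LINT x:\<Omega>|lebesgue. norm x powr (- (real CARD('n) - 2)) * (norm (grad v x))\<^sup>2) = (\<integral>y. energy_density v y \<partial>lebesgue)"
    unfolding set_lebesgue_integral_def using C0_inf_D(5)[OF v]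
    by (intro Bochner_Integration.integral_cong) (auto simp: energy_density_def indicator_def)
  also have "\<dots> = (\<integral>y. energy_density v y \<partial>lborel)"
    using borel_measurable_energy_density[OF v] by (simp add: integral_completion)
  finally show ?thesis unfolding norm_Ht_def by (rule arg_cong)
qed

lemma norm_Ht_square:
  fixes v :: "real^'n::finite \<Rightarrow> real"
  assumes v: "v \<in> C0_inf \<Omega>"
  shows "(norm_Ht \<Omega> v)\<^sup>2 = (\<integral>y. energy_density v y \<partial>lborel)" "norm_Ht \<Omega> v \<ge> 0"
proof -
  have "0 \<le> (\<integral>y. energy_density v y \<partial>lborel)"
    by (rule Bochner_Integration.integral_nonneg) (rule energy_density_nonneg)
  then show "(norm_Ht \<Omega> v)\<^sup>2 = (\<integral>y. energy_density v y \<partial>lborel)" "norm_Ht \<Omega> v \<ge> 0"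
    unfolding norm_Ht_eq[OF v] by simp_all
qed

lemma nn_integral_energy_density:
  fixes v :: "real^'n::finite \<Rightarrow> real"
  assumes v: "v \<in> C0_inf \<Omega>" and N: "CARD('n) \<ge> 3"
  shows "(\<integral>\<^sup>+y. ennreal (energy_density v y) \<partial>lborel) = ennreal ((norm_Ht \<Omega> v)\<^sup>2)"
  unfolding norm_Ht_square[OF v]
  by (intro nn_integral_eq_integral integrable_energy_density[OF v N]) (simp add: energy_density_nonneg)

section \<open>The weighted Sobolev inequality\<close>

text \<open>Hoelder's inequality with the exponents \<open>2\<close>, \<open>q\<close> and \<open>2 q / (q - 2)\<close> for the factorisation
  \<open>\<kappa> h = \<mu> powr (1/2) * (\<kappa> * \<mu> powr (- 1/2) * h powr (2/q)) * h powr (1 - 2/q)\<close>, in its pointwise form with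
  a free scaling parameter \<open>l\<close>. Choosing \<open>l\<close> after integration gives back the product form.\<close>

lemma three_factor_young:
  fixes q l \<kappa> \<mu> h :: real
  assumes q: "q \<ge> 2" and l: "l > 0" and k: "\<kappa> \<ge> 0" and m: "\<mu> \<ge> 0" "\<mu> = 0 \<Longrightarrow> \<kappa> = 0" and h: "h \<ge> 0"
  shows "\<kappa> * h \<le> l * \<mu> + l * h\<^sup>2 + l powr (1 - q) * ((\<kappa> powr q * \<mu> powr (- q / 2)) * h\<^sup>2)"
proof -
  have third: "l powr (1 - q) * ((\<kappa> powr q * \<mu> powr (- q / 2)) * h\<^sup>2) \<ge> 0" by simp
  consider "\<kappa> * h \<le> l * \<mu>" | "\<kappa> \<le> l * h" | "\<kappa> * h > l * \<mu>" "\<kappa> > l * h" by linarith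
  then show ?thesis
  proof cases
    case 1 then show ?thesis using third l by (smt (verit) mult_nonneg_nonneg zero_le_power2)
  next
    case 2
    then have "\<kappa> * h \<le> l * h\<^sup>2" using h by (simp add: power2_eq_square mult_right_mono mult.assoc[symmetric])
    then show ?thesis using third l m(1) by (smt (verit) mult_nonneg_nonneg)
  next
    case 3
    have "\<kappa> > 0" using 3(2) l h by (smt (verit) mult_nonneg_nonneg)
    have "h > 0" using 3(1) l m(1) h \<open>\<kappa> > 0\<close> by (smt (verit) mult_nonneg_nonneg mult_eq_0_iff)
    have "\<mu> > 0" using m \<open>\<kappa> > 0\<close> by (smt (verit))
    define t where "t = \<kappa> / l"
    have t: "t > 0" "t * h > \<mu>" "t > h" using 3 l \<open>\<kappa> > 0\<close> by (simp_all add: t_def field_simps)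
    have kap: "\<kappa> = l * t" using l by (simp add: t_def)
    have "t * h \<le> t powr (q/2) * h powr (2 - q/2)"
    proof -
      have "1 \<le> (t / h) powr (q/2 - 1)" using t \<open>h > 0\<close> q by (intro ge_one_powr_ge_zero) auto
      then have "t * h * 1 \<le> t * h * (t / h) powr (q/2 - 1)" using t \<open>h > 0\<close> by (intro mult_left_mono) auto
      also have "\<dots> = t powr (q/2) * h powr (2 - q/2)"
      proof -
        have "(t / h) powr (q/2 - 1) = t powr (q/2 - 1) * h powr (1 - q/2)"
        proof -
          have "h powr (1 - q/2) = inverse (h powr (q/2 - 1))" by (subst powr_minus[symmetric]) simp
          moreover have "(t / h) powr (q/2 - 1) = t powr (q/2 - 1) / h powr (q/2 - 1)"
            using t \<open>h > 0\<close> by (simp add: powr_divide)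
          ultimately show ?thesis by (simp only: divide_inverse)
        qed
        then have "t * h * (t / h) powr (q/2 - 1) = (t powr 1 * t powr (q/2 - 1)) * (h powr 1 * h powr (1 - q/2))"
          using t \<open>h > 0\<close> by (simp only: powr_one mult_ac less_imp_le)
        also have "\<dots> = t powr (q/2) * h powr (2 - q/2)" by (simp only: powr_add[symmetric]) simp
        finally show ?thesis .
      qed
      finally show ?thesis by simp
    qed
    also have "\<dots> = t powr q * ((t * h) powr (- q/2) * h\<^sup>2)"
    proof -
      have "t powr q * ((t * h) powr (- q/2) * h\<^sup>2) = (t powr q * t powr (- q/2)) * (h powr (- q/2) * h powr 2)"
        using t \<open>h > 0\<close> by (simp add: powr_mult)
      also have "\<dots> = t powr (q/2) * h powr (2 - q/2)" by (simp flip: powr_add)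
      finally show ?thesis by simp
    qed
    also have "\<dots> \<le> t powr q * (\<mu> powr (- q/2) * h\<^sup>2)"
      using t \<open>\<mu> > 0\<close> q by (intro mult_left_mono mult_right_mono powr_mono2') auto
    finally have *: "t * h \<le> t powr q * (\<mu> powr (- q/2) * h\<^sup>2)" .
    have "\<kappa> * h = l * (t * h)" by (simp add: kap)
    also have "\<dots> \<le> l * (t powr q * (\<mu> powr (- q/2) * h\<^sup>2))" using * l by (intro mult_left_mono) auto
    also have "\<dots> = l powr (1 - q) * ((\<kappa> powr q * \<mu> powr (- q / 2)) * h\<^sup>2)"
    proof -
      have "l powr (1 - q) * (l * t) powr q = (l powr (1 - q) * l powr q) * t powr q" by (simp add: powr_mult)
      also have "l powr (1 - q) * l powr q = l" using l by (simp flip: powr_add)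
      finally show ?thesis by (simp add: kap mult_ac)
    qed
    finally show ?thesis using l m(1) by (smt (verit) mult_nonneg_nonneg zero_le_power2)
  qed
qed

text \<open>The power \<open>\<kappa> powr q * \<mu> powr (- q / 2)\<close> of the kernel that comes out of \<open>three_factor_young\<close> is of
  this form. The factor \<open>norm y powr A\<close> compensates the singularity at the origin up to powers of
  the distance, so that only singularities of the one order \<open>\<gamma>\<close> remain.\<close>

lemma kernel_quotient_bound:
  fixes x y :: "'a::real_normed_vector"
  assumes "x \<noteq> 0" "A \<ge> 0" "A \<le> \<gamma>"
  shows "norm x powr - A * norm y powr A * norm (y - x) powr - \<gamma>
     \<le> 2 powr A * (2 * norm (y - x) powr - \<gamma> + norm x powr - \<gamma>)"
proof (cases "y = x")
  case False
  let ?x = "norm x" and ?d = "norm (y - x)"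
  have pos: "?x > 0" "?d > 0" using assms False by auto
  have 1: "norm y powr A \<le> 2 powr A * (?x powr A + ?d powr A)"
  proof -
    have "norm y \<le> ?x + ?d" using norm_triangle_ineq[of x "y - x"] by simp
    then have "norm y \<le> 2 * max ?x ?d" by linarith
    then have "norm y powr A \<le> (2 * max ?x ?d) powr A" using assms by (intro powr_mono2) auto
    also have "\<dots> = 2 powr A * (max ?x ?d powr A)" by (simp add: powr_mult)
    also have "max ?x ?d powr A \<le> ?x powr A + ?d powr A" by (simp add: max_def)
    finally show ?thesis by simp
  qed
  have 2: "?x powr - A * ?d powr (A - \<gamma>) \<le> ?x powr - \<gamma> + ?d powr - \<gamma>"
  proof (cases "?x \<le> ?d")
    case True
    have "?d powr (A - \<gamma>) \<le> ?x powr (A - \<gamma>)" using True pos assms by (intro powr_mono2') auto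
    then have "?x powr - A * ?d powr (A - \<gamma>) \<le> ?x powr - A * ?x powr (A - \<gamma>)" by (intro mult_left_mono) auto
    also have "\<dots> = ?x powr - \<gamma>" by (simp flip: powr_add)
    finally show ?thesis by (smt (verit) powr_ge_zero)
  next
    case False
    have "?x powr - A \<le> ?d powr - A" using False pos assms by (intro powr_mono2') auto
    then have "?x powr - A * ?d powr (A - \<gamma>) \<le> ?d powr - A * ?d powr (A - \<gamma>)" by (intro mult_right_mono) auto
    also have "\<dots> = ?d powr - \<gamma>" by (simp flip: powr_add)
    finally show ?thesis by (smt (verit) powr_ge_zero)
  qed
  have "?x powr - A * norm y powr A * ?d powr - \<gamma> \<le> ?x powr - A * (2 powr A * (?x powr A + ?d powr A)) * ?d powr - \<gamma>"
    using 1 by (intro mult_right_mono mult_left_mono) auto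
  also have "\<dots> = 2 powr A * ((?x powr - A * ?x powr A) * ?d powr - \<gamma> + ?x powr - A * (?d powr A * ?d powr - \<gamma>))"
    by (simp add: algebra_simps)
  also have "\<dots> = 2 powr A * (?d powr - \<gamma> + ?x powr - A * ?d powr (A - \<gamma>))"
    using pos by (simp flip: powr_add)
  also have "\<dots> \<le> 2 powr A * (?d powr - \<gamma> + (?x powr - \<gamma> + ?d powr - \<gamma>))"
    using 2 by (intro mult_left_mono add_left_mono) auto
  finally show ?thesis by simp
qed simp

lemma nn_integral_shifted_kernel_le:
  fixes y :: "'a::euclidean_space" and k :: "'a \<Rightarrow> real"
  assumes k: "k \<in> borel_measurable borel" and y: "y \<in> ball 0 R"
  shows "(\<integral>\<^sup>+x. ennreal (indicator (ball 0 R) x * k (x - y)) \<partial>lborel) \<le>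
     (\<integral>\<^sup>+x. ennreal (indicator (ball 0 (2 * R)) x * k x) \<partial>lborel)"
proof -
  let ?g = "\<lambda>x. ennreal (indicator (ball 0 (2 * R)) x * k x)"
  have meas: "?g \<in> borel_measurable borel"
    using k by (intro measurable_compose[OF _ measurable_ennreal] borel_measurable_times borel_measurable_indicator) auto
  have "(\<integral>\<^sup>+x. ennreal (indicator (ball 0 R) x * k (x - y)) \<partial>lborel) \<le> (\<integral>\<^sup>+x. ?g (- y + x) \<partial>lborel)"
  proof (rule nn_integral_mono)
    fix x :: 'a
    have "norm (x - y) < 2 * R" if "norm x < R" using that y norm_triangle_ineq4[of x y] by simp
    then show "ennreal (indicator (ball 0 R) x * k (x - y)) \<le> ?g (- y + x)"
      by (auto simp: indicator_def)
  qed
  also have "\<dots> = (\<integral>\<^sup>+x. ?g x \<partial>distr lborel borel ((+) (- y)))"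
    by (rule nn_integral_distr[symmetric]) (use meas in auto)
  also have "\<dots> = (\<integral>\<^sup>+x. ?g x \<partial>lborel)" unfolding lborel_distr_plus ..
  finally show ?thesis .
qed

text \<open>With \<open>h = |y| powr - a * |grad v|\<close>, the potential representation bounds \<open>c * |u(x)|\<close> by the integral of
  \<open>\<kappa> x y * h y\<close>. The auxiliary kernel \<open>\<mu>\<close> is barely integrable (its order stays below the critical \<open>N\<close> by
  \<open>\<delta>\<close>), and \<open>three_factor_young\<close> then bounds \<open>|u(x)|\<close> to the power \<open>q\<close>, up to a constant, by
  the integral of \<open>W x y * (h y)\<^sup>2\<close>.
  Integrating in \<open>x\<close> first, the inner integral of \<open>W\<close> is bounded uniformly in \<open>y\<close>, and the
  integral of \<open>h\<^sup>2\<close> is the energy.\<close>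

lemma weighted_Sobolev_bound:
  fixes \<Omega> :: "(real^'n::finite) set"
  defines "N \<equiv> real CARD('n)"
  assumes N3: "CARD('n) \<ge> 3" and \<Omega>: "\<Omega> \<subseteq> ball 0 R" and q: "2 \<le> q" "q < 2 * N / (N - 2)"
  shows "\<exists>C\<ge>0. \<forall>v\<in>C0_inf \<Omega>. norm_Ht \<Omega> v \<le> 1 \<longrightarrow>
    (\<integral>\<^sup>+x. ennreal ((norm x powr (- (N - 2) / 2) * \<bar>v x\<bar>) powr q) \<partial>lborel) \<le> ennreal C"
proof -
  have N: "N \<ge> 3" using N3 by (simp add: N_def)
  define a where "a = (N - 2) / 2"
  \<comment> \<open>half of the room that the subcritical \<open>q\<close> leaves; it makes the exponent \<open>\<gamma>\<close> below less than \<open>N\<close>\<close>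
  define \<delta> where "\<delta> = (2 * N / q - (N - 2)) / 2"
  have qN: "q * (N - 2) < 2 * N" using q N by (simp add: field_simps)
  have d: "\<delta> > 0" "\<delta> < N"
  proof -
    show "\<delta> > 0" using q(1) qN by (simp add: \<delta>_def field_simps)
    have "2 * N / q \<le> N" using q(1) N by (simp add: field_simps)
    then show "\<delta> < N" using N by (simp add: \<delta>_def)
  qed
  define A where "A = a * q"
  define \<gamma> where "\<gamma> = A + \<delta> * q / 2"
  have A: "A \<ge> 0" "A \<le> \<gamma>" using d(1) q(1) N by (auto simp: A_def \<gamma>_def a_def)
  have g: "\<gamma> < N"
  proof -
    have "\<delta> * q = (2 * N - (N - 2) * q) / 2" using q(1) by (simp add: \<delta>_def field_simps)
    then show ?thesis using qN by (simp add: \<gamma>_def A_def a_def field_simps)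
  qed
  define ib :: "real^'n \<Rightarrow> real" where "ib = indicator (ball 0 R)"
  have ib01: "ib x = 0 \<or> ib x = 1" "ib x \<ge> 0" for x by (auto simp: ib_def indicator_def)
  have ibm[measurable]: "ib \<in> borel_measurable borel" unfolding ib_def by (intro borel_measurable_indicator) auto
  define J where "J \<alpha> = enn2real (\<integral>\<^sup>+x. ennreal (indicator (ball 0 (2 * R)) (x::real^'n) * norm x powr - \<alpha>) \<partial>lborel)" for \<alpha>
  have J: "(\<integral>\<^sup>+x. ennreal (ib x * norm (x - y) powr - \<alpha>) \<partial>lborel) \<le> ennreal (J \<alpha>)"
    if "y \<in> ball 0 R" "0 \<le> \<alpha>" "\<alpha> < N" for y \<alpha>
  proof -
    have "ennreal (J \<alpha>) = (\<integral>\<^sup>+x. ennreal (indicator (ball 0 (2 * R)) (x::real^'n) * norm x powr - \<alpha>) \<partial>lborel)"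
      unfolding J_def using that nn_integral_norm_powr_ball[where 'a="real^'n", of \<alpha> "2 * R"]
      by (intro ennreal_enn2real) (auto simp: N_def)
    with nn_integral_shifted_kernel_le[OF _ that(1), of "\<lambda>z. norm z powr - \<alpha>"] show ?thesis by (simp add: ib_def)
  qed
  have Jpos: "J \<alpha> \<ge> 0" for \<alpha> by (simp add: J_def)
  define c where "c = newton_const TYPE('n)"
  have c: "c > 0" unfolding c_def by (rule newton_const_pos)
  define K where "K = J (N - \<delta>) + 1"
  have K: "K \<ge> 1" using Jpos by (simp add: K_def)
  define \<kappa> where "\<kappa> x y = norm x powr - a * norm y powr a * norm (y - x) powr (1 - N)" for x y :: "real^'n"
  define \<mu> where "\<mu> x y = norm (y - x) powr - (N - \<delta>)" for x y :: "real^'n"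
  define W where "W x y = \<kappa> x y powr q * \<mu> x y powr (- q / 2)" for x y
  have [measurable]: "(\<lambda>(x, y). W x y) \<in> borel_measurable (borel \<Otimes>\<^sub>M borel)"
    unfolding W_def \<kappa>_def \<mu>_def by measurable
  have [measurable]: "W x \<in> borel_measurable borel" "(\<lambda>x. W x y) \<in> borel_measurable borel"
     "\<mu> x \<in> borel_measurable borel" for x y
    unfolding W_def[abs_def] \<kappa>_def[abs_def] \<mu>_def[abs_def] by measurable
  have Wpos: "W x y \<ge> 0" for x y by (simp add: W_def)
  have W: "W x y \<le> 2 powr A * (2 * norm (x - y) powr - \<gamma> + norm x powr - \<gamma>)" if "x \<noteq> 0" for x y
  proof -
    have "W x y = norm x powr - A * norm y powr A * (norm (y - x) powr ((1 - N) * q) * norm (y - x) powr ((N - \<delta>) * q / 2))"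
    proof -
      have "\<mu> x y powr (- q / 2) = norm (y - x) powr ((N - \<delta>) * q / 2)"
        unfolding \<mu>_def powr_powr by (rule arg_cong2[where f="(powr)"]) (simp_all add: field_simps)
      moreover have "\<kappa> x y powr q = norm x powr - A * norm y powr A * norm (y - x) powr ((1 - N) * q)"
        by (simp add: \<kappa>_def powr_mult powr_powr A_def)
      ultimately show ?thesis by (simp add: W_def)
    qed
    also have "norm (y - x) powr ((1 - N) * q) * norm (y - x) powr ((N - \<delta>) * q / 2) = norm (y - x) powr - \<gamma>"
      unfolding powr_add[symmetric] by (rule arg_cong2[where f="(powr)"]) (simp_all add: \<gamma>_def A_def a_def field_simps)
    also have "norm x powr - A * norm y powr A * norm (y - x) powr - \<gamma> \<le> 2 powr A * (2 * norm (y - x) powr - \<gamma> + norm x powr - \<gamma>)"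
      by (rule kernel_quotient_bound[OF that A])
    finally show ?thesis by (simp add: norm_minus_commute)
  qed
  define D where "D = 2 powr A * (2 * J \<gamma> + J \<gamma>)"
  have Dpos: "D \<ge> 0" using Jpos by (simp add: D_def)
  have intW: "(\<integral>\<^sup>+x. ennreal (ib x) * ennreal (W x y) \<partial>lborel) \<le> ennreal D" if y: "y \<in> ball 0 R" for y
  proof -
    have R: "0 \<in> ball (0::real^'n) R" using y by (auto intro: le_less_trans[OF norm_ge_zero])
    have "(\<integral>\<^sup>+x. ennreal (ib x) * ennreal (W x y) \<partial>lborel) \<le>
      (\<integral>\<^sup>+x. ennreal (2 powr A) * (2 * ennreal (ib x * norm (x - y) powr - \<gamma>) + ennreal (ib x * norm (x - 0) powr - \<gamma>)) \<partial>lborel)"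
    proof (rule nn_integral_mono_AE)
      show "AE x in lborel. ennreal (ib x) * ennreal (W x y) \<le>
         ennreal (2 powr A) * (2 * ennreal (ib x * norm (x - y) powr - \<gamma>) + ennreal (ib x * norm (x - 0) powr - \<gamma>))"
        using AE_lborel_singleton[of "0::real^'n"]
      proof eventually_elim
        case (elim x)
        have "ennreal (ib x) * ennreal (W x y) = ennreal (ib x * W x y)" using ib01 by (simp add: ennreal_mult')
        also have "\<dots> \<le> ennreal (ib x * (2 powr A * (2 * norm (x - y) powr - \<gamma> + norm x powr - \<gamma>)))"
          using W[OF elim, of y] ib01 by (intro ennreal_leI mult_left_mono) auto
        also have "ib x * (2 powr A * (2 * norm (x - y) powr - \<gamma> + norm x powr - \<gamma>)) =
           2 powr A * (2 * (ib x * norm (x - y) powr - \<gamma>) + ib x * norm (x - 0) powr - \<gamma>)" by (simp add: algebra_simps)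
        also have "ennreal \<dots> = ennreal (2 powr A) * (2 * ennreal (ib x * norm (x - y) powr - \<gamma>) + ennreal (ib x * norm (x - 0) powr - \<gamma>))"
          using ib01(2)[of x] by (simp add: ennreal_mult ennreal_plus)
        finally show ?case .
      qed
    qed
    also have "\<dots> = ennreal (2 powr A) * (2 * (\<integral>\<^sup>+x. ennreal (ib x * norm (x - y) powr - \<gamma>) \<partial>lborel)
        + (\<integral>\<^sup>+x. ennreal (ib x * norm (x - 0) powr - \<gamma>) \<partial>lborel))"
      by (simp add: nn_integral_cmult nn_integral_add)
    also have "\<dots> \<le> ennreal (2 powr A) * (2 * ennreal (J \<gamma>) + ennreal (J \<gamma>))"
      using A g by (intro mult_left_mono add_mono J y R) auto
    also have "\<dots> = ennreal D"
    proof -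
      have "2 * ennreal (J \<gamma>) = ennreal (2 * J \<gamma>)" using Jpos by (simp add: ennreal_mult)
      then have "2 * ennreal (J \<gamma>) + ennreal (J \<gamma>) = ennreal (2 * J \<gamma> + J \<gamma>)"
        using ennreal_plus[of "2 * J \<gamma>" "J \<gamma>"] Jpos[of \<gamma>] by simp
      then show ?thesis unfolding D_def by (simp only: ennreal_mult'[OF powr_ge_zero])
    qed
    finally show ?thesis .
  qed
  define C where "C = (2 * (2 * K) powr (q - 1)) * D / c powr q"
  have Cpos: "C \<ge> 0" using Dpos by (simp add: C_def)
  have "(\<integral>\<^sup>+x. ennreal ((norm x powr (- (N - 2) / 2) * \<bar>v x\<bar>) powr q) \<partial>lborel) \<le> ennreal C"
    if v: "v \<in> C0_inf \<Omega>" and v1: "norm_Ht \<Omega> v \<le> 1" for v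
  proof -
    have [measurable]: "v \<in> borel_measurable borel" "grad v \<in> borel_measurable borel"
      using borel_measurable_C0_inf[OF v] by auto
    define h where "h y = norm y powr - a * norm (grad v y)" for y
    have [measurable]: "h \<in> borel_measurable borel" unfolding h_def[abs_def] by measurable
    have hpos: "h y \<ge> 0" for y by (simp add: h_def)
    have h2: "(h y)\<^sup>2 = energy_density v y" for y
      by (cases "y = 0") (auto simp: h_def energy_density_def power_mult_distrib power2_eq_square[of "_ powr _"] a_def N_def simp flip: powr_add)
    have E1: "(\<integral>\<^sup>+y. ennreal ((h y)\<^sup>2) \<partial>lborel) \<le> 1"
    proof -
      have "(norm_Ht \<Omega> v)\<^sup>2 \<le> 1" using v1 norm_Ht_square(2)[OF v] by (simp add: power_le_one)
      then have "ennreal ((norm_Ht \<Omega> v)\<^sup>2) \<le> ennreal 1" by (rule ennreal_leI)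
      then show ?thesis using nn_integral_energy_density[OF v N3] by (simp add: h2)
    qed
    define P where "P x = c * (norm x powr - a * \<bar>v x\<bar>)" for x
    have Ppos: "P x \<ge> 0" for x using c by (simp add: P_def)
    define Q where "Q x = (\<integral>\<^sup>+y. ennreal (ib y * W x y * (h y)\<^sup>2) \<partial>lborel)" for x
    have Pbd: "ennreal (P x powr q) \<le> ennreal (2 * (2 * K) powr (q - 1)) * Q x" if x: "x \<in> ball 0 R" for x
    proof (cases "P x > 0")
      case True
      then have x0: "x \<noteq> 0" by (auto simp: P_def)
      \<comment> \<open>with this choice the first two terms of \<open>three_factor_young\<close> integrate to at most half of \<open>P x\<close>\<close>
      define l where "l = P x / (2 * K)"
      have l: "l > 0" using True K by (simp add: l_def)
      have "ennreal (P x) = ennreal (norm x powr - a) * ennreal (c * \<bar>v x\<bar>)"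
        using c by (simp add: P_def mult_ac flip: ennreal_mult')
      also have "\<dots> \<le> ennreal (norm x powr - a) * (\<integral>\<^sup>+y. ennreal (norm (y - x) powr (1 - N) * norm (grad v y)) \<partial>lborel)"
        unfolding c_def N_def by (intro mult_left_mono potential_bound[OF C0_inf_D(1)[OF v] bounded_supp_C0_inf[OF v]]) simp
      also have "\<dots> = (\<integral>\<^sup>+y. ennreal (norm x powr - a * (norm (y - x) powr (1 - N) * norm (grad v y))) \<partial>lborel)"
        by (subst nn_integral_cmult[symmetric]) (auto simp: ennreal_mult')
      also have "\<dots> \<le> (\<integral>\<^sup>+y. ennreal l * ennreal (ib y * norm (y - x) powr - (N - \<delta>)) + ennreal l * ennreal ((h y)\<^sup>2)
          + ennreal (l powr (1 - q)) * ennreal (ib y * W x y * (h y)\<^sup>2) \<partial>lborel)"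
      proof (rule nn_integral_mono_AE)
        show "AE y in lborel. ennreal (norm x powr - a * (norm (y - x) powr (1 - N) * norm (grad v y))) \<le>
          ennreal l * ennreal (ib y * norm (y - x) powr - (N - \<delta>)) + ennreal l * ennreal ((h y)\<^sup>2)
          + ennreal (l powr (1 - q)) * ennreal (ib y * W x y * (h y)\<^sup>2)"
          using AE_lborel_singleton[of "0::real^'n"]
        proof eventually_elim
          case (elim y)
          have "norm x powr - a * (norm (y - x) powr (1 - N) * norm (grad v y)) \<le>
            l * (ib y * \<mu> x y) + l * (h y)\<^sup>2 + l powr (1 - q) * (ib y * W x y * (h y)\<^sup>2)"
          proof (cases "y \<in> ball 0 R")
            case True
            have "norm x powr - a * (norm (y - x) powr (1 - N) * norm (grad v y)) = \<kappa> x y * h y"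
              using elim by (simp add: \<kappa>_def h_def powr_minus field_simps)
            also have "\<dots> \<le> l * \<mu> x y + l * (h y)\<^sup>2 + l powr (1 - q) * ((\<kappa> x y powr q * \<mu> x y powr (- q / 2)) * (h y)\<^sup>2)"
              by (rule three_factor_young[OF q(1) l _ _ _ hpos]) (auto simp: \<kappa>_def \<mu>_def)
            finally show ?thesis using True by (simp add: W_def ib_def)
          next
            case False
            then have "grad v y = 0" using C0_inf_D(5)[OF v, of y] \<Omega> by blast
            then show ?thesis using False l by (simp add: ib_def)
          qed
          then have "ennreal (norm x powr - a * (norm (y - x) powr (1 - N) * norm (grad v y))) \<le>
            ennreal (l * (ib y * \<mu> x y) + l * (h y)\<^sup>2 + l powr (1 - q) * (ib y * W x y * (h y)\<^sup>2))"
            by (rule ennreal_leI)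
          also have "\<dots> = ennreal l * ennreal (ib y * \<mu> x y) + ennreal l * ennreal ((h y)\<^sup>2)
             + ennreal (l powr (1 - q)) * ennreal (ib y * W x y * (h y)\<^sup>2)"
            using l ib01(2)[of y] Wpos[of x y] by (simp add: ennreal_mult ennreal_plus \<mu>_def)
          finally show ?case by (simp add: \<mu>_def)
        qed
      qed
      also have "\<dots> = ennreal l * (\<integral>\<^sup>+y. ennreal (ib y * norm (y - x) powr - (N - \<delta>)) \<partial>lborel)
          + ennreal l * (\<integral>\<^sup>+y. ennreal ((h y)\<^sup>2) \<partial>lborel) + ennreal (l powr (1 - q)) * Q x"
        unfolding Q_def by (simp add: nn_integral_add nn_integral_cmult)
      also have "\<dots> \<le> ennreal l * ennreal (J (N - \<delta>)) + ennreal l * 1 + ennreal (l powr (1 - q)) * Q x"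
        using d by (intro add_mono mult_left_mono E1 J x order_refl) auto
      also have "ennreal l * ennreal (J (N - \<delta>)) + ennreal l * 1 = ennreal (P x / 2)"
      proof -
        have "l * J (N - \<delta>) + l = l * K" by (simp add: K_def algebra_simps)
        also have "\<dots> = P x / 2" using K by (simp add: l_def)
        finally have e: "l * J (N - \<delta>) + l = P x / 2" .
        have "ennreal l * ennreal (J (N - \<delta>)) + ennreal l * 1 = ennreal (l * J (N - \<delta>) + l)"
          using l Jpos[of "N - \<delta>"] by (simp flip: ennreal_mult' ennreal_plus)
        then show ?thesis unfolding e .
      qed
      finally have 1: "ennreal (P x) \<le> ennreal (P x / 2) + ennreal (l powr (1 - q)) * Q x" .
      have "ennreal (P x / 2) \<le> ennreal (l powr (1 - q)) * Q x"
      proof -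
        have "ennreal (P x / 2) + ennreal (P x / 2) \<le> ennreal (P x / 2) + ennreal (l powr (1 - q)) * Q x"
          using 1 True by (simp flip: ennreal_plus)
        then show ?thesis by (rule ennreal_add_left_cancel_le[THEN iffD1, THEN disjE]) auto
      qed
      then have "ennreal (2 * P x powr (q - 1)) * ennreal (P x / 2) \<le> ennreal (2 * P x powr (q - 1)) * (ennreal (l powr (1 - q)) * Q x)"
        by (rule mult_left_mono) simp
      also have "ennreal (2 * P x powr (q - 1)) * ennreal (P x / 2) = ennreal (P x powr q)"
        using True by (simp add: powr_diff flip: ennreal_mult')
      also have "ennreal (2 * P x powr (q - 1)) * (ennreal (l powr (1 - q)) * Q x) = ennreal (2 * (2 * K) powr (q - 1)) * Q x"
      proof -
        have "l powr (1 - q) = (2 * K) powr (q - 1) / P x powr (q - 1)"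
        proof -
          have "l powr (1 - q) = inverse (l powr (q - 1))" by (subst powr_minus[symmetric]) simp
          then show ?thesis using True K by (simp add: l_def powr_divide)
        qed
        then have "(2 * P x powr (q - 1)) * l powr (1 - q) = 2 * (2 * K) powr (q - 1)" using True by simp
        then show ?thesis by (metis (no_types, opaque_lifting) ennreal_mult' mult.assoc powr_ge_zero zero_le_mult_iff zero_le_numeral)
      qed
      finally show ?thesis .
    qed (use Ppos[of x] in simp)
    have meas2: "(\<lambda>(x, y). ennreal (ib x) * ennreal (ib y * W x y * (h y)\<^sup>2)) \<in> borel_measurable (lborel \<Otimes>\<^sub>M lborel)"
      by measurable
    have "(\<integral>\<^sup>+x. ennreal (P x powr q) \<partial>lborel) \<le> (\<integral>\<^sup>+x. ennreal (2 * (2 * K) powr (q - 1)) * (\<integral>\<^sup>+y. ennreal (ib x) * ennreal (ib y * W x y * (h y)\<^sup>2) \<partial>lborel) \<partial>lborel)"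
    proof (rule nn_integral_mono)
      fix x
      show "ennreal (P x powr q) \<le> ennreal (2 * (2 * K) powr (q - 1)) * (\<integral>\<^sup>+y. ennreal (ib x) * ennreal (ib y * W x y * (h y)\<^sup>2) \<partial>lborel)"
      proof (cases "x \<in> ball 0 R")
        case True
        then show ?thesis using Pbd[OF True] by (simp add: Q_def ib_def)
      next
        case False
        then have "v x = 0" using C0_inf_D(4)[OF v, of x] \<Omega> by blast
        then show ?thesis by (simp add: P_def)
      qed
    qed
    also have "\<dots> = ennreal (2 * (2 * K) powr (q - 1)) * (\<integral>\<^sup>+x. \<integral>\<^sup>+y. ennreal (ib x) * ennreal (ib y * W x y * (h y)\<^sup>2) \<partial>lborel \<partial>lborel)"
      by (rule nn_integral_cmult) measurable
    also have "(\<integral>\<^sup>+x. \<integral>\<^sup>+y. ennreal (ib x) * ennreal (ib y * W x y * (h y)\<^sup>2) \<partial>lborel \<partial>lborel) =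
       (\<integral>\<^sup>+y. \<integral>\<^sup>+x. ennreal (ib x) * ennreal (ib y * W x y * (h y)\<^sup>2) \<partial>lborel \<partial>lborel)"
      by (rule lborel_pair.Fubini'[OF meas2, symmetric])
    also have "\<dots> \<le> (\<integral>\<^sup>+y. ennreal D * ennreal ((h y)\<^sup>2) \<partial>lborel)"
    proof (rule nn_integral_mono)
      fix y
      show "(\<integral>\<^sup>+x. ennreal (ib x) * ennreal (ib y * W x y * (h y)\<^sup>2) \<partial>lborel) \<le> ennreal D * ennreal ((h y)\<^sup>2)"
      proof (cases "y \<in> ball 0 R")
        case True
        have "(\<integral>\<^sup>+x. ennreal (ib x) * ennreal (ib y * W x y * (h y)\<^sup>2) \<partial>lborel) =
          (\<integral>\<^sup>+x. (ennreal (ib x) * ennreal (W x y)) * ennreal ((h y)\<^sup>2) \<partial>lborel)"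
          using True Wpos by (simp add: ib_def ennreal_mult mult.assoc)
        also have "\<dots> = (\<integral>\<^sup>+x. ennreal (ib x) * ennreal (W x y) \<partial>lborel) * ennreal ((h y)\<^sup>2)"
          by (rule nn_integral_multc) measurable
        also have "\<dots> \<le> ennreal D * ennreal ((h y)\<^sup>2)" by (intro mult_right_mono intW True) simp
        finally show ?thesis .
      qed (simp add: ib_def)
    qed
    also have "\<dots> = ennreal D * (\<integral>\<^sup>+y. ennreal ((h y)\<^sup>2) \<partial>lborel)" by (rule nn_integral_cmult) measurable
    also have "\<dots> \<le> ennreal D * 1" by (intro mult_left_mono E1) simp
    finally have fin: "(\<integral>\<^sup>+x. ennreal (P x powr q) \<partial>lborel) \<le> ennreal (2 * (2 * K) powr (q - 1)) * ennreal D"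
      by (simp add: mult_left_mono)
    have "(\<integral>\<^sup>+x. ennreal ((norm x powr (- (N - 2) / 2) * \<bar>v x\<bar>) powr q) \<partial>lborel) =
      (\<integral>\<^sup>+x. ennreal (1 / c powr q) * ennreal (P x powr q) \<partial>lborel)"
    proof -
      have a': "- (N - 2) / 2 = - a" by (simp add: a_def field_simps)
      show ?thesis unfolding a' using c by (intro nn_integral_cong) (simp add: P_def powr_mult flip: ennreal_mult')
    qed
    also have "\<dots> = ennreal (1 / c powr q) * (\<integral>\<^sup>+x. ennreal (P x powr q) \<partial>lborel)"
      unfolding P_def by (rule nn_integral_cmult) measurable
    also have "\<dots> \<le> ennreal (1 / c powr q) * (ennreal (2 * (2 * K) powr (q - 1)) * ennreal D)"
      by (intro mult_left_mono fin) simp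
    also have "\<dots> = ennreal C" using Dpos by (simp add: C_def flip: ennreal_mult')
    finally show ?thesis .
  qed
  then show ?thesis using Cpos by blast
qed

section \<open>Compactness in the unweighted space L1\<close>

text \<open>Pointwise away from the origin, \<open>|grad v| \<le> |x| powr (N - 2) + |x| powr - (N - 2) * |grad v|\<^sup>2\<close>.\<close>

lemma integral_norm_grad_bound:
  fixes \<Omega> :: "(real^'n::finite) set"
  assumes N3: "CARD('n) \<ge> 3" and \<Omega>: "\<Omega> \<subseteq> ball 0 R" and R: "R > 0"
  shows "\<exists>M\<ge>0. \<forall>v\<in>C0_inf \<Omega>. norm_Ht \<Omega> v \<le> B \<longrightarrow>
    integrable lborel (\<lambda>y. norm (grad v y)) \<and> (\<integral>y. norm (grad v y) \<partial>lborel) \<le> M"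
proof -
  let ?a = "(real CARD('n) - 2)"
  define M where "M = R powr ?a * measure lborel (ball (0::real^'n) R) + B\<^sup>2"
  have "integrable lborel (\<lambda>y. norm (grad v y)) \<and> (\<integral>y. norm (grad v y) \<partial>lborel) \<le> M"
    if v: "v \<in> C0_inf \<Omega>" and B: "norm_Ht \<Omega> v \<le> B" for v
  proof
    have fin: "emeasure lborel (ball (0::real^'n) R) < \<infinity>" by (rule emeasure_lborel_ball_finite)
    have i1: "integrable lborel (\<lambda>y::real^'n. R powr ?a * indicator (ball 0 R) y)"
      using fin by (intro integrable_mult_right integrable_real_indicator) auto
    have i2: "integrable lborel (energy_density v)" by (rule integrable_energy_density[OF v N3])
    have ae: "AE y in lborel. norm (grad v y) \<le> R powr ?a * indicator (ball 0 R) y + energy_density v y"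
      using AE_lborel_singleton[of "0::real^'n"]
    proof eventually_elim
      case (elim y)
      show ?case
      proof (cases "y \<in> ball 0 R")
        case True
        let ?g = "norm (grad v y)" and ?p = "norm y powr ?a"
        have p: "?p > 0" using elim by simp
        have e: "energy_density v y = ?g\<^sup>2 / ?p"
          unfolding energy_density_def powr_minus by (simp add: divide_inverse mult.commute)
        have "?g * ?p \<le> ?p\<^sup>2 + ?g\<^sup>2"
        proof -
          have "2 * (?g * ?p) \<le> ?p\<^sup>2 + ?g\<^sup>2" using sum_squares_bound[of ?p ?g] by (simp add: mult_ac)
          moreover have "0 \<le> ?g * ?p" by simp
          ultimately show ?thesis by linarith
        qed
        then have "?g \<le> ?p + ?g\<^sup>2 / ?p" using p by (simp add: field_simps power2_eq_square)
        also have "\<dots> \<le> R powr ?a + ?g\<^sup>2 / ?p" using True N3 by (intro add_right_mono powr_mono2) auto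
        finally show ?thesis using True by (simp add: e)
      next
        case False
        then have "grad v y = 0" using C0_inf_D(5)[OF v, of y] \<Omega> by blast
        then show ?thesis by (simp add: energy_density_def)
      qed
    qed
    have meas: "(\<lambda>y. norm (grad v y)) \<in> borel_measurable lborel" using borel_measurable_C0_inf(2)[OF v] by measurable
    show i: "integrable lborel (\<lambda>y. norm (grad v y))"
      by (rule Bochner_Integration.integrable_bound[OF Bochner_Integration.integrable_add[OF i1 i2] meas])
        (use ae in \<open>auto elim!: eventually_mono\<close>)
    have "(\<integral>y. norm (grad v y) \<partial>lborel) \<le> (\<integral>y. R powr ?a * indicator (ball 0 R) y + energy_density v y \<partial>lborel)"
      by (rule integral_mono_AE[OF i _ ae]) (use i1 i2 in simp)
    also have "\<dots> = R powr ?a * measure lborel (ball (0::real^'n) R) + (norm_Ht \<Omega> v)\<^sup>2"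
      using i1 i2 norm_Ht_square(1)[OF v] by simp
    also have "\<dots> \<le> M" using B norm_Ht_square(2)[OF v] by (simp add: M_def power_mono)
    finally show "(\<integral>y. norm (grad v y) \<partial>lborel) \<le> M" .
  qed
  moreover have "M \<ge> 0" by (simp add: M_def)
  ultimately show ?thesis by blast
qed

text \<open>\<open>F m n\<close> is the potential of \<open>grad (v n)\<close> for the regular kernel \<open>\<Psi> m\<close>. A diagonal sequence makes all \<open>F m\<close>
  converge on a countable dense set; equicontinuity extends this to the whole ball, and boundedness
  turns it into convergence in \<open>L\<^sup>1\<close>. On the other hand \<open>F m n\<close> differs from \<open>- c * v n\<close> in \<open>L\<^sup>1\<close> by at most
  \<open>\<kappa> m * M\<close>, where \<open>\<kappa> m\<close> is the integral of the difference of the kernels, which tends to zero.\<close>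

lemma L1_compactness:
  fixes \<Omega> :: "(real^'n::finite) set" and v :: "nat \<Rightarrow> real^'n \<Rightarrow> real"
  assumes N3: "CARD('n) \<ge> 3" and \<Omega>: "\<Omega> \<subseteq> ball 0 R" and R: "R > 0"
    and v: "\<And>n. v n \<in> C0_inf \<Omega>" and B: "\<And>n. norm_Ht \<Omega> (v n) \<le> B"
  obtains r :: "nat \<Rightarrow> nat" where "strict_mono r"
    "\<And>e. e > 0 \<Longrightarrow> \<exists>K. \<forall>j\<ge>K. \<forall>k\<ge>K. (\<integral>\<^sup>+x. ennreal \<bar>v (r j) x - v (r k) x\<bar> \<partial>lborel) \<le> ennreal e"
proof -
  define N where "N = real CARD('n)"
  have N: "N \<ge> 3" using N3 by (simp add: N_def)
  obtain M where M: "M \<ge> 0" "\<And>n. integrable lborel (\<lambda>y. norm (grad (v n) y))"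
      "\<And>n. (\<integral>y. norm (grad (v n) y) \<partial>lborel) \<le> M"
    using integral_norm_grad_bound[OF N3 \<Omega> R, of B] v B by metis
  have gm[measurable]: "grad (v n) \<in> borel_measurable borel" "v n \<in> borel_measurable borel" for n
    using borel_measurable_C0_inf[OF v] by auto
  have g0: "grad (v n) y = 0" if "y \<notin> cball 0 R" for n y
    using C0_inf_D(5)[OF v, of y] \<Omega> that by force
  have v0: "v n y = 0" if "y \<notin> ball 0 R" for n y
    using C0_inf_D(4)[OF v, of y] \<Omega> that by blast
  define ib :: "real^'n \<Rightarrow> real" where "ib = indicator (ball 0 R)"
  have ib01: "ib x = 0 \<or> ib x = 1" "ib x \<ge> 0" for x by (auto simp: ib_def indicator_def)
  have ibm[measurable]: "ib \<in> borel_measurable borel" unfolding ib_def by (intro borel_measurable_indicator) auto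
  define c where "c = newton_const TYPE('n)"
  have c: "c > 0" unfolding c_def by (rule newton_const_pos)
  define h :: "nat \<Rightarrow> real" where "h n = inverse (Suc n)" for n
  have h: "0 < h n" for n by (auto simp: h_def field_simps)
  have h0: "h \<longlonglongrightarrow> 0" unfolding h_def by (rule LIMSEQ_inverse_real_of_nat)
  define \<Psi> where "\<Psi> m z = reg_powr 0 ((h m)\<^sup>2) (- N / 2) z *\<^sub>R z" for m and z :: "real^'n"
  have \<Psi>c: "continuous_on UNIV (\<Psi> m)" for m
  proof -
    have "continuous_on UNIV (reg_powr (0::real^'n) ((h m)\<^sup>2) (- N / 2))"
      using C_k_reg_powr[of "(h m)\<^sup>2" 0] h[of m] by (simp add: zero_less_power2 less_imp_neq[THEN not_sym] del: zero_less_power2)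
    then show ?thesis unfolding \<Psi>_def by (intro continuous_intros)
  qed
  have \<Psi>m[measurable]: "\<Psi> m \<in> borel_measurable borel" for m
    using \<Psi>c by (rule borel_measurable_continuous_onI)
  have "\<exists>b\<ge>0. \<forall>z\<in>cball 0 (2 * R). norm (\<Psi> m z) \<le> b" for m
  proof -
    have "compact (\<Psi> m ` cball 0 (2 * R))"
      using \<Psi>c by (intro compact_continuous_image) (auto intro: continuous_on_subset)
    then obtain b where "\<forall>z\<in>cball 0 (2 * R). norm (\<Psi> m z) \<le> b" by (auto dest!: compact_imp_bounded simp: bounded_iff)
    then show ?thesis by (intro exI[of _ "max b 0"]) (auto simp: le_max_iff_disj)
  qed
  then obtain b where b: "\<And>m. b m \<ge> 0" "\<And>m z. z \<in> cball 0 (2 * R) \<Longrightarrow> norm (\<Psi> m z) \<le> b m" by metis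
  have diff2: "y - x \<in> cball 0 (2 * R)" if "y \<in> cball 0 R" "x \<in> cball 0 R" for x y :: "real^'n"
    using that norm_triangle_ineq4[of y x] by simp
  define F where "F m n x = (\<integral>y. \<Psi> m (y - x) \<bullet> grad (v n) y \<partial>lborel)" for m n x
  have Fint: "integrable lborel (\<lambda>y. \<Psi> m (y - x) \<bullet> grad (v n) y)" if "x \<in> cball 0 R" for m n x
  proof (rule Bochner_Integration.integrable_bound[OF integrable_mult_right[OF M(2)[of n], of "b m"]])
    show "AE y in lborel. norm (\<Psi> m (y - x) \<bullet> grad (v n) y) \<le> norm (b m * norm (grad (v n) y))"
    proof (intro AE_I2)
      fix y
      show "norm (\<Psi> m (y - x) \<bullet> grad (v n) y) \<le> norm (b m * norm (grad (v n) y))"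
      proof (cases "y \<in> cball 0 R")
        case True
        have "norm (\<Psi> m (y - x) \<bullet> grad (v n) y) \<le> norm (\<Psi> m (y - x)) * norm (grad (v n) y)"
          unfolding real_norm_def by (rule Cauchy_Schwarz_ineq2)
        also have "\<dots> \<le> b m * norm (grad (v n) y)" by (intro mult_right_mono b diff2 True that) simp
        finally show ?thesis using b(1)[of m] by simp
      qed (simp add: g0)
    qed
  qed measurable
  \<comment> \<open>applied to the kernel, this bounds all potentials; applied to its increments, it shows equicontinuity\<close>
  have Fdiff: "\<bar>\<integral>y. w y \<bullet> grad (v n) y \<partial>lborel\<bar> \<le> \<eta> * M"
    if w: "\<And>y. y \<in> cball 0 R \<Longrightarrow> norm (w y) \<le> \<eta>" and "\<eta> \<ge> 0" for w n \<eta>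
  proof -
    have "\<bar>\<integral>y. w y \<bullet> grad (v n) y \<partial>lborel\<bar> \<le> (\<integral>y. \<eta> * norm (grad (v n) y) \<partial>lborel)"
    proof (rule order_trans[OF integral_abs_bound integral_mono'])
      fix y
      show "\<bar>w y \<bullet> grad (v n) y\<bar> \<le> \<eta> * norm (grad (v n) y)"
      proof (cases "y \<in> cball 0 R")
        case True
        have "\<bar>w y \<bullet> grad (v n) y\<bar> \<le> norm (w y) * norm (grad (v n) y)" by (rule Cauchy_Schwarz_ineq2)
        also have "\<dots> \<le> \<eta> * norm (grad (v n) y)" by (intro mult_right_mono w True) simp
        finally show ?thesis .
      qed (simp add: g0)
    qed (use M(2) \<open>\<eta> \<ge> 0\<close> in simp_all)
    also have "\<dots> \<le> \<eta> * M" using M(3)[of n] that(2) by (simp add: mult_left_mono)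
    finally show ?thesis .
  qed
  have Fbd: "\<bar>F m n x\<bar> \<le> b m * M" if "x \<in> cball 0 R" for m n x
    unfolding F_def by (rule Fdiff) (use b diff2 that in auto)
  obtain S :: "(real^'n) set" where S: "countable S" "S \<subseteq> cball 0 R" "cball 0 R \<subseteq> closure S"
    using separable by blast
  \<comment> \<open>division by \<open>1 + b m\<close> makes the bound on the potentials independent of \<open>m\<close>, as the diagonal argument requires\<close>
  have "countable ((UNIV :: nat set) \<times> S)" using S by auto
  moreover have "norm (F (fst p) n (snd p) / (1 + b (fst p))) \<le> M" if "p \<in> UNIV \<times> S" for p n
  proof -
    have "\<bar>F (fst p) n (snd p)\<bar> \<le> b (fst p) * M" using S(2) that by (intro Fbd) auto
    also have "\<dots> \<le> (1 + b (fst p)) * M" using M(1) by (intro mult_right_mono) auto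
    finally show ?thesis using b(1)[of "fst p"] by (simp add: field_simps)
  qed
  ultimately obtain r where r: "strict_mono (r :: nat \<Rightarrow> nat)"
    and conv: "\<And>p. p \<in> UNIV \<times> S \<Longrightarrow> \<exists>l. (\<lambda>n. F (fst p) (r n) (snd p) / (1 + b (fst p))) \<longlonglongrightarrow> l"
    using function_convergent_subsequence[of "UNIV \<times> S" "\<lambda>n p. F (fst p) n (snd p) / (1 + b (fst p))" M] by metis
  have convS: "convergent (\<lambda>n. F m (r n) x)" if "x \<in> S" for m x
  proof -
    obtain l where "(\<lambda>n. F m (r n) x / (1 + b m)) \<longlonglongrightarrow> l" using conv[of "(m, x)"] \<open>x \<in> S\<close> by auto
    then have "(\<lambda>n. (1 + b m) * (F m (r n) x / (1 + b m))) \<longlonglongrightarrow> (1 + b m) * l" by (intro tendsto_intros)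
    moreover have "(1 + b m) * (z / (1 + b m)) = z" for z using b(1)[of m] by simp
    ultimately show ?thesis by (auto simp: convergent_def)
  qed
  have convB: "convergent (\<lambda>n. F m (r n) x)" if x: "x \<in> cball 0 R" for m x
  proof (rule real_Cauchy_convergent)
    have "uniformly_continuous_on (cball 0 (2 * R)) (\<Psi> m)"
      using \<Psi>c by (intro compact_uniformly_continuous) (auto intro: continuous_on_subset)
    show "Cauchy (\<lambda>n. F m (r n) x)"
    proof (rule metric_CauchyI)
      fix e :: real assume e: "e > 0"
      define \<eta> where "\<eta> = e / (3 * (M + 1))"
      have eta: "\<eta> > 0" "\<eta> * M < e / 3" using e M(1) by (auto simp: \<eta>_def field_simps)
      obtain d where d: "d > 0" "\<And>z z'. z \<in> cball 0 (2 * R) \<Longrightarrow> z' \<in> cball 0 (2 * R) \<Longrightarrow> dist z' z < d \<Longrightarrow> dist (\<Psi> m z') (\<Psi> m z) < \<eta>"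
        using \<open>uniformly_continuous_on (cball 0 (2 * R)) (\<Psi> m)\<close> eta(1) unfolding uniformly_continuous_on_def by meson
      obtain x' where x': "x' \<in> S" "dist x' x < d" using S(3) x d(1) closure_approachable by blast
      have x'B: "x' \<in> cball 0 R" using x' S by auto
      have near: "\<bar>F m n x - F m n x'\<bar> \<le> \<eta> * M" for n
      proof -
        have "F m n x - F m n x' = (\<integral>y. (\<Psi> m (y - x) - \<Psi> m (y - x')) \<bullet> grad (v n) y \<partial>lborel)"
          unfolding F_def inner_diff_left using Fint x x'B by simp
        also have "\<bar>\<dots>\<bar> \<le> \<eta> * M"
        proof (rule Fdiff)
          fix y :: "real^'n" assume y: "y \<in> cball 0 R"
          have "dist (y - x) (y - x') < d" using x'(2) by (simp add: dist_norm norm_minus_commute)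
          then have "dist (\<Psi> m (y - x)) (\<Psi> m (y - x')) < \<eta>" using d(2) diff2 y x x'B by blast
          then show "norm (\<Psi> m (y - x) - \<Psi> m (y - x')) \<le> \<eta>" by (simp add: dist_norm)
        qed (use eta in simp)
        finally show ?thesis .
      qed
      have "Cauchy (\<lambda>n. F m (r n) x')" using convS[OF x'(1)] convergent_Cauchy by blast
      then obtain K where K: "\<And>j k. j \<ge> K \<Longrightarrow> k \<ge> K \<Longrightarrow> dist (F m (r j) x') (F m (r k) x') < e / 3"
        using e unfolding Cauchy_def by (metis divide_pos_pos zero_less_numeral)
      show "\<exists>K. \<forall>j\<ge>K. \<forall>k\<ge>K. dist (F m (r j) x) (F m (r k) x) < e"
      proof (intro exI[of _ K] allI impI)
        fix j k assume "j \<ge> K" "k \<ge> K"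
        from K[OF this] show "dist (F m (r j) x) (F m (r k) x) < e"
          using near[of "r j"] near[of "r k"] eta(2) unfolding dist_real_def by linarith
      qed
    qed
  qed
  have Fm[measurable]: "F m n \<in> borel_measurable borel" for m n
    unfolding F_def[abs_def] by measurable
  define L where "L m x = lim (\<lambda>n. ib x * F m (r n) x)" for m x
  have Lc: "(\<lambda>n. ib x * F m (r n) x) \<longlonglongrightarrow> L m x" for m x
  proof (cases "x \<in> ball 0 R")
    case True
    then have "convergent (\<lambda>n. ib x * F m (r n) x)" using convB[of x m] by (simp add: ib_def)
    then show ?thesis by (simp add: L_def convergent_LIMSEQ_iff)
  qed (simp add: L_def ib_def)
  have Lm[measurable]: "L m \<in> borel_measurable borel" for m
    by (rule borel_measurable_LIMSEQ_real[of _ "\<lambda>n x. ib x * F m (r n) x"]) (use Lc in auto)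
  have FL: "(\<lambda>n. \<integral>\<^sup>+x. ennreal \<bar>ib x * F m (r n) x - L m x\<bar> \<partial>lborel) \<longlonglongrightarrow> 0" for m
  proof -
    have "(\<lambda>n. \<integral>\<^sup>+x. ennreal \<bar>ib x * F m (r n) x - L m x\<bar> \<partial>lborel) \<longlonglongrightarrow> (\<integral>\<^sup>+x. 0 \<partial>(lborel :: (real^'n) measure))"
    proof (rule nn_integral_dominated_convergence[where w="\<lambda>x. ennreal (2 * (b m * M)) * indicator (ball 0 R) x"])
      show "AE x in lborel. ennreal \<bar>ib x * F m (r n) x - L m x\<bar> \<le> ennreal (2 * (b m * M)) * indicator (ball 0 R) x" for n
      proof (intro AE_I2)
        fix x
        show "ennreal \<bar>ib x * F m (r n) x - L m x\<bar> \<le> ennreal (2 * (b m * M)) * indicator (ball 0 R) x"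
        proof (cases "x \<in> ball 0 R")
          case True
          have bd: "\<bar>ib x * F m n x\<bar> \<le> b m * M" for n using True Fbd[of x m n] by (simp add: ib_def)
          have "\<bar>L m x\<bar> \<le> b m * M"
            by (rule LIMSEQ_le_const2[OF tendsto_rabs[OF Lc]]) (use bd in auto)
          then have "\<bar>ib x * F m (r n) x - L m x\<bar> \<le> 2 * (b m * M)" using bd[of "r n"] by linarith
          then show ?thesis using True by (simp add: ennreal_leI)
        next
          case False
          then have "L m x = 0" using LIMSEQ_unique[OF Lc[of x m], of 0] by (simp add: ib_def)
          then show ?thesis using False by (simp add: ib_def)
        qed
      qed
      have "(\<integral>\<^sup>+x. ennreal (2 * (b m * M)) * indicator (ball 0 R) x \<partial>(lborel :: (real^'n) measure)) = ennreal (2 * (b m * M)) * emeasure lborel (ball (0::real^'n) R)"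
        by (rule nn_integral_cmult_indicator) simp
      also have "\<dots> < \<infinity>" using emeasure_lborel_ball_finite[of "0::real^'n" R] by (simp add: ennreal_mult_less_top)
      finally show "(\<integral>\<^sup>+x. ennreal (2 * (b m * M)) * indicator (ball 0 R) x \<partial>(lborel :: (real^'n) measure)) < \<infinity>" .
      show "AE x in lborel. (\<lambda>n. ennreal \<bar>ib x * F m (r n) x - L m x\<bar>) \<longlonglongrightarrow> 0"
      proof (intro AE_I2)
        fix x
        have "(\<lambda>n. \<bar>ib x * F m (r n) x - L m x\<bar>) \<longlonglongrightarrow> \<bar>L m x - L m x\<bar>" by (intro tendsto_intros Lc)
        then show "(\<lambda>n. ennreal \<bar>ib x * F m (r n) x - L m x\<bar>) \<longlonglongrightarrow> 0"
          using tendsto_ennrealI by fastforce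
      qed
    qed (auto intro!: borel_measurable_times_ennreal borel_measurable_indicator)
    then show ?thesis by simp
  qed
  \<comment> \<open>regularising shortens the kernel without turning it, so the difference of the lengths measures the error\<close>
  define k where "k m z = norm z powr (1 - N) - reg_powr 0 ((h m)\<^sup>2) (- N / 2) z * norm z" for m and z :: "real^'n"
  have km[measurable]: "k m \<in> borel_measurable borel" for m
    unfolding k_def[abs_def] reg_powr_def[abs_def] by measurable
  have reg: "0 \<le> reg_powr 0 ((h m)\<^sup>2) (- N / 2) z" "z \<noteq> 0 \<Longrightarrow> reg_powr 0 ((h m)\<^sup>2) (- N / 2) z \<le> norm z powr - N" for m and z :: "real^'n"
    using reg_powr_le[of "(h m)\<^sup>2" "- N / 2" z 0] N by (auto simp: reg_powr_def)
  have pw: "norm z powr (1 - N) = norm z powr - N * norm z" for z :: "real^'n"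
    by (simp add: powr_diff powr_minus divide_inverse mult.commute)
  have kpos: "k m z \<ge> 0" and kle: "k m z \<le> norm z powr (1 - N)" for m and z :: "real^'n"
    using reg(1)[of m z] reg(2)[of z m] by (cases "z = 0"; simp add: k_def pw mult_right_mono)+
  define \<kappa> where "\<kappa> m = (\<integral>\<^sup>+z. ennreal (indicator (ball 0 (2 * R)) z * k m z) \<partial>lborel)" for m
  have \<kappa>0: "\<kappa> \<longlonglongrightarrow> 0"
  proof -
    have "(\<lambda>m. \<integral>\<^sup>+z. ennreal (indicator (ball 0 (2 * R)) z * k m z) \<partial>lborel) \<longlonglongrightarrow> (\<integral>\<^sup>+z. 0 \<partial>(lborel :: (real^'n) measure))"
    proof (rule nn_integral_dominated_convergence[where w="\<lambda>z. ennreal (indicator (ball 0 (2 * R)) z * norm z powr - (N - 1))"])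
      show "(\<integral>\<^sup>+z. ennreal (indicator (ball 0 (2 * R)) z * norm (z::real^'n) powr - (N - 1)) \<partial>lborel) < \<infinity>"
        using N by (intro nn_integral_norm_powr_ball) (auto simp: N_def)
      show "AE z in lborel. ennreal (indicator (ball 0 (2 * R)) z * k m z) \<le> ennreal (indicator (ball 0 (2 * R)) z * norm z powr - (N - 1))" for m
        using kle by (intro AE_I2 ennreal_leI mult_left_mono) auto
      show "AE z in lborel. (\<lambda>m. ennreal (indicator (ball 0 (2 * R)) z * k m z)) \<longlonglongrightarrow> 0"
        using AE_lborel_singleton[of "0::real^'n"]
      proof eventually_elim
        case (elim z)
        have "(\<lambda>m. reg_powr 0 ((h m)\<^sup>2) (- N / 2) z) \<longlonglongrightarrow> norm z powr - N"
          using tendsto_reg_powr[OF h0 elim, of "- N / 2"] by simp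
        then have "(\<lambda>m. indicator (ball 0 (2 * R)) z * k m z) \<longlonglongrightarrow> indicator (ball 0 (2 * R)) z * (norm z powr (1 - N) - norm z powr - N * norm z)"
          unfolding k_def by (intro tendsto_intros)
        then show ?case using tendsto_ennrealI by (fastforce simp: pw)
      qed
      show "(\<lambda>z. ennreal (indicator (ball 0 (2 * R)) z * k m z)) \<in> borel_measurable lborel" for m
        by (intro measurable_compose[OF _ measurable_ennreal] borel_measurable_times borel_measurable_indicator) auto
      show "(\<lambda>z::real^'n. ennreal (indicator (ball 0 (2 * R)) z * norm z powr - (N - 1))) \<in> borel_measurable lborel"
        by (intro measurable_compose[OF _ measurable_ennreal] borel_measurable_times borel_measurable_indicator powr_real_measurable) auto
    qed auto
    then show ?thesis unfolding \<kappa>_def by simp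
  qed
  have err: "(\<integral>\<^sup>+x. ennreal \<bar>ib x * (c * v n x + F m n x)\<bar> \<partial>lborel) \<le> \<kappa> m * ennreal M" for m n
  proof -
    have pt: "ennreal \<bar>ib x * (c * v n x + F m n x)\<bar> \<le> (\<integral>\<^sup>+y. ennreal (norm (grad (v n) y)) * ennreal (ib x * k m (x - y)) \<partial>lborel)" for x
    proof (cases "x \<in> ball 0 R")
      case True
      then have xc: "x \<in> cball 0 R" by simp
      note rep = potential_representation[OF C0_inf_D(1)[OF v[of n]] bounded_supp_C0_inf[OF v[of n]], where x=x, folded N_def c_def]
      let ?I = "\<integral>y. \<Psi> m (y - x) \<bullet> grad (v n) y - norm (y - x) powr - N * ((y - x) \<bullet> grad (v n) y) \<partial>lborel"
      have I: "c * v n x + F m n x = (\<integral>y. \<Psi> m (y - x) \<bullet> grad (v n) y - norm (y - x) powr - N * ((y - x) \<bullet> grad (v n) y) \<partial>lborel)"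
        unfolding rep(2) F_def using rep(1) Fint[OF xc] by simp
      have "ennreal \<bar>ib x * (c * v n x + F m n x)\<bar> = ennreal \<bar>?I\<bar>"
        unfolding I using True by (simp add: ib_def)
      also have "\<dots> \<le> (\<integral>\<^sup>+y. ennreal (norm (\<Psi> m (y - x) \<bullet> grad (v n) y - norm (y - x) powr - N * ((y - x) \<bullet> grad (v n) y))) \<partial>lborel)"
        using integral_norm_bound_ennreal[OF Bochner_Integration.integrable_diff[OF Fint[OF xc, of m n] rep(1)]] by simp
      also have "\<dots> \<le> (\<integral>\<^sup>+y. ennreal (norm (grad (v n) y)) * ennreal (ib x * k m (x - y)) \<partial>lborel)"
      proof (intro nn_integral_mono)
        fix y
        let ?z = "y - x"
        have "\<Psi> m ?z \<bullet> grad (v n) y - norm ?z powr - N * (?z \<bullet> grad (v n) y) =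
            (reg_powr 0 ((h m)\<^sup>2) (- N / 2) ?z - norm ?z powr - N) * (?z \<bullet> grad (v n) y)"
          by (simp add: \<Psi>_def algebra_simps)
        also have "norm \<dots> \<le> \<bar>reg_powr 0 ((h m)\<^sup>2) (- N / 2) ?z - norm ?z powr - N\<bar> * (norm ?z * norm (grad (v n) y))"
          unfolding real_norm_def abs_mult by (intro mult_left_mono Cauchy_Schwarz_ineq2) simp
        also have "\<dots> = norm (grad (v n) y) * k m ?z"
          using reg(1)[of m ?z] reg(2)[of ?z m] by (cases "?z = 0") (auto simp: k_def pw algebra_simps)
        also have "k m ?z = ib x * k m (x - y)" using True by (simp add: k_def reg_powr_def ib_def norm_minus_commute)
        finally show "ennreal (norm (\<Psi> m ?z \<bullet> grad (v n) y - norm ?z powr - N * (?z \<bullet> grad (v n) y)))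
          \<le> ennreal (norm (grad (v n) y)) * ennreal (ib x * k m (x - y))"
          by (subst ennreal_mult'[symmetric]) (auto intro: ennreal_leI)
      qed
      finally show ?thesis .
    qed (simp add: ib_def)
    have meas2: "(\<lambda>(x, y). ennreal (norm (grad (v n) y)) * ennreal (ib x * k m (x - y))) \<in> borel_measurable (lborel \<Otimes>\<^sub>M lborel)"
      by measurable
    have "(\<integral>\<^sup>+x. ennreal \<bar>ib x * (c * v n x + F m n x)\<bar> \<partial>lborel) \<le>
      (\<integral>\<^sup>+x. \<integral>\<^sup>+y. ennreal (norm (grad (v n) y)) * ennreal (ib x * k m (x - y)) \<partial>lborel \<partial>lborel)"
      by (intro nn_integral_mono pt)
    also have "\<dots> = (\<integral>\<^sup>+y. \<integral>\<^sup>+x. ennreal (norm (grad (v n) y)) * ennreal (ib x * k m (x - y)) \<partial>lborel \<partial>lborel)"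
      by (rule lborel_pair.Fubini'[OF meas2, symmetric])
    also have "\<dots> \<le> (\<integral>\<^sup>+y. \<kappa> m * ennreal (norm (grad (v n) y)) \<partial>lborel)"
    proof (rule nn_integral_mono)
      fix y
      show "(\<integral>\<^sup>+x. ennreal (norm (grad (v n) y)) * ennreal (ib x * k m (x - y)) \<partial>lborel) \<le> \<kappa> m * ennreal (norm (grad (v n) y))"
      proof (cases "y \<in> ball 0 R")
        case True
        have "(\<integral>\<^sup>+x. ennreal (norm (grad (v n) y)) * ennreal (ib x * k m (x - y)) \<partial>lborel) =
          ennreal (norm (grad (v n) y)) * (\<integral>\<^sup>+x. ennreal (ib x * k m (x - y)) \<partial>lborel)"
          by (rule nn_integral_cmult) measurable
        also have "\<dots> \<le> ennreal (norm (grad (v n) y)) * \<kappa> m"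
          unfolding \<kappa>_def ib_def by (intro mult_left_mono nn_integral_shifted_kernel_le True) auto
        finally show ?thesis by (simp add: mult.commute)
      next
        case False
        then have "grad (v n) y = 0" using C0_inf_D(5)[OF v, of y] \<Omega> by blast
        then show ?thesis by simp
      qed
    qed
    also have "\<dots> = \<kappa> m * (\<integral>\<^sup>+y. ennreal (norm (grad (v n) y)) \<partial>lborel)" by (rule nn_integral_cmult) measurable
    also have "(\<integral>\<^sup>+y. ennreal (norm (grad (v n) y)) \<partial>lborel) = ennreal (\<integral>y. norm (grad (v n) y) \<partial>lborel)"
      by (rule nn_integral_eq_integral[OF M(2)]) simp
    also have "\<kappa> m * \<dots> \<le> \<kappa> m * ennreal M" using M(3)[of n] by (intro mult_left_mono ennreal_leI) auto
    finally show ?thesis .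
  qed
  have "\<exists>K. \<forall>i\<ge>K. \<forall>j\<ge>K. (\<integral>\<^sup>+x. ennreal \<bar>v (r i) x - v (r j) x\<bar> \<partial>lborel) \<le> ennreal e" if e: "e > 0" for e
  proof -
    define \<theta> where "\<theta> = c * e / 4"
    have th: "\<theta> > 0" using c e by (simp add: \<theta>_def)
    have "(\<lambda>m. \<kappa> m * ennreal M) \<longlonglongrightarrow> 0 * ennreal M"
      by (intro tendsto_mult_ennreal \<kappa>0 tendsto_const) auto
    then have "\<forall>\<^sub>F m in sequentially. \<kappa> m * ennreal M < ennreal \<theta>" using th by (intro order_tendstoD) auto
    then obtain m where m: "\<kappa> m * ennreal M < ennreal \<theta>" by (auto simp: eventually_sequentially)
    have "\<forall>\<^sub>F n in sequentially. (\<integral>\<^sup>+x. ennreal \<bar>ib x * F m (r n) x - L m x\<bar> \<partial>lborel) < ennreal \<theta>"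
      using th by (intro order_tendstoD[OF FL]) auto
    then obtain K where K: "\<And>n. n \<ge> K \<Longrightarrow> (\<integral>\<^sup>+x. ennreal \<bar>ib x * F m (r n) x - L m x\<bar> \<partial>lborel) < ennreal \<theta>"
      by (auto simp: eventually_sequentially)
    have "(\<integral>\<^sup>+x. ennreal \<bar>v (r i) x - v (r j) x\<bar> \<partial>lborel) \<le> ennreal e" if "i \<ge> K" "j \<ge> K" for i j
    proof -
      let ?e = "\<lambda>n x. ennreal \<bar>ib x * (c * v n x + F m n x)\<bar>" and ?f = "\<lambda>n x. ennreal \<bar>ib x * F m n x - L m x\<bar>"
      have "(\<integral>\<^sup>+x. ennreal c * ennreal \<bar>v (r i) x - v (r j) x\<bar> \<partial>lborel) \<le> (\<integral>\<^sup>+x. (?e (r i) x + ?e (r j) x) + (?f (r i) x + ?f (r j) x) \<partial>lborel)"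
      proof (rule nn_integral_mono)
        fix x
        have "c * \<bar>v (r i) x - v (r j) x\<bar> = \<bar>ib x * (c * v (r i) x) - ib x * (c * v (r j) x)\<bar>"
        proof (cases "x \<in> ball 0 R")
          case True
          have "c * \<bar>v (r i) x - v (r j) x\<bar> = \<bar>c * (v (r i) x - v (r j) x)\<bar>" using c by (simp add: abs_mult)
          then show ?thesis using True by (simp add: ib_def algebra_simps)
        next
          case False then show ?thesis by (simp add: v0)
        qed
        also have "\<dots> \<le> \<bar>ib x * (c * v (r i) x + F m (r i) x)\<bar> + \<bar>ib x * (c * v (r j) x + F m (r j) x)\<bar>
            + (\<bar>ib x * F m (r i) x - L m x\<bar> + \<bar>ib x * F m (r j) x - L m x\<bar>)"
          unfolding distrib_left by linarith
        finally have "ennreal (c * \<bar>v (r i) x - v (r j) x\<bar>) \<le> ennreal \<dots>" by (rule ennreal_leI)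
        then show "ennreal c * ennreal \<bar>v (r i) x - v (r j) x\<bar> \<le> (?e (r i) x + ?e (r j) x) + (?f (r i) x + ?f (r j) x)"
          using c by (simp add: ennreal_mult' ennreal_plus)
      qed
      also have "\<dots> = ((\<integral>\<^sup>+x. ?e (r i) x \<partial>lborel) + (\<integral>\<^sup>+x. ?e (r j) x \<partial>lborel)) + ((\<integral>\<^sup>+x. ?f (r i) x \<partial>lborel) + (\<integral>\<^sup>+x. ?f (r j) x \<partial>lborel))"
        by (simp add: nn_integral_add)
      also have "\<dots> \<le> (ennreal \<theta> + ennreal \<theta>) + (ennreal \<theta> + ennreal \<theta>)"
        using K that by (intro add_mono order_trans[OF err less_imp_le[OF m]] less_imp_le[OF K]) auto
      also have "\<dots> = ennreal c * ennreal e" using th c e by (simp add: \<theta>_def flip: ennreal_plus ennreal_mult')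
      finally have "ennreal c * (\<integral>\<^sup>+x. ennreal \<bar>v (r i) x - v (r j) x\<bar> \<partial>lborel) \<le> ennreal c * ennreal e"
        by (subst (asm) nn_integral_cmult) auto
      then show ?thesis using c by (subst (asm) ennreal_mult_le_mult_iff) auto
    qed
    then show ?thesis by blast
  qed
  with r show ?thesis using that by blast
qed

section \<open>The energy norm is a closable seminorm\<close>

lemma energy_density_diff_le:
  assumes f: "f \<in> C0_inf \<Omega>" and g: "g \<in> C0_inf \<Omega>" and l: "l > 0"
  shows "energy_density (\<lambda>x. f x - g x) y \<le> (1 + l) * energy_density f y + (1 + 1 / l) * energy_density g y"
proof -
  let ?a = "grad f y" and ?b = "grad g y"
  have "norm (?a - ?b) \<le> norm ?a + norm ?b" by (rule norm_triangle_ineq4)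
  then have "(norm (?a - ?b))\<^sup>2 \<le> (norm ?a + norm ?b)\<^sup>2" by (intro power_mono) auto
  also have "\<dots> \<le> (1 + l) * (norm ?a)\<^sup>2 + (1 + 1 / l) * (norm ?b)\<^sup>2"
  proof -
    have "0 \<le> (l * norm ?a - norm ?b)\<^sup>2 / l" using l by simp
    also have "\<dots> = (1 + l) * (norm ?a)\<^sup>2 + (1 + 1 / l) * (norm ?b)\<^sup>2 - (norm ?a + norm ?b)\<^sup>2"
      using l by (simp add: field_simps power2_eq_square)
    finally show ?thesis by simp
  qed
  finally have "norm y powr (- (real CARD('a) - 2)) * (norm (?a - ?b))\<^sup>2 \<le>
     norm y powr (- (real CARD('a) - 2)) * ((1 + l) * (norm ?a)\<^sup>2 + (1 + 1 / l) * (norm ?b)\<^sup>2)"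
    by (rule mult_left_mono) simp
  then show ?thesis
    unfolding energy_density_def grad_diff[OF C0_inf_D(6)[OF f] C0_inf_D(6)[OF g]] by (simp add: algebra_simps)
qed

text \<open>In \<open>energy_density_diff_le\<close> the best parameter is the quotient of the two norms; half of \<open>e\<close> is
  added to each of them to keep the quotient defined when one vanishes.\<close>

lemma norm_Ht_diff_le:
  fixes f g :: "real^'n::finite \<Rightarrow> real"
  assumes f: "f \<in> C0_inf \<Omega>" and g: "g \<in> C0_inf \<Omega>" and N3: "CARD('n) \<ge> 3"
  shows "norm_Ht \<Omega> (\<lambda>x. f x - g x) \<le> norm_Ht \<Omega> f + norm_Ht \<Omega> g"
proof (rule field_le_epsilon)
  fix e :: real assume e: "e > 0"
  define s t where "s = norm_Ht \<Omega> f + e / 2" and "t = norm_Ht \<Omega> g + e / 2"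
  note fg = C0_inf_diff[OF f g]
  have st: "s > 0" "t > 0" "norm_Ht \<Omega> f \<le> s" "norm_Ht \<Omega> g \<le> t"
    using e norm_Ht_square(2)[OF f] norm_Ht_square(2)[OF g] by (auto simp: s_def t_def)
  have "(norm_Ht \<Omega> (\<lambda>x. f x - g x))\<^sup>2 \<le> (\<integral>y. (1 + t / s) * energy_density f y + (1 + 1 / (t / s)) * energy_density g y \<partial>lborel)"
    unfolding norm_Ht_square(1)[OF fg]
    by (intro integral_mono energy_density_diff_le[OF f g] integrable_energy_density[OF fg N3] Bochner_Integration.integrable_add
        integrable_mult_right integrable_energy_density[OF f N3] integrable_energy_density[OF g N3]) (use st in auto)
  also have "\<dots> = (1 + t / s) * (norm_Ht \<Omega> f)\<^sup>2 + (1 + s / t) * (norm_Ht \<Omega> g)\<^sup>2"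
    using integrable_energy_density[OF f N3] integrable_energy_density[OF g N3]
    by (simp add: norm_Ht_square(1)[OF f] norm_Ht_square(1)[OF g])
  also have "\<dots> \<le> (1 + t / s) * s\<^sup>2 + (1 + s / t) * t\<^sup>2"
    using st norm_Ht_square(2)[OF f] norm_Ht_square(2)[OF g] by (intro add_mono mult_left_mono power_mono) auto
  also have "\<dots> = (s + t)\<^sup>2"
  proof -
    have "t / s * s\<^sup>2 = s * t" "s / t * t\<^sup>2 = s * t"
      using st by (simp_all add: power2_eq_square)
    then have "(1 + t / s) * s\<^sup>2 + (1 + s / t) * t\<^sup>2 = s\<^sup>2 + s * t + (t\<^sup>2 + s * t)"
      by (simp only: distrib_right mult_1)
    then show ?thesis by (simp add: power2_sum)
  qed
  finally have sq: "(norm_Ht \<Omega> (\<lambda>x. f x - g x))\<^sup>2 \<le> (s + t)\<^sup>2" .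
  have "norm_Ht \<Omega> (\<lambda>x. f x - g x) \<le> s + t"
    by (rule power2_le_imp_le[OF sq]) (use st in simp)
  then show "norm_Ht \<Omega> (\<lambda>x. f x - g x) \<le> norm_Ht \<Omega> f + norm_Ht \<Omega> g + e" by (simp add: s_def t_def)
qed

lemma norm_Ht_minus_commute:
  assumes f: "f \<in> C0_inf \<Omega>" and g: "g \<in> C0_inf \<Omega>"
  shows "norm_Ht \<Omega> (\<lambda>x. f x - g x) = norm_Ht \<Omega> (\<lambda>x. g x - f x)"
  unfolding norm_Ht_def grad_diff[OF C0_inf_D(6)[OF f] C0_inf_D(6)[OF g]]
    grad_diff[OF C0_inf_D(6)[OF g] C0_inf_D(6)[OF f]] by (simp add: norm_minus_commute)

lemma norm_Ht_triangle:
  fixes f g k :: "real^'n::finite \<Rightarrow> real"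
  assumes f: "f \<in> C0_inf \<Omega>" and g: "g \<in> C0_inf \<Omega>" and k: "k \<in> C0_inf \<Omega>" and N3: "CARD('n) \<ge> 3"
  shows "norm_Ht \<Omega> (\<lambda>x. f x - k x) \<le> norm_Ht \<Omega> (\<lambda>x. f x - g x) + norm_Ht \<Omega> (\<lambda>x. g x - k x)"
  using norm_Ht_diff_le[OF C0_inf_diff[OF f g] C0_inf_diff[OF k g] N3] norm_Ht_minus_commute[OF k g] by simp

lemma norm_Ht_cmult:
  fixes f :: "real^'n::finite \<Rightarrow> real"
  assumes f: "f \<in> C0_inf \<Omega>"
  shows "norm_Ht \<Omega> (\<lambda>x. c * f x) = \<bar>c\<bar> * norm_Ht \<Omega> f"
proof -
  have cf: "(\<lambda>x. c * f x) \<in> C0_inf \<Omega>" using C0_inf_mult[OF f C_k_const] by simp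
  have "energy_density (\<lambda>x. c * f x) y = c\<^sup>2 * energy_density f y" for y
    by (simp add: energy_density_def grad_cmult[OF C0_inf_D(6)[OF f]] power_mult_distrib)
  then show ?thesis by (simp add: norm_Ht_eq[OF f] norm_Ht_eq[OF cf] real_sqrt_mult)
qed

lemma norm_Ht_0: "norm_Ht \<Omega> (\<lambda>x::real^'n::finite. 0) = 0"
  using norm_Ht_cmult[OF C0_inf_zero, where c=0 and \<Omega>=\<Omega>] by simp

definition energy_form :: "(real^'n::finite \<Rightarrow> real) \<Rightarrow> (real^'n \<Rightarrow> real) \<Rightarrow> real^'n \<Rightarrow> real" where
  "energy_form f g y = norm y powr (- (real CARD('n) - 2)) * (grad f y \<bullet> grad g y)"

lemma abs_inner_le_weighted:
  fixes a b :: "'a::real_inner"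
  assumes "l > 0"
  shows "\<bar>a \<bullet> b\<bar> \<le> l * (norm a)\<^sup>2 + (norm b)\<^sup>2 / l"
proof -
  have "\<bar>a \<bullet> b\<bar> \<le> norm a * norm b" by (rule Cauchy_Schwarz_ineq2)
  also have "\<dots> \<le> l * (norm a)\<^sup>2 + (norm b)\<^sup>2 / l"
  proof -
    have "0 \<le> (l * norm a - norm b)\<^sup>2 / l" using assms by simp
    also have "\<dots> = l * (norm a)\<^sup>2 + (norm b)\<^sup>2 / l - 2 * (norm a * norm b)"
      using assms by (simp add: field_simps power2_eq_square)
    finally have "2 * (norm a * norm b) \<le> l * (norm a)\<^sup>2 + (norm b)\<^sup>2 / l" by simp
    moreover have "0 \<le> norm a * norm b" by simp
    ultimately show ?thesis by linarith
  qed
  finally show ?thesis .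
qed

lemma integrable_energy_form:
  fixes f g :: "real^'n::finite \<Rightarrow> real"
  assumes f: "f \<in> C0_inf \<Omega>" and g: "g \<in> C0_inf \<Omega>" and N3: "CARD('n) \<ge> 3"
  shows "integrable lborel (energy_form f g)"
proof (rule Bochner_Integration.integrable_bound[OF Bochner_Integration.integrable_add[OF
      integrable_energy_density[OF f N3] integrable_energy_density[OF g N3]]])
  have [measurable]: "grad f \<in> borel_measurable borel" "grad g \<in> borel_measurable borel"
    using borel_measurable_C0_inf(2)[OF f] borel_measurable_C0_inf(2)[OF g] by auto
  show "energy_form f g \<in> borel_measurable lborel" unfolding energy_form_def[abs_def] by measurable
  show "AE y in lborel. norm (energy_form f g y) \<le> norm (energy_density f y + energy_density g y)"
  proof (intro AE_I2)
    fix y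
    have "\<bar>energy_form f g y\<bar> \<le> norm y powr (- (real CARD('n) - 2)) * (1 * (norm (grad f y))\<^sup>2 + (norm (grad g y))\<^sup>2 / 1)"
      unfolding energy_form_def abs_mult abs_of_nonneg[OF powr_ge_zero]
      by (intro mult_left_mono abs_inner_le_weighted) auto
    then show "norm (energy_form f g y) \<le> norm (energy_density f y + energy_density g y)"
      using energy_density_nonneg[of f y] energy_density_nonneg[of g y] by (simp add: energy_density_def algebra_simps)
  qed
qed

lemma norm_Ht_diff_square:
  fixes f g :: "real^'n::finite \<Rightarrow> real"
  assumes f: "f \<in> C0_inf \<Omega>" and g: "g \<in> C0_inf \<Omega>" and N3: "CARD('n) \<ge> 3"
  shows "(norm_Ht \<Omega> (\<lambda>x. f x - g x))\<^sup>2 =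
    (norm_Ht \<Omega> f)\<^sup>2 - 2 * (\<integral>y. energy_form f g y \<partial>lborel) + (norm_Ht \<Omega> g)\<^sup>2"
proof -
  have "energy_density (\<lambda>x. f x - g x) y = energy_density f y - 2 * energy_form f g y + energy_density g y" for y
    by (simp add: energy_density_def energy_form_def grad_diff[OF C0_inf_D(6)[OF f] C0_inf_D(6)[OF g]]
      power2_norm_eq_inner inner_diff_left inner_diff_right inner_commute[of "grad g y" "grad f y"] algebra_simps)
  then show ?thesis
    using integrable_energy_density[OF f N3] integrable_energy_density[OF g N3] integrable_energy_form[OF f g N3]
    by (simp add: norm_Ht_square(1)[OF C0_inf_diff[OF f g]] norm_Ht_square(1)[OF f] norm_Ht_square(1)[OF g])
qed

text \<open>For the smooth weight \<open>w l\<close> the derivatives of \<open>D k\<close> can be moved to \<open>g\<close> and to the weight, after which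
  convergence in \<open>L\<^sup>1\<close> applies. The error of replacing the singular weight is small uniformly in \<open>k\<close>,
  because it only involves the bounded energies of \<open>D k\<close> and the energy that the fixed function \<open>g\<close> has
  in the difference of the weights.\<close>

lemma energy_form_weak_limit:
  fixes D :: "nat \<Rightarrow> real^'n::finite \<Rightarrow> real"
  assumes N3: "CARD('n) \<ge> 3" and D: "\<And>k. D k \<in> C0_inf \<Omega>" and bd: "\<And>k. norm_Ht \<Omega> (D k) \<le> B"
    and g: "g \<in> C0_inf \<Omega>" and L1: "(\<lambda>k. \<integral>y. \<bar>D k y\<bar> \<partial>lborel) \<longlonglongrightarrow> 0"
  shows "(\<lambda>k. \<integral>y. energy_form (D k) g y \<partial>lborel) \<longlonglongrightarrow> 0"
proof -
  define N where "N = real CARD('n)"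
  have N: "N \<ge> 3" using N3 by (simp add: N_def)
  define h :: "nat \<Rightarrow> real" where "h n = inverse (Suc n)" for n
  have h: "(h n)\<^sup>2 > 0" for n by (auto simp: h_def field_simps)
  have h0: "h \<longlonglongrightarrow> 0" unfolding h_def by (rule LIMSEQ_inverse_real_of_nat)
  define \<omega> where "\<omega> y = norm y powr (- (N - 2))" for y :: "real^'n"
  define w where "w l = reg_powr (0::real^'n) ((h l)\<^sup>2) (- (N - 2) / 2)" for l
  have expo: "2 * (- (N - 2) / 2) = - (N - 2)" by (simp add: field_simps)
  have w: "C_k k (w l)" for k l unfolding w_def by (rule C_k_reg_powr[OF h])
  have w0: "0 \<le> w l y" for l y by (simp add: w_def reg_powr_def)
  have wle: "w l y \<le> \<omega> y" if "y \<noteq> 0" for l y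
    using reg_powr_le[of "(h l)\<^sup>2" "- (N - 2) / 2" y 0] that N unfolding w_def \<omega>_def expo by simp
  have [measurable]: "grad (D k) \<in> borel_measurable borel" "D k \<in> borel_measurable borel" "grad g \<in> borel_measurable borel" for k
    using borel_measurable_C0_inf[OF D] borel_measurable_C0_inf[OF g] by auto
  have [measurable]: "w l \<in> borel_measurable borel" "\<omega> \<in> borel_measurable borel" for l
    unfolding w_def \<omega>_def[abs_def] reg_powr_def[abs_def] by measurable
  have ed: "energy_density f y = \<omega> y * (norm (grad f y))\<^sup>2" for f y by (simp add: energy_density_def \<omega>_def N_def)
  have ef: "energy_form f f' y = \<omega> y * (grad f y \<bullet> grad f' y)" for f f' y by (simp add: energy_form_def \<omega>_def N_def)
  define \<rho> where "\<rho> l = (\<integral>y. (\<omega> y - w l y) * (norm (grad g y))\<^sup>2 \<partial>lborel)" for l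
  have bound_g: "AE y in lborel. norm ((\<omega> y - w l y) * (norm (grad g y))\<^sup>2) \<le> energy_density g y" for l
    using AE_lborel_singleton[of "0::real^'n"]
  proof eventually_elim
    case (elim y)
    have "\<bar>\<omega> y - w l y\<bar> \<le> \<omega> y" using w0[of l y] wle[OF elim, of l] by simp
    then show ?case by (simp add: ed abs_mult mult_right_mono)
  qed
  have int_g: "integrable lborel (\<lambda>y. (\<omega> y - w l y) * (norm (grad g y))\<^sup>2)" for l
    by (rule Bochner_Integration.integrable_bound[OF integrable_energy_density[OF g N3]])
      (measurable, use bound_g[of l] in \<open>simp add: abs_of_nonneg[OF energy_density_nonneg]\<close>)
  have \<rho>0: "\<rho> \<longlonglongrightarrow> 0"
  proof -
    have "\<rho> \<longlonglongrightarrow> (\<integral>y. 0 \<partial>(lborel :: (real^'n) measure))"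
      unfolding \<rho>_def
    proof (rule integral_dominated_convergence[OF _ _ integrable_energy_density[OF g N3] _ bound_g])
      show "AE y in lborel. (\<lambda>l. (\<omega> y - w l y) * (norm (grad g y))\<^sup>2) \<longlonglongrightarrow> 0"
        using AE_lborel_singleton[of "0::real^'n"]
      proof eventually_elim
        case (elim y)
        have "(\<lambda>l. w l y) \<longlonglongrightarrow> \<omega> y"
          using tendsto_reg_powr[OF h0 elim, of "- (N - 2) / 2"] unfolding w_def \<omega>_def expo by simp
        then have "(\<lambda>l. (\<omega> y - w l y) * (norm (grad g y))\<^sup>2) \<longlonglongrightarrow> (\<omega> y - \<omega> y) * (norm (grad g y))\<^sup>2"
          by (intro tendsto_intros)
        then show ?case by simp
      qed
    qed auto
    then show ?thesis by simp
  qed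
  have cw: "continuous_on UNIV (w l)" for l using C_k_continuous[OF w] .
  have int_w: "integrable lborel (\<lambda>y. w l y * (grad (D k) y \<bullet> grad g y))" for l k
  proof (rule integrable_compact_supp)
    show "continuous_on UNIV (\<lambda>y. w l y * (grad (D k) y \<bullet> grad g y))"
      by (intro continuous_intros cw C0_inf_D(8)[OF D] C0_inf_D(8)[OF g])
    have "{y. w l y * (grad (D k) y \<bullet> grad g y) \<noteq> 0} \<subseteq> closure {x. g x \<noteq> 0}"
    proof clarify
      fix y assume y: "w l y * (grad (D k) y \<bullet> grad g y) \<noteq> 0"
      show "y \<in> closure {x. g x \<noteq> 0}"
      proof (rule ccontr)
        assume "y \<notin> closure {x. g x \<noteq> 0}"
        then have "grad g y = 0" by (simp add: grad_def vec_eq_iff partial_deriv_eq_0)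
        with y show False by simp
      qed
    qed
    then show "bounded {y. w l y * (grad (D k) y \<bullet> grad g y) \<noteq> 0}"
      using bounded_subset bounded_closure[OF bounded_supp_C0_inf[OF g]] by blast
  qed
  have err: "\<bar>(\<integral>y. energy_form (D k) g y \<partial>lborel) - (\<integral>y. w l y * (grad (D k) y \<bullet> grad g y) \<partial>lborel)\<bar> \<le> t * B\<^sup>2 + \<rho> l / t"
    if t: "t > 0" for k l t
  proof -
    note iD = integrable_energy_density[OF D N3, of k]
    have "(\<integral>y. energy_form (D k) g y \<partial>lborel) - (\<integral>y. w l y * (grad (D k) y \<bullet> grad g y) \<partial>lborel)
      = (\<integral>y. energy_form (D k) g y - w l y * (grad (D k) y \<bullet> grad g y) \<partial>lborel)"
      using integrable_energy_form[OF D g N3] int_w by simp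
    also have "\<bar>\<dots>\<bar> \<le> (\<integral>y. t * energy_density (D k) y + (\<omega> y - w l y) * (norm (grad g y))\<^sup>2 / t \<partial>lborel)"
    proof (rule order_trans[OF integral_abs_bound integral_mono_AE])
      show "AE y in lborel. \<bar>energy_form (D k) g y - w l y * (grad (D k) y \<bullet> grad g y)\<bar> \<le>
         t * energy_density (D k) y + (\<omega> y - w l y) * (norm (grad g y))\<^sup>2 / t"
        using AE_lborel_singleton[of "0::real^'n"]
      proof eventually_elim
        case (elim y)
        have d: "0 \<le> \<omega> y - w l y" using wle[OF elim, of l] by simp
        have "\<bar>energy_form (D k) g y - w l y * (grad (D k) y \<bullet> grad g y)\<bar> = (\<omega> y - w l y) * \<bar>grad (D k) y \<bullet> grad g y\<bar>"
          using d unfolding ef left_diff_distrib[symmetric] abs_mult by simp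
        also have "\<dots> \<le> (\<omega> y - w l y) * (t * (norm (grad (D k) y))\<^sup>2 + (norm (grad g y))\<^sup>2 / t)"
          by (intro mult_left_mono abs_inner_le_weighted t d)
        also have "\<dots> = (\<omega> y - w l y) * (t * (norm (grad (D k) y))\<^sup>2) + (\<omega> y - w l y) * (norm (grad g y))\<^sup>2 / t"
          by (simp add: algebra_simps)
        also have "\<dots> \<le> \<omega> y * (t * (norm (grad (D k) y))\<^sup>2) + (\<omega> y - w l y) * (norm (grad g y))\<^sup>2 / t"
          using t w0 by (intro add_right_mono mult_right_mono) auto
        finally show ?case by (simp add: ed mult_ac)
      qed
      show "integrable lborel (\<lambda>y. \<bar>energy_form (D k) g y - w l y * (grad (D k) y \<bullet> grad g y)\<bar>)"
        using integrable_energy_form[OF D g N3] int_w by simp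
      show "integrable lborel (\<lambda>y. t * energy_density (D k) y + (\<omega> y - w l y) * (norm (grad g y))\<^sup>2 / t)"
        using iD int_g by simp
    qed
    also have "\<dots> = t * (norm_Ht \<Omega> (D k))\<^sup>2 + \<rho> l / t"
      using iD int_g by (simp add: \<rho>_def norm_Ht_square(1)[OF D])
    also have "\<dots> \<le> t * B\<^sup>2 + \<rho> l / t"
      using t bd[of k] norm_Ht_square(2)[OF D, of k] by (intro add_right_mono mult_left_mono power_mono) auto
    finally show ?thesis .
  qed
  \<comment> \<open>for the regular weight, the derivatives can be moved to the fixed function\<close>
  have "\<exists>C. \<forall>k. \<bar>\<integral>y. w l y * (grad (D k) y \<bullet> grad g y) \<partial>lborel\<bar> \<le> C * (\<integral>y. \<bar>D k y\<bar> \<partial>lborel)" for l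
  proof -
    define \<psi> where "\<psi> i y = w l y * partial_deriv i g y" for i y
    have \<psi>: "C_k (Suc 0) (\<psi> i)" for i
      unfolding \<psi>_def by (intro C_k_mult w C_k_partial C0_inf_D(1)[OF g])
    have bdg: "bounded {x. g x \<noteq> 0}" by (rule bounded_supp_C0_inf[OF g])
    have b\<psi>: "bounded {y. \<psi> i y \<noteq> 0}" for i
      by (rule bounded_subset[OF bounded_supp_partial_deriv[OF bdg, of i]]) (auto simp: \<psi>_def)
    have c\<psi>: "continuous_on UNIV (partial_deriv i (\<psi> i))" for i using \<psi>[of i] by simp
    have "\<exists>M. \<forall>y. \<bar>partial_deriv i (\<psi> i) y\<bar> \<le> M" for i
      using bounded_compact_supp[OF c\<psi> bounded_supp_partial_deriv[OF b\<psi>]] by metis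
    then obtain M where M: "\<And>i y. \<bar>partial_deriv i (\<psi> i) y\<bar> \<le> M i" by metis
    have "\<bar>\<integral>y. w l y * (grad (D k) y \<bullet> grad g y) \<partial>lborel\<bar> \<le> (\<Sum>i\<in>UNIV. M i) * (\<integral>y. \<bar>D k y\<bar> \<partial>lborel)" for k
    proof -
      have D1: "C_k (Suc 0) (D k)" and bD: "bounded {x. D k x \<noteq> 0}"
        using C0_inf_D(1)[OF D] bounded_supp_C0_inf[OF D] by auto
      have cD: "continuous_on UNIV (D k)" "continuous_on UNIV (partial_deriv i (D k))" for i
        using C_k_continuous[OF D1] D1 by auto
      have iD: "integrable lborel (D k)" by (rule integrable_compact_supp[OF cD(1) bD])
      have i1: "integrable lborel (\<lambda>y. \<psi> i y * partial_deriv i (D k) y)" for i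
        by (intro integrable_compact_supp continuous_intros C_k_continuous[OF \<psi>] cD)
          (auto intro: bounded_subset[OF b\<psi>[of i]])
      have "(\<integral>y. w l y * (grad (D k) y \<bullet> grad g y) \<partial>lborel) = (\<integral>y. (\<Sum>i\<in>UNIV. \<psi> i y * partial_deriv i (D k) y) \<partial>lborel)"
        by (simp add: grad_def inner_vec_def \<psi>_def sum_distrib_left mult_ac)
      also have "\<dots> = (\<Sum>i\<in>UNIV. \<integral>y. \<psi> i y * partial_deriv i (D k) y \<partial>lborel)"
        using i1 by (intro Bochner_Integration.integral_sum) auto
      also have "\<dots> = (\<Sum>i\<in>UNIV. - (\<integral>y. partial_deriv i (\<psi> i) y * D k y \<partial>lborel))"
        by (intro sum.cong refl integral_by_parts \<psi> D1 bD)
      also have "\<bar>\<dots>\<bar> \<le> (\<Sum>i\<in>UNIV. \<bar>- (\<integral>y. partial_deriv i (\<psi> i) y * D k y \<partial>lborel)\<bar>)" by (rule sum_abs)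
      also have "\<dots> \<le> (\<Sum>i\<in>UNIV. M i * (\<integral>y. \<bar>D k y\<bar> \<partial>lborel))"
      proof (rule sum_mono)
        fix i
        have "\<bar>- (\<integral>y. partial_deriv i (\<psi> i) y * D k y \<partial>lborel)\<bar> \<le> (\<integral>y. M i * \<bar>D k y\<bar> \<partial>lborel)"
          unfolding abs_minus_cancel
        proof (rule order_trans[OF integral_abs_bound integral_mono'])
          show "integrable lborel (\<lambda>y. M i * \<bar>D k y\<bar>)" using iD by simp
          show "\<bar>partial_deriv i (\<psi> i) y * D k y\<bar> \<le> M i * \<bar>D k y\<bar>" for y
            unfolding abs_mult by (intro mult_right_mono M) simp
          show "0 \<le> M i * \<bar>D k y\<bar>" for y using order_trans[OF abs_ge_zero M] by simp
        qed
        then show "\<bar>- (\<integral>y. partial_deriv i (\<psi> i) y * D k y \<partial>lborel)\<bar> \<le> M i * (\<integral>y. \<bar>D k y\<bar> \<partial>lborel)" by simp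
      qed
      finally show ?thesis by (simp add: sum_distrib_right)
    qed
    then show ?thesis by blast
  qed
  then obtain C where C: "\<And>l k. \<bar>\<integral>y. w l y * (grad (D k) y \<bullet> grad g y) \<partial>lborel\<bar> \<le> C l * (\<integral>y. \<bar>D k y\<bar> \<partial>lborel)" by metis
  show ?thesis
  proof (rule LIMSEQ_I)
    fix e :: real assume e: "e > 0"
    define t where "t = e / (3 * (B\<^sup>2 + 1))"
    have B1: "B\<^sup>2 + 1 > 0" by (simp add: add_nonneg_pos)
    have t: "t > 0" using e B1 by (simp add: t_def)
    have "t * B\<^sup>2 \<le> t * (B\<^sup>2 + 1)" using t by simp
    also have "\<dots> = e / 3"     proof -
      have "e / (3 * s) * s = e / 3" if "s > 0" for s using that by simp
      from this[OF B1] show ?thesis by (simp only: t_def)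
    qed
    finally have tB: "t * B\<^sup>2 \<le> e / 3" .
    have "\<forall>\<^sub>F l in sequentially. \<rho> l < t * (e / 3)" using \<rho>0 t e by (intro order_tendstoD) auto
    then obtain l where l: "\<rho> l < t * (e / 3)" by (auto simp: eventually_sequentially)
    have lt: "\<rho> l / t < e / 3" using l t by (simp add: field_simps)
    have "(\<lambda>k. C l * (\<integral>y. \<bar>D k y\<bar> \<partial>lborel)) \<longlonglongrightarrow> C l * 0" by (intro tendsto_intros L1)
    then have "\<forall>\<^sub>F k in sequentially. C l * (\<integral>y. \<bar>D k y\<bar> \<partial>lborel) < e / 3" using e by (intro order_tendstoD) auto
    then obtain K where K: "\<And>k. k \<ge> K \<Longrightarrow> C l * (\<integral>y. \<bar>D k y\<bar> \<partial>lborel) < e / 3" by (auto simp: eventually_sequentially)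
    show "\<exists>K. \<forall>k\<ge>K. norm ((\<integral>y. energy_form (D k) g y \<partial>lborel) - 0) < e"
    proof (intro exI[of _ K] allI impI)
      fix k assume "k \<ge> K"
      then show "norm ((\<integral>y. energy_form (D k) g y \<partial>lborel) - 0) < e"
        using K[of k] C[of l k] err[OF t, of k l] tB lt unfolding real_norm_def by linarith
    qed
  qed
qed

text \<open>For large \<open>k\<close> and \<open>m\<close> the energy of \<open>D k - D m\<close> is small. It equals the energy of \<open>D m\<close>, plus that
  of \<open>D k\<close>, minus twice their energy product, and this product tends to zero for fixed \<open>m\<close> as \<open>k\<close>
  grows; so the energy of \<open>D m\<close> is small itself.\<close>

lemma norm_Ht_closable:
  fixes D :: "nat \<Rightarrow> real^'n::finite \<Rightarrow> real"
  assumes N3: "CARD('n) \<ge> 3" and D: "\<And>k. D k \<in> C0_inf \<Omega>"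
    and Cau: "\<And>e. e > 0 \<Longrightarrow> \<exists>K. \<forall>j\<ge>K. \<forall>k\<ge>K. norm_Ht \<Omega> (\<lambda>x. D j x - D k x) < e"
    and L1: "(\<lambda>k. \<integral>y. \<bar>D k y\<bar> \<partial>lborel) \<longlonglongrightarrow> 0"
  shows "(\<lambda>k. norm_Ht \<Omega> (D k)) \<longlonglongrightarrow> 0"
proof -
  obtain K0 where K0: "\<And>j k. j \<ge> K0 \<Longrightarrow> k \<ge> K0 \<Longrightarrow> norm_Ht \<Omega> (\<lambda>x. D j x - D k x) < 1"
    using Cau[of 1] by auto
  define B where "B = norm_Ht \<Omega> (D K0) + 1"
  have B: "norm_Ht \<Omega> (D (k + K0)) \<le> B" for k
    using norm_Ht_triangle[OF D D C0_inf_zero N3, of "k + K0" K0] K0[of "k + K0" K0] by (simp add: B_def)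
  have weak: "(\<lambda>k. \<integral>y. energy_form (D (k + K0)) (D m) y \<partial>lborel) \<longlonglongrightarrow> 0" for m
    by (rule energy_form_weak_limit[OF N3 D B D]) (rule LIMSEQ_ignore_initial_segment[OF L1])
  show ?thesis
  proof (rule LIMSEQ_I)
    fix e :: real assume e: "e > 0"
    obtain K where K: "\<And>j k. j \<ge> K \<Longrightarrow> k \<ge> K \<Longrightarrow> norm_Ht \<Omega> (\<lambda>x. D j x - D k x) < e / 2"
      using Cau[of "e / 2"] e by auto
    have "norm_Ht \<Omega> (D m) < e" if m: "m \<ge> K" for m
    proof -
      have "\<forall>\<^sub>F k in sequentially. (\<integral>y. energy_form (D (k + K0)) (D m) y \<partial>lborel) < e\<^sup>2 / 4"
        using e by (intro order_tendstoD[OF weak]) auto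
      then obtain K' where K': "\<And>k. k \<ge> K' \<Longrightarrow> (\<integral>y. energy_form (D (k + K0)) (D m) y \<partial>lborel) < e\<^sup>2 / 4"
        by (auto simp: eventually_sequentially)
      define k where "k = max K K' + K0"
      have s: "(\<integral>y. energy_form (D k) (D m) y \<partial>lborel) < e\<^sup>2 / 4" using K'[of "max K K'"] by (simp add: k_def)
      have kK: "k \<ge> K" by (simp add: k_def)
      have "(norm_Ht \<Omega> (\<lambda>x. D k x - D m x))\<^sup>2 \<le> (e / 2)\<^sup>2"
        using K[OF kK m] norm_Ht_square(2)[OF C0_inf_diff[OF D D], of k m] by (intro power_mono) auto
      then have "(norm_Ht \<Omega> (D m))\<^sup>2 < e\<^sup>2"
      proof -
        have "(e / 2)\<^sup>2 = e\<^sup>2 / 4" "e\<^sup>2 > 0" using e by (simp_all add: power_divide)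
        with \<open>(norm_Ht \<Omega> (\<lambda>x. D k x - D m x))\<^sup>2 \<le> (e / 2)\<^sup>2\<close> show ?thesis
          using norm_Ht_diff_square[OF D D N3, of k m] s zero_le_power2[of "norm_Ht \<Omega> (D k)"] by linarith
      qed
      then show ?thesis using e by (meson less_imp_le power_less_imp_less_base)
    qed
    then show "\<exists>K. \<forall>k\<ge>K. norm (norm_Ht \<Omega> (D k) - 0) < e"
      using norm_Ht_square(2)[OF D] by (intro exI[of _ K]) auto
  qed
qed

section \<open>Weighted Lebesgue spaces\<close>

locale Lq_weight =
  fixes \<Omega> :: "(real^'n::finite) set" and w :: "real^'n \<Rightarrow> real" and q :: real
  assumes q1: "q \<ge> 1" and \<Omega>m: "\<Omega> \<in> sets lebesgue" and wm: "w \<in> borel_measurable lebesgue"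
    and w0: "\<And>x. w x \<ge> 0" and wpos: "AE x in lebesgue. x \<in> \<Omega> \<longrightarrow> w x > 0"
begin

abbreviation meas :: "(real^'n \<Rightarrow> real) \<Rightarrow> bool" where "meas f \<equiv> set_borel_measurable lebesgue \<Omega> f"

text \<open>The indicator multiplies \<open>f\<close> and not the whole integrand, so that the density of a function that is
  measurable only on \<open>\<Omega>\<close> is measurable. As \<open>q > 0\<close>, the value is the same.\<close>

definition dens :: "(real^'n \<Rightarrow> real) \<Rightarrow> real^'n \<Rightarrow> real" where
  "dens f x = w x * \<bar>indicator \<Omega> x * f x\<bar> powr q"

text \<open>The power \<open>q\<close> of the norm as an extended number. It satisfies the triangle inequality only
  up to the factor \<open>2 powr q\<close>, which is enough for all limit arguments.\<close>

definition Iq :: "(real^'n \<Rightarrow> real) \<Rightarrow> ennreal" where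
  "Iq f = (\<integral>\<^sup>+x. ennreal (dens f x) \<partial>lebesgue)"

lemma dens_eq: "dens f x = indicator \<Omega> x * (w x * \<bar>f x\<bar> powr q)"
  using q1 by (simp add: dens_def indicator_def)

lemma dens_nonneg: "dens f x \<ge> 0"
  using w0 by (simp add: dens_def)

lemma measD: "meas f \<Longrightarrow> (\<lambda>x. indicator \<Omega> x * f x) \<in> borel_measurable lebesgue"
  by (simp add: set_borel_measurable_def)

lemma meas_diff: "meas f \<Longrightarrow> meas g \<Longrightarrow> meas (\<lambda>x. f x - g x)"
  unfolding set_borel_measurable_def by (simp add: algebra_simps borel_measurable_diff)

lemma dens_measurable[measurable]: "meas f \<Longrightarrow> dens f \<in> borel_measurable lebesgue"
  using wm measD[of f] unfolding dens_def[abs_def] by measurable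

lemma Lq_finite_iff: "Lq_finite \<Omega> w q f \<longleftrightarrow> meas f \<and> Iq f < \<infinity>"
proof -
  have "set_integrable lebesgue \<Omega> (\<lambda>x. w x * \<bar>f x\<bar> powr q) \<longleftrightarrow> integrable lebesgue (dens f)"
    unfolding set_integrable_def by (simp add: dens_eq[abs_def])
  also have "\<dots> \<longleftrightarrow> Iq f < \<infinity>" if "meas f"
    using dens_measurable[OF that] dens_nonneg[of f] unfolding integrable_iff_bounded Iq_def by simp
  finally show ?thesis unfolding Lq_finite_def by blast
qed

lemma Lq_norm_eq: "meas f \<Longrightarrow> Lq_norm \<Omega> w q f = enn2real (Iq f) powr (1 / q)"
  unfolding Lq_norm_def set_lebesgue_integral_def Iq_def
  using dens_measurable[of f] dens_nonneg[of f]
  by (subst integral_eq_nn_integral) (auto simp: dens_eq[abs_def])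

lemma Lq_norm_powr: "Lq_finite \<Omega> w q f \<Longrightarrow> ennreal (Lq_norm \<Omega> w q f powr q) = Iq f"
  using q1 by (simp add: Lq_finite_iff Lq_norm_eq powr_powr)

lemma Lq_norm_nonneg: "Lq_norm \<Omega> w q f \<ge> 0"
  by (simp add: Lq_norm_def)

lemma dens_triangle: "dens (\<lambda>x. f x - g x) x \<le> 2 powr q * (dens f x + dens g x)"
proof -
  let ?a = "\<bar>indicator \<Omega> x * f x\<bar>" and ?b = "\<bar>indicator \<Omega> x * g x\<bar>"
  have "\<bar>indicator \<Omega> x * (f x - g x)\<bar> \<le> 2 * max ?a ?b"
    unfolding right_diff_distrib by linarith
  then have "\<bar>indicator \<Omega> x * (f x - g x)\<bar> powr q \<le> (2 * max ?a ?b) powr q"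
    using q1 by (intro powr_mono2) auto
  also have "\<dots> = 2 powr q * max ?a ?b powr q" by (simp add: powr_mult)
  also have "\<dots> \<le> 2 powr q * (?a powr q + ?b powr q)" by (intro mult_left_mono) (auto simp: max_def)
  finally have "dens (\<lambda>x. f x - g x) x \<le> w x * (2 powr q * (?a powr q + ?b powr q))"
    unfolding dens_def by (intro mult_left_mono w0) auto
  then show ?thesis by (simp add: dens_def algebra_simps)
qed

lemma Iq_diff_le:
  assumes "meas f" "meas g"
  shows "Iq (\<lambda>x. f x - g x) \<le> ennreal (2 powr q) * (Iq f + Iq g)"
proof -
  have "Iq (\<lambda>x. f x - g x) \<le> (\<integral>\<^sup>+x. ennreal (2 powr q) * (ennreal (dens f x) + ennreal (dens g x)) \<partial>lebesgue)"
    unfolding Iq_def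
  proof (rule nn_integral_mono)
    fix x
    show "ennreal (dens (\<lambda>x. f x - g x) x) \<le> ennreal (2 powr q) * (ennreal (dens f x) + ennreal (dens g x))"
      using ennreal_leI[OF dens_triangle[of f g x]] dens_nonneg[of f x] dens_nonneg[of g x]
      by (simp add: ennreal_mult' ennreal_plus)
  qed
  also have "\<dots> = ennreal (2 powr q) * (Iq f + Iq g)"
    using assms by (simp add: nn_integral_cmult nn_integral_add Iq_def)
  finally show ?thesis .
qed

lemma Iq_minus_commute: "Iq (\<lambda>x. f x - g x) = Iq (\<lambda>x. g x - f x)"
  by (simp add: Iq_def dens_eq abs_minus_commute)

lemma Iq_triangle:
  assumes "meas f" "meas g" "meas h"
  shows "Iq (\<lambda>x. f x - h x) \<le> ennreal (2 powr q) * (Iq (\<lambda>x. f x - g x) + Iq (\<lambda>x. g x - h x))"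
  using Iq_diff_le[OF meas_diff[OF assms(1,2)] meas_diff[OF assms(3,2)]] Iq_minus_commute[of h g] by simp

lemma meas_0: "meas (\<lambda>x. 0)" by (simp add: set_borel_measurable_def)

lemma Iq_le:
  assumes "meas f" "meas g"
  shows "Iq f \<le> ennreal (2 powr q) * (Iq g + Iq (\<lambda>x. f x - g x))"
  using Iq_triangle[OF assms meas_0] by (simp add: add.commute)

lemma Lq_finite_diff:
  assumes "Lq_finite \<Omega> w q f" "Lq_finite \<Omega> w q g"
  shows "Lq_finite \<Omega> w q (\<lambda>x. f x - g x)"
  using assms Iq_diff_le[of f g] le_less_trans unfolding Lq_finite_iff
  by (auto intro: meas_diff simp: ennreal_mult_less_top intro: le_less_trans)

lemma Lq_norm_tendsto_0_iff:
  assumes "\<And>k. Lq_finite \<Omega> w q (G k)"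
  shows "(\<lambda>k. Lq_norm \<Omega> w q (G k)) \<longlonglongrightarrow> 0 \<longleftrightarrow> (\<lambda>k. Iq (G k)) \<longlonglongrightarrow> 0"
proof
  assume "(\<lambda>k. Lq_norm \<Omega> w q (G k)) \<longlonglongrightarrow> 0"
  then have "(\<lambda>k. Lq_norm \<Omega> w q (G k) powr q) \<longlonglongrightarrow> 0 powr q"
    using q1 by (intro tendsto_powr' tendsto_const) (auto simp: Lq_norm_nonneg)
  then have "(\<lambda>k. ennreal (Lq_norm \<Omega> w q (G k) powr q)) \<longlonglongrightarrow> ennreal 0"
    by (intro tendsto_ennrealI) simp
  then show "(\<lambda>k. Iq (G k)) \<longlonglongrightarrow> 0" using Lq_norm_powr[OF assms] by simp
next
  assume "(\<lambda>k. Iq (G k)) \<longlonglongrightarrow> 0"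
  then have "(\<lambda>k. enn2real (Iq (G k))) \<longlonglongrightarrow> enn2real 0" by (intro tendsto_enn2real) auto
  then have "(\<lambda>k. enn2real (Iq (G k)) powr (1 / q)) \<longlonglongrightarrow> 0 powr (1 / q)"
    using q1 by (intro tendsto_powr' tendsto_const) auto
  then show "(\<lambda>k. Lq_norm \<Omega> w q (G k)) \<longlonglongrightarrow> 0"
    using assms by (simp add: Lq_finite_iff Lq_norm_eq)
qed

lemma Lq_space_finite: "f \<in> Lq_space \<Omega> w q \<Longrightarrow> Lq_finite \<Omega> w q f" by (simp add: Lq_space_def)

lemma Lq_norm_0: "Lq_norm \<Omega> w q (\<lambda>x. 0) = 0" using q1 by (simp add: Lq_norm_def set_lebesgue_integral_def)

lemma Lq_norm_less:
  assumes "Lq_finite \<Omega> w q f" "Iq f < ennreal (e powr q)" "e > 0"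
  shows "Lq_norm \<Omega> w q f < e"
proof -
  have "Lq_norm \<Omega> w q f powr q < e powr q"
    using assms(2) Lq_norm_powr[OF assms(1)] by (metis ennreal_less_iff powr_ge_zero)
  then show ?thesis using q1 assms(3) Lq_norm_nonneg
    by (smt (verit) powr_mono2)
qed

lemma Lq_space_limit:
  assumes F: "\<And>k. F k \<in> Lq_space \<Omega> w q" and f: "Lq_finite \<Omega> w q f" and lim: "(\<lambda>k. Iq (\<lambda>x. F k x - f x)) \<longlonglongrightarrow> 0"
  shows "f \<in> Lq_space \<Omega> w q"
  unfolding Lq_space_def mem_Collect_eq
proof (intro conjI allI impI f)
  fix e :: real assume e: "e > 0"
  define \<eta> where "\<eta> = e powr q / (4 * 2 powr q)"
  have eta: "\<eta> > 0" using e by (simp add: \<eta>_def)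
  have "\<forall>\<^sub>F k in sequentially. Iq (\<lambda>x. F k x - f x) < ennreal \<eta>" using eta by (intro order_tendstoD[OF lim]) simp
  then obtain k where k: "Iq (\<lambda>x. F k x - f x) < ennreal \<eta>" by (auto simp: eventually_sequentially)
  obtain \<phi> where \<phi>: "\<phi> \<in> C0_inf \<Omega>" "Lq_finite \<Omega> w q (\<lambda>x. F k x - \<phi> x)" "Lq_norm \<Omega> w q (\<lambda>x. F k x - \<phi> x) < \<eta> powr (1 / q)"
    using F[of k] eta unfolding Lq_space_def by (auto dest!: spec[of _ "\<eta> powr (1 / q)"])
  have "Lq_norm \<Omega> w q (\<lambda>x. F k x - \<phi> x) powr q < (\<eta> powr (1 / q)) powr q"
    using \<phi>(3) q1 Lq_norm_nonneg by (intro powr_less_mono2) auto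
  also have "\<dots> = \<eta>" using q1 eta by (simp add: powr_powr)
  finally have I\<phi>: "Iq (\<lambda>x. F k x - \<phi> x) < ennreal \<eta>"
    using Lq_norm_powr[OF \<phi>(2)] by (metis ennreal_lessI eta)
  have Fk: "meas (F k)" "Lq_finite \<Omega> w q (F k)" using Lq_space_finite[OF F] by (auto simp: Lq_finite_iff)
  have fin\<phi>: "Lq_finite \<Omega> w q \<phi>"
    using Lq_finite_diff[OF Fk(2) \<phi>(2)] by simp
  have "Iq (\<lambda>x. f x - \<phi> x) \<le> ennreal (2 powr q) * (Iq (\<lambda>x. f x - F k x) + Iq (\<lambda>x. F k x - \<phi> x))"
    using f Fk fin\<phi> by (intro Iq_triangle) (auto simp: Lq_finite_iff)
  also have "\<dots> \<le> ennreal (2 powr q) * (ennreal \<eta> + ennreal \<eta>)"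
    using k I\<phi> by (intro mult_left_mono add_mono) (auto simp: Iq_minus_commute[of f])
  also have "\<dots> = ennreal (e powr q / 2)"
    using eta by (simp add: \<eta>_def flip: ennreal_plus ennreal_mult')
  also have "\<dots> < ennreal (e powr q)" using e by (intro ennreal_lessI) auto
  finally have "Iq (\<lambda>x. f x - \<phi> x) < ennreal (e powr q)" .
  then have "Lq_norm \<Omega> w q (\<lambda>x. f x - \<phi> x) < e"
    using Lq_finite_diff[OF f fin\<phi>] e by (intro Lq_norm_less)
  then show "\<exists>\<phi>\<in>C0_inf \<Omega>. Lq_finite \<Omega> w q (\<lambda>x. f x - \<phi> x) \<and> Lq_norm \<Omega> w q (\<lambda>x. f x - \<phi> x) < e"
    using \<phi>(1) Lq_finite_diff[OF f fin\<phi>] by blast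
qed

lemma Lq_conv_iff:
  "Lq_conv \<Omega> w q F f \<longleftrightarrow> (\<forall>k. F k \<in> Lq_space \<Omega> w q) \<and> Lq_finite \<Omega> w q f \<and> (\<lambda>k. Iq (\<lambda>x. F k x - f x)) \<longlonglongrightarrow> 0"
proof -
  have "(\<lambda>k. Lq_norm \<Omega> w q (\<lambda>x. F k x - f x)) \<longlonglongrightarrow> 0 \<longleftrightarrow> (\<lambda>k. Iq (\<lambda>x. F k x - f x)) \<longlonglongrightarrow> 0"
    if "\<forall>k. F k \<in> Lq_space \<Omega> w q" "Lq_finite \<Omega> w q f"
    by (rule Lq_norm_tendsto_0_iff, rule Lq_finite_diff[OF Lq_space_finite that(2)]) (use that(1) in blast)
  then show ?thesis unfolding Lq_conv_def using Lq_space_limit[of F f] Lq_space_finite[of f] by blast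
qed

definition Lq_Cauchy :: "(nat \<Rightarrow> real^'n \<Rightarrow> real) \<Rightarrow> bool" where
  "Lq_Cauchy F \<longleftrightarrow> (\<forall>e>0. \<exists>K. \<forall>j\<ge>K. \<forall>k\<ge>K. Iq (\<lambda>x. F j x - F k x) \<le> ennreal e)"

text \<open>The Riesz--Fischer argument: choose a subsequence with increments so small that the values of
  \<open>Iq\<close> at \<open>2 ^ i\<close> times the \<open>i\<close>-th one are summable. Then the functions converge almost
  everywhere where \<open>w > 0\<close>, at a geometric rate. Fatou's lemma carries the Cauchy property over to the limit.\<close>

lemma Lq_complete:
  assumes F: "\<And>k. Lq_finite \<Omega> w q (F k)" and Cau: "Lq_Cauchy F"
  shows "\<exists>f. Lq_finite \<Omega> w q f \<and> (\<lambda>k. Iq (\<lambda>x. F k x - f x)) \<longlonglongrightarrow> 0"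
proof -
  \<comment> \<open>the first factor absorbs the weights \<open>2 ^ i\<close> of the increments, the second one makes the series converge\<close>
  define \<theta> where "\<theta> i = ((1/2) ^ i) powr q * (1/2) ^ i" for i :: nat
  have \<theta>: "\<theta> i > 0" for i by (simp add: \<theta>_def)
  obtain K where K: "\<And>i j k. j \<ge> K i \<Longrightarrow> k \<ge> K i \<Longrightarrow> Iq (\<lambda>x. F j x - F k x) \<le> ennreal (\<theta> i)"
  proof -
    have "\<forall>i. \<exists>L. \<forall>j\<ge>L. \<forall>k\<ge>L. Iq (\<lambda>x. F j x - F k x) \<le> ennreal (\<theta> i)"
      using Cau \<theta> unfolding Lq_Cauchy_def by blast
    from choice[OF this] show thesis using that by blast
  qed
  define r where "r i = i + (\<Sum>j\<le>i. K j)" for i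
  have rK: "r i \<ge> K i" for i
    using member_le_sum[of i "{..i}" K] by (simp add: r_def)
  have rS: "r (Suc i) \<ge> K i" for i using rK[of i] by (simp add: r_def)
  have rid: "r i \<ge> i" for i by (simp add: r_def)
  have m: "meas (F k)" for k using F by (simp add: Lq_finite_iff)
  have d[measurable]: "dens (\<lambda>x. F j x - F k x) \<in> borel_measurable lebesgue" for j k
    by (intro dens_measurable meas_diff m)
  define \<Delta> where "\<Delta> i x = dens (\<lambda>x. F (r (Suc i)) x - F (r i) x) x" for i x
  have dm[measurable]: "\<Delta> i \<in> borel_measurable lebesgue" for i unfolding \<Delta>_def by measurable
  define S where "S x = (\<Sum>i. ennreal ((2 ^ i) powr q * \<Delta> i x))" for x
  have "(\<integral>\<^sup>+x. S x \<partial>lebesgue) = (\<Sum>i. \<integral>\<^sup>+x. ennreal ((2 ^ i) powr q * \<Delta> i x) \<partial>lebesgue)"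
    unfolding S_def by (rule nn_integral_suminf) measurable
  also have "\<dots> \<le> (\<Sum>i. ennreal ((1/2) ^ i))"
  proof (rule suminf_le)
    fix i
    have "(\<integral>\<^sup>+x. ennreal ((2 ^ i) powr q * \<Delta> i x) \<partial>lebesgue) = ennreal ((2 ^ i) powr q) * Iq (\<lambda>x. F (r (Suc i)) x - F (r i) x)"
      by (simp add: Iq_def \<Delta>_def ennreal_mult' nn_integral_cmult)
    also have "\<dots> \<le> ennreal ((2 ^ i) powr q) * ennreal (\<theta> i)" by (intro mult_left_mono K rK rS) simp
    also have "\<dots> = ennreal ((1/2) ^ i)"
    proof -
      have "(2 ^ i) powr q * ((1/2) ^ i) powr q = ((2 ^ i) * (1/2 :: real) ^ i) powr q" by (simp add: powr_mult)
      also have "\<dots> = 1" by (simp flip: power_mult_distrib)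
      finally have "(2 ^ i) powr q * \<theta> i = (1/2) ^ i" by (simp add: \<theta>_def flip: mult.assoc)
      then show ?thesis by (simp flip: ennreal_mult')
    qed
    finally show "(\<integral>\<^sup>+x. ennreal ((2 ^ i) powr q * \<Delta> i x) \<partial>lebesgue) \<le> ennreal ((1/2) ^ i)" .
  qed auto
  also have "\<dots> < \<infinity>" by (subst suminf_ennreal2) (auto intro: summable_geometric)
  finally have fin: "(\<integral>\<^sup>+x. S x \<partial>lebesgue) \<noteq> \<infinity>" by simp
  have Sm: "S \<in> borel_measurable lebesgue" unfolding S_def by measurable
  have AES: "AE x in lebesgue. S x \<noteq> \<infinity>" using nn_integral_PInf_AE[OF Sm fin] .
  define f where "f x = lim (\<lambda>i. indicator \<Omega> x * F (r i) x)" for x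
  have conv: "AE x in lebesgue. (\<lambda>i. indicator \<Omega> x * F (r i) x) \<longlonglongrightarrow> f x"
    using AES wpos
  proof eventually_elim
    case (elim x)
    show ?case
    proof (cases "x \<in> \<Omega>")
      case True
      then have wx: "w x > 0" using elim by simp
      define C where "C = enn2real (S x)"
      have SC: "S x = ennreal C" using elim(1) by (simp add: C_def less_top)
      have "\<bar>F (r (Suc i)) x - F (r i) x\<bar> \<le> (C / w x) powr (1 / q) * (1/2) ^ i" for i
      proof -
        have "ennreal ((2 ^ i) powr q * \<Delta> i x) \<le> S x"
          unfolding S_def using sum_le_suminf[of "\<lambda>i. ennreal ((2 ^ i) powr q * \<Delta> i x)" "{i}"] by simp
        then have "(2 ^ i) powr q * \<Delta> i x \<le> C" unfolding SC by (subst (asm) ennreal_le_iff) (auto simp: C_def)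
        then have "(2 ^ i * \<bar>F (r (Suc i)) x - F (r i) x\<bar>) powr q \<le> C / w x"
          using True wx by (simp add: \<Delta>_def dens_eq powr_mult field_simps)
        then have "((2 ^ i * \<bar>F (r (Suc i)) x - F (r i) x\<bar>) powr q) powr (1 / q) \<le> (C / w x) powr (1 / q)"
          using q1 by (intro powr_mono2) auto
        then have "2 ^ i * \<bar>F (r (Suc i)) x - F (r i) x\<bar> \<le> (C / w x) powr (1 / q)"
          using q1 by (simp add: powr_powr)
        then show ?thesis by (simp add: field_simps power_divide)
      qed
      then have "summable (\<lambda>i. F (r (Suc i)) x - F (r i) x)"
        by (intro summable_comparison_test[OF _ summable_mult[OF summable_geometric[of "1/2"]]]) auto
      then have "convergent (\<lambda>n. \<Sum>i<n. F (r (Suc i)) x - F (r i) x)" by (simp add: summable_iff_convergent)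
      then have "convergent (\<lambda>n. F (r n) x - F (r 0) x)" by (simp only: sum_lessThan_telescope[of "\<lambda>i. F (r i) x"])
      then have "convergent (\<lambda>n. (F (r n) x - F (r 0) x) + F (r 0) x)" by (intro convergent_add convergent_const)
      then show ?thesis using True by (simp add: f_def convergent_LIMSEQ_iff)
    qed (simp add: f_def)
  qed
  have f0: "indicator \<Omega> x * f x = f x" for x by (cases "x \<in> \<Omega>") (auto simp: f_def)
  have mf: "meas f"
    unfolding set_borel_measurable_def real_scaleR_def f0 unfolding f_def
    by (rule borel_measurable_lim_metric) (use measD[OF m] in simp)
  have est: "Iq (\<lambda>x. F k x - f x) \<le> ennreal e" if e: "\<And>j. j \<ge> L \<Longrightarrow> Iq (\<lambda>x. F k x - F j x) \<le> ennreal e" for k L e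
  proof -
    have "Iq (\<lambda>x. F k x - f x) \<le> (\<integral>\<^sup>+x. liminf (\<lambda>i. ennreal (dens (\<lambda>x. F k x - F (r i) x) x)) \<partial>lebesgue)"
      unfolding Iq_def
    proof (rule nn_integral_mono_AE)
      show "AE x in lebesgue. ennreal (dens (\<lambda>x. F k x - f x) x) \<le> liminf (\<lambda>i. ennreal (dens (\<lambda>x. F k x - F (r i) x) x))"
        using conv
      proof eventually_elim
        case (elim x)
        have "(\<lambda>i. \<bar>indicator \<Omega> x * F k x - indicator \<Omega> x * F (r i) x\<bar> powr q) \<longlonglongrightarrow> \<bar>indicator \<Omega> x * F k x - f x\<bar> powr q"
          using q1 by (intro tendsto_powr' tendsto_intros elim) auto
        then have "(\<lambda>i. dens (\<lambda>x. F k x - F (r i) x) x) \<longlonglongrightarrow> dens (\<lambda>x. F k x - f x) x"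
          unfolding dens_def right_diff_distrib f0 by (rule tendsto_mult[OF tendsto_const])
        then have "(\<lambda>i. ennreal (dens (\<lambda>x. F k x - F (r i) x) x)) \<longlonglongrightarrow> ennreal (dens (\<lambda>x. F k x - f x) x)"
          by (rule tendsto_ennrealI)
        then show ?case by (simp add: lim_imp_Liminf)
      qed
    qed
    also have "\<dots> \<le> liminf (\<lambda>i. Iq (\<lambda>x. F k x - F (r i) x))"
      unfolding Iq_def by (rule nn_integral_liminf) measurable
    also have "\<dots> \<le> ennreal e"
    proof -
      have "\<forall>\<^sub>F i in sequentially. Iq (\<lambda>x. F k x - F (r i) x) \<le> ennreal e"
        unfolding eventually_sequentially using e rid order_trans by blast
      then have "liminf (\<lambda>i. Iq (\<lambda>x. F k x - F (r i) x)) \<le> liminf (\<lambda>i. ennreal e)" by (rule Liminf_mono)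
      then show ?thesis by (simp add: Liminf_const)
    qed
    finally show ?thesis .
  qed
  have small: "\<exists>L. \<forall>k\<ge>L. Iq (\<lambda>x. F k x - f x) \<le> ennreal e" if "e > 0" for e
  proof -
    obtain L where L: "\<And>j k. j \<ge> L \<Longrightarrow> k \<ge> L \<Longrightarrow> Iq (\<lambda>x. F j x - F k x) \<le> ennreal e"
      using Cau \<open>e > 0\<close> unfolding Lq_Cauchy_def by blast
    show ?thesis using est[of L] L by blast
  qed
  have "(\<lambda>k. Iq (\<lambda>x. F k x - f x)) \<longlonglongrightarrow> 0"
  proof (rule order_tendstoI)
    fix a :: ennreal assume "0 < a"
    then obtain e where "ennreal e < a" "e > 0"
    proof -
      obtain b where b: "0 < b" "b < a" using dense[OF \<open>0 < a\<close>] by blast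
      then have "b < top" using less_top_ennreal le_less_trans top_greatest by (metis order_less_le_trans)
      then obtain e where "b = ennreal e" "e \<ge> 0" by (cases b) auto
      with b that show thesis by (auto simp: less_le)
    qed
    then show "\<forall>\<^sub>F k in sequentially. Iq (\<lambda>x. F k x - f x) < a"
      using small[of e] unfolding eventually_sequentially by (meson le_less_trans)
  qed auto
  moreover have "Lq_finite \<Omega> w q f"
  proof -
    obtain L where L: "Iq (\<lambda>x. F L x - f x) \<le> ennreal 1" using small[of 1] by auto
    have "Iq f \<le> ennreal (2 powr q) * (Iq (F L) + Iq (\<lambda>x. f x - F L x))" by (rule Iq_le[OF mf m])
    also have "\<dots> < \<infinity>"
      using L F[of L] le_less_trans[OF L] by (simp add: ennreal_mult_less_top Lq_finite_iff Iq_minus_commute[of f])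
    finally show ?thesis by (simp add: Lq_finite_iff mf)
  qed
  ultimately show ?thesis by blast
qed

end

section \<open>Completions of seminormed function spaces\<close>

lemma tendsto_0_squeeze:
  fixes f g :: "nat \<Rightarrow> 'a::{linorder_topology,zero}"
  assumes "\<And>k. 0 \<le> f k" "\<And>k. f k \<le> g k" "g \<longlonglongrightarrow> 0"
  shows "f \<longlonglongrightarrow> 0"
  by (rule tendsto_sandwich[OF _ _ tendsto_const assms(3)]) (use assms in auto)

locale seminormed_core =
  fixes A :: "(real^'n::finite \<Rightarrow> real) set" and p :: "(real^'n \<Rightarrow> real) \<Rightarrow> real"
  assumes zeroA: "(\<lambda>x. 0) \<in> A"
    and diffA: "\<And>f g. f \<in> A \<Longrightarrow> g \<in> A \<Longrightarrow> (\<lambda>x. f x - g x) \<in> A"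
    and p_nonneg: "\<And>f. f \<in> A \<Longrightarrow> p f \<ge> 0"
    and p_0: "p (\<lambda>x. 0) = 0"
    and p_commute: "\<And>f g. f \<in> A \<Longrightarrow> g \<in> A \<Longrightarrow> p (\<lambda>x. f x - g x) = p (\<lambda>x. g x - f x)"
    and p_triangle: "\<And>f g h. f \<in> A \<Longrightarrow> g \<in> A \<Longrightarrow> h \<in> A \<Longrightarrow>
      p (\<lambda>x. f x - h x) \<le> p (\<lambda>x. f x - g x) + p (\<lambda>x. g x - h x)"
begin

abbreviation CS where "CS \<equiv> Cauchy_seqs A p"
abbreviation rel where "rel \<equiv> completion_rel A p"

lemma CS_D: "V \<in> CS \<Longrightarrow> V k \<in> A"
  "V \<in> CS \<Longrightarrow> e > 0 \<Longrightarrow> \<exists>K. \<forall>j\<ge>K. \<forall>k\<ge>K. p (\<lambda>x. V j x - V k x) < e"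
  by (auto simp: Cauchy_seqs_def)

lemma p_le: "f \<in> A \<Longrightarrow> g \<in> A \<Longrightarrow> p f \<le> p g + p (\<lambda>x. f x - g x)"
  using p_triangle[of f g "\<lambda>x. 0"] zeroA by simp

lemma p_abs_diff: "f \<in> A \<Longrightarrow> g \<in> A \<Longrightarrow> \<bar>p f - p g\<bar> \<le> p (\<lambda>x. f x - g x)"
  using p_le[of f g] p_le[of g f] p_commute[of f g] by auto

lemma rel_D: "(V, W) \<in> rel \<Longrightarrow> V \<in> CS" "(V, W) \<in> rel \<Longrightarrow> W \<in> CS"
  "(V, W) \<in> rel \<Longrightarrow> (\<lambda>k. p (\<lambda>x. V k x - W k x)) \<longlonglongrightarrow> 0"
  by (auto simp: completion_rel_def)

lemma rel_I: "V \<in> CS \<Longrightarrow> W \<in> CS \<Longrightarrow> (\<lambda>k. p (\<lambda>x. V k x - W k x)) \<longlonglongrightarrow> 0 \<Longrightarrow> (V, W) \<in> rel"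
  by (auto simp: completion_rel_def)

lemma equiv_rel: "equiv CS rel"
proof (rule equivI)
  show "rel \<subseteq> CS \<times> CS" by (auto simp: completion_rel_def)
  show "refl_on CS rel" by (auto simp: refl_on_def p_0 intro!: rel_I)
  show "sym rel"
  proof (rule symI)
    fix V W assume VW: "(V, W) \<in> rel"
    then have "p (\<lambda>x. V k x - W k x) = p (\<lambda>x. W k x - V k x)" for k
      by (intro p_commute CS_D rel_D(1)[OF VW] rel_D(2)[OF VW])
    with rel_D[OF VW] show "(W, V) \<in> rel" by (intro rel_I) auto
  qed
  show "trans rel"
  proof (rule transI)
    fix U V W assume UV: "(U, V) \<in> rel" and VW: "(V, W) \<in> rel"
    note UA = CS_D(1)[OF rel_D(1)[OF UV]] and VA = CS_D(1)[OF rel_D(1)[OF VW]] and WA = CS_D(1)[OF rel_D(2)[OF VW]]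
    have "(\<lambda>k. p (\<lambda>x. U k x - V k x) + p (\<lambda>x. V k x - W k x)) \<longlonglongrightarrow> 0 + 0"
      by (intro tendsto_add rel_D(3)[OF UV] rel_D(3)[OF VW])
    then have lim: "(\<lambda>k. p (\<lambda>x. U k x - V k x) + p (\<lambda>x. V k x - W k x)) \<longlonglongrightarrow> 0" by simp
    have "(\<lambda>k. p (\<lambda>x. U k x - W k x)) \<longlonglongrightarrow> 0"
      by (rule tendsto_0_squeeze[OF p_nonneg[OF diffA[OF UA WA]] p_triangle[OF UA VA WA] lim])
    then show "(U, W) \<in> rel" using rel_D(1)[OF UV] rel_D(2)[OF VW] by (intro rel_I)
  qed
qed

lemma completion_ex: "X \<in> completion A p \<Longrightarrow> \<exists>V. V \<in> X"
  unfolding completion_def using equiv_rel by (metis equiv_class_self quotientE)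

lemma completion_CS: "X \<in> completion A p \<Longrightarrow> V \<in> X \<Longrightarrow> V \<in> CS"
  unfolding completion_def using equiv_rel by (metis in_quotient_imp_subset subsetD)

lemma completion_rel_iff: "X \<in> completion A p \<Longrightarrow> V \<in> X \<Longrightarrow> (V, W) \<in> rel \<longleftrightarrow> W \<in> X"
  unfolding completion_def using equiv_rel in_quotient_imp_closed in_quotient_imp_in_rel
  by (metis empty_subsetI insert_subset)

lemma completion_class: "V \<in> CS \<Longrightarrow> rel `` {V} \<in> completion A p"
  unfolding completion_def by (rule quotientI)

lemma completion_eqI: "X \<in> completion A p \<Longrightarrow> Y \<in> completion A p \<Longrightarrow> V \<in> X \<Longrightarrow> W \<in> Y \<Longrightarrow> (V, W) \<in> rel \<Longrightarrow> X = Y"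
  unfolding completion_def using equiv_rel by (rule quotient_eqI)

lemma p_convergent:
  assumes "V \<in> CS" shows "\<exists>l. (\<lambda>k. p (V k)) \<longlonglongrightarrow> l"
proof -
  have "Cauchy (\<lambda>k. p (V k))"
  proof (rule metric_CauchyI)
    fix e :: real assume "e > 0"
    then obtain K where K: "\<And>j k. j \<ge> K \<Longrightarrow> k \<ge> K \<Longrightarrow> p (\<lambda>x. V j x - V k x) < e" using CS_D(2)[OF assms] by blast
    show "\<exists>M. \<forall>m\<ge>M. \<forall>n\<ge>M. dist (p (V m)) (p (V n)) < e"
      using K p_abs_diff[OF CS_D(1)[OF assms] CS_D(1)[OF assms]] unfolding dist_real_def by (meson le_less_trans)
  qed
  then show ?thesis using real_Cauchy_convergent convergent_def by blast
qed

lemma completion_norm_limit: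
  assumes X: "X \<in> completion A p" and V: "V \<in> X"
  shows "(\<lambda>k. p (V k)) \<longlonglongrightarrow> completion_norm p X"
proof -
  obtain l where l: "(\<lambda>k. p (V k)) \<longlonglongrightarrow> l" using p_convergent[OF completion_CS[OF X V]] by blast
  have all: "(\<lambda>k. p (W k)) \<longlonglongrightarrow> l" if W: "W \<in> X" for W
  proof -
    have r: "(V, W) \<in> rel" using completion_rel_iff[OF X V] W by blast
    have "(\<lambda>k. p (V k) - p (W k)) \<longlonglongrightarrow> 0"
      by (rule Lim_null_comparison[OF _ rel_D(3)[OF r]])
        (use p_abs_diff[OF CS_D(1)[OF rel_D(1)[OF r]] CS_D(1)[OF rel_D(2)[OF r]]] in auto)
    then have "(\<lambda>k. p (V k) - (p (V k) - p (W k))) \<longlonglongrightarrow> l - 0" by (intro tendsto_diff l)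
    then show ?thesis by simp
  qed
  have "completion_norm p X = l"
    unfolding completion_norm_def
  proof (rule the_equality)
    show "\<forall>W\<in>X. (\<lambda>k. p (W k)) \<longlonglongrightarrow> l" using all by blast
    show "\<And>r. \<forall>W\<in>X. (\<lambda>k. p (W k)) \<longlonglongrightarrow> r \<Longrightarrow> r = l" using l V LIMSEQ_unique by blast
  qed
  with l show ?thesis by simp
qed

lemma completion_norm_nonneg: "X \<in> completion A p \<Longrightarrow> completion_norm p X \<ge> 0"
  using completion_ex[of X] completion_norm_limit[of X] completion_CS[of X] p_nonneg CS_D(1)
  by (meson LIMSEQ_le_const)

end

text \<open>The situation in which a completion imbeds compactly into a weighted space, stated for
  the functions from which the completion is built. Elements of the completion reach \<open>L\<^sup>q\<close> as limits, so
  everything carries over by approximation.\<close>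

locale compact_core = Lq_weight \<Omega> w q + seminormed_core A p
  for \<Omega> :: "(real^'n::finite) set" and w q and A :: "(real^'n \<Rightarrow> real) set" and p +
  assumes A_Lq: "\<And>f. f \<in> A \<Longrightarrow> f \<in> Lq_space \<Omega> w q"
    and A_bound: "\<exists>C\<ge>0. \<forall>f\<in>A. Iq f \<le> ennreal (C * p f powr q)"
    and A_compact: "\<And>V B. (\<And>n. V n \<in> A) \<Longrightarrow> (\<And>n. p (V n) \<le> B) \<Longrightarrow>
      \<exists>r. strict_mono (r :: nat \<Rightarrow> nat) \<and> Lq_Cauchy (V \<circ> r)"
begin

lemma measA: "f \<in> A \<Longrightarrow> meas f"
  using A_Lq Lq_space_finite Lq_finite_iff by blast

lemma finA: "f \<in> A \<Longrightarrow> Lq_finite \<Omega> w q f"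
  using A_Lq Lq_space_finite by blast

lemma Iq_tendsto_0:
  assumes V: "\<And>k. V k \<in> A" and lim: "(\<lambda>k. p (V k)) \<longlonglongrightarrow> 0"
  shows "(\<lambda>k. Iq (V k)) \<longlonglongrightarrow> 0"
proof -
  obtain C where C: "C \<ge> 0" "\<And>f. f \<in> A \<Longrightarrow> Iq f \<le> ennreal (C * p f powr q)" using A_bound by blast
  have "(\<lambda>k. p (V k) powr q) \<longlonglongrightarrow> 0 powr q"
    using q1 p_nonneg[OF V] by (intro tendsto_powr' lim tendsto_const) auto
  then have "(\<lambda>k. C * p (V k) powr q) \<longlonglongrightarrow> C * 0" by (intro tendsto_mult tendsto_const) simp
  then have "(\<lambda>k. ennreal (C * p (V k) powr q)) \<longlonglongrightarrow> 0" using tendsto_ennrealI by fastforce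
  then show ?thesis by (rule tendsto_0_squeeze[OF zero_le C(2)[OF V]])
qed

lemma Lq_Cauchy_CS:
  assumes "V \<in> CS" shows "Lq_Cauchy V"
  unfolding Lq_Cauchy_def
proof (intro allI impI)
  fix e :: real assume e: "e > 0"
  obtain C where C: "C \<ge> 0" "\<And>f. f \<in> A \<Longrightarrow> Iq f \<le> ennreal (C * p f powr q)" using A_bound by blast
  define d where "d = (e / (C + 1)) powr (1 / q)"
  have d: "d > 0" using e C by (simp add: d_def)
  obtain K where K: "\<And>j k. j \<ge> K \<Longrightarrow> k \<ge> K \<Longrightarrow> p (\<lambda>x. V j x - V k x) < d" using CS_D(2)[OF assms d] by blast
  have "Iq (\<lambda>x. V j x - V k x) \<le> ennreal e" if "j \<ge> K" "k \<ge> K" for j k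
  proof -
    have VA: "(\<lambda>x. V j x - V k x) \<in> A" using CS_D(1)[OF assms] diffA by blast
    have "p (\<lambda>x. V j x - V k x) powr q \<le> d powr q"
      using K[OF that] p_nonneg[OF VA] q1 by (intro powr_mono2) auto
    also have "\<dots> = e / (C + 1)" using q1 e C by (simp add: d_def powr_powr)
    finally have "C * p (\<lambda>x. V j x - V k x) powr q \<le> C * (e / (C + 1))" using C(1) by (rule mult_left_mono)
    also have "\<dots> \<le> e" using C(1) e by (simp add: field_simps)
    finally show ?thesis using C(2)[OF VA] by (meson ennreal_leI order_trans)
  qed
  then show "\<exists>K. \<forall>j\<ge>K. \<forall>k\<ge>K. Iq (\<lambda>x. V j x - V k x) \<le> ennreal e" by blast
qed

lemma Lq_conv_rel:
  assumes r: "(V, W) \<in> rel" and V: "Lq_conv \<Omega> w q V f"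
  shows "Lq_conv \<Omega> w q W f"
proof -
  have VA: "V k \<in> A" "W k \<in> A" for k using CS_D(1) rel_D(1)[OF r] rel_D(2)[OF r] by auto
  have f: "Lq_finite \<Omega> w q f" "(\<lambda>k. Iq (\<lambda>x. V k x - f x)) \<longlonglongrightarrow> 0" using V by (auto simp: Lq_conv_iff)
  have mf: "meas f" using f(1) by (simp add: Lq_finite_iff)
  have 1: "(\<lambda>k. Iq (\<lambda>x. W k x - V k x)) \<longlonglongrightarrow> 0"
    by (subst Iq_minus_commute) (rule Iq_tendsto_0[OF diffA[OF VA] rel_D(3)[OF r]])
  have "(\<lambda>k. ennreal (2 powr q) * (Iq (\<lambda>x. W k x - V k x) + Iq (\<lambda>x. V k x - f x))) \<longlonglongrightarrow> ennreal (2 powr q) * (0 + 0)"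
    by (intro tendsto_mult_ennreal tendsto_add 1 f(2) tendsto_const) auto
  then have lim: "(\<lambda>k. ennreal (2 powr q) * (Iq (\<lambda>x. W k x - V k x) + Iq (\<lambda>x. V k x - f x))) \<longlonglongrightarrow> 0" by simp
  have "(\<lambda>k. Iq (\<lambda>x. W k x - f x)) \<longlonglongrightarrow> 0"
    by (rule tendsto_0_squeeze[OF zero_le Iq_triangle[OF measA[OF VA(2)] measA[OF VA(1)] mf] lim])
  then show ?thesis using f(1) A_Lq[OF VA(2)] by (simp add: Lq_conv_iff)
qed

lemma represents_iff:
  assumes "X \<in> completion A p" "V \<in> X"
  shows "represents \<Omega> w q X f \<longleftrightarrow> Lq_conv \<Omega> w q V f"
  using Lq_conv_rel completion_rel_iff[OF assms] assms(2) unfolding represents_def by blast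

lemma represents_ex:
  assumes X: "X \<in> completion A p" shows "\<exists>f. represents \<Omega> w q X f"
proof -
  obtain V where V: "V \<in> X" using completion_ex[OF X] by blast
  then have VC: "V \<in> CS" using completion_CS[OF X] by blast
  have "\<exists>f. Lq_finite \<Omega> w q f \<and> (\<lambda>k. Iq (\<lambda>x. V k x - f x)) \<longlonglongrightarrow> 0"
    by (rule Lq_complete[OF finA[OF CS_D(1)[OF VC]] Lq_Cauchy_CS[OF VC]])
  then show ?thesis unfolding represents_iff[OF X V] Lq_conv_iff using A_Lq[OF CS_D(1)[OF VC]] by blast
qed

lemma represents_bounded:
  "\<exists>C. \<forall>X\<in>completion A p. \<forall>f. represents \<Omega> w q X f \<longrightarrow> Lq_norm \<Omega> w q f \<le> C * completion_norm p X"
proof -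
  obtain C where C: "C \<ge> 0" "\<And>f. f \<in> A \<Longrightarrow> Iq f \<le> ennreal (C * p f powr q)" using A_bound by blast
  have "Lq_norm \<Omega> w q f \<le> (2 powr q * C) powr (1 / q) * completion_norm p X"
    if X: "X \<in> completion A p" and f: "represents \<Omega> w q X f" for X f
  proof -
    obtain V where V: "V \<in> X" using completion_ex[OF X] by blast
    have VA: "V k \<in> A" for k using CS_D(1)[OF completion_CS[OF X V]] .
    have fV: "Lq_finite \<Omega> w q f" "(\<lambda>k. Iq (\<lambda>x. V k x - f x)) \<longlonglongrightarrow> 0"
      using f unfolding represents_iff[OF X V] Lq_conv_iff by auto
    have mf: "meas f" using fV(1) by (simp add: Lq_finite_iff)
    have "(\<lambda>k. p (V k) powr q) \<longlonglongrightarrow> completion_norm p X powr q"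
      using q1 p_nonneg[OF VA] by (intro tendsto_powr' completion_norm_limit[OF X V] tendsto_const) auto
    then have "(\<lambda>k. ennreal (C * p (V k) powr q)) \<longlonglongrightarrow> ennreal (C * completion_norm p X powr q)"
      by (intro tendsto_ennrealI tendsto_mult tendsto_const)
    then have lim: "(\<lambda>k. ennreal (2 powr q) * (ennreal (C * p (V k) powr q) + Iq (\<lambda>x. V k x - f x))) \<longlonglongrightarrow>
       ennreal (2 powr q) * (ennreal (C * completion_norm p X powr q) + 0)"
      by (intro tendsto_mult_ennreal tendsto_add fV(2) tendsto_const) auto
    have "Iq f \<le> ennreal (2 powr q) * (ennreal (C * p (V k) powr q) + Iq (\<lambda>x. V k x - f x))" for k
      using Iq_le[OF mf measA[OF VA[of k]]] C(2)[OF VA[of k]] Iq_minus_commute[of f "V k"]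
      by (smt (verit, ccfv_threshold) add_right_mono mult_left_mono order_trans zero_le)
    then have "Iq f \<le> ennreal (2 powr q) * (ennreal (C * completion_norm p X powr q) + 0)"
      by (intro LIMSEQ_le_const[OF lim]) auto
    also have "\<dots> = ennreal (2 powr q * C * completion_norm p X powr q)"
      using C(1) by (simp add: ennreal_mult' mult.assoc)
    finally have "Lq_norm \<Omega> w q f powr q \<le> 2 powr q * C * completion_norm p X powr q"
      using Lq_norm_powr[OF fV(1)] C(1) by (metis ennreal_le_iff mult_nonneg_nonneg powr_ge_zero)
    then have "(Lq_norm \<Omega> w q f powr q) powr (1 / q) \<le> (2 powr q * C * completion_norm p X powr q) powr (1 / q)"
      using q1 by (intro powr_mono2) auto
    then show ?thesis
      using q1 Lq_norm_nonneg[of f] completion_norm_nonneg[OF X] by (simp add: powr_mult powr_powr)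
  qed
  then show ?thesis by blast
qed

text \<open>Each \<open>f n\<close> is approximated, with \<open>Iq\<close> of the error at most \<open>1 / (n + 1)\<close>, by some \<open>g n\<close> in the core
  whose seminorm exceeds the bound by at most one, and the compactness assumption is applied to the sequence \<open>g\<close>.\<close>

lemma represents_compact:
  assumes X: "bounded_seq_in A p X" and f: "\<And>n. represents \<Omega> w q (X n) (f n)"
  shows "\<exists>r u. strict_mono r \<and> Lq_conv \<Omega> w q (f \<circ> r) u"
proof -
  obtain C where Xc: "\<And>n. X n \<in> completion A p" and C: "\<And>n. completion_norm p (X n) \<le> C"
    using X by (auto simp: bounded_seq_in_def)
  have "\<exists>g. g \<in> A \<and> p g \<le> C + 1 \<and> Iq (\<lambda>x. g x - f n x) \<le> ennreal (inverse (real (Suc n)))" for n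
  proof -
    obtain V where V: "V \<in> X n" using completion_ex[OF Xc] by blast
    have "(\<lambda>k. Iq (\<lambda>x. V k x - f n x)) \<longlonglongrightarrow> 0"
      using f[of n] unfolding represents_iff[OF Xc V] Lq_conv_iff by blast
    then have "\<forall>\<^sub>F k in sequentially. Iq (\<lambda>x. V k x - f n x) < ennreal (inverse (real (Suc n)))"
      by (rule order_tendstoD) simp
    moreover have "\<forall>\<^sub>F k in sequentially. p (V k) < C + 1"
      using C[of n] by (intro order_tendstoD[OF completion_norm_limit[OF Xc V]]) simp
    ultimately have "\<forall>\<^sub>F k in sequentially. Iq (\<lambda>x. V k x - f n x) < ennreal (inverse (real (Suc n))) \<and> p (V k) < C + 1"
      by (rule eventually_conj)
    then obtain k where "Iq (\<lambda>x. V k x - f n x) < ennreal (inverse (real (Suc n)))" "p (V k) < C + 1"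
      by (auto simp: eventually_sequentially)
    then show ?thesis using CS_D(1)[OF completion_CS[OF Xc V], of k] by (intro exI[of _ "V k"]) auto
  qed
  then obtain g where gA: "\<And>n. g n \<in> A" and gp: "\<And>n. p (g n) \<le> C + 1"
    and gf: "\<And>n. Iq (\<lambda>x. g n x - f n x) \<le> ennreal (inverse (real (Suc n)))" by metis
  obtain r where r: "strict_mono (r :: nat \<Rightarrow> nat)" "Lq_Cauchy (g \<circ> r)" using A_compact[of g, OF gA gp] by blast
  obtain u where u: "Lq_finite \<Omega> w q u" "(\<lambda>k. Iq (\<lambda>x. (g \<circ> r) k x - u x)) \<longlonglongrightarrow> 0"
    using Lq_complete[OF _ r(2)] finA[OF gA] by auto
  have fs: "f n \<in> Lq_space \<Omega> w q" for n
    using completion_ex[OF Xc, of n] f[of n] unfolding represents_def Lq_conv_def by blast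
  have mf: "meas (f n)" for n using Lq_space_finite[OF fs] by (simp add: Lq_finite_iff)
  have mu: "meas u" using u(1) by (simp add: Lq_finite_iff)
  have inv: "(\<lambda>k. ennreal (inverse (real (Suc (r k))))) \<longlonglongrightarrow> 0"
    using tendsto_ennrealI[OF LIMSEQ_subseq_LIMSEQ[OF LIMSEQ_inverse_real_of_nat r(1)]] by (simp add: o_def)
  have "(\<lambda>k. Iq (\<lambda>x. f (r k) x - g (r k) x)) \<longlonglongrightarrow> 0"
    by (rule tendsto_0_squeeze[OF zero_le _ inv], subst Iq_minus_commute) (rule gf)
  then have "(\<lambda>k. ennreal (2 powr q) * (Iq (\<lambda>x. f (r k) x - g (r k) x) + Iq (\<lambda>x. g (r k) x - u x))) \<longlonglongrightarrow> ennreal (2 powr q) * (0 + 0)"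
    using u(2) by (intro tendsto_mult_ennreal tendsto_add tendsto_const) (auto simp: o_def)
  then have lim: "(\<lambda>k. ennreal (2 powr q) * (Iq (\<lambda>x. f (r k) x - g (r k) x) + Iq (\<lambda>x. g (r k) x - u x))) \<longlonglongrightarrow> 0" by simp
  have "(\<lambda>k. Iq (\<lambda>x. f (r k) x - u x)) \<longlonglongrightarrow> 0"
    by (rule tendsto_0_squeeze[OF zero_le Iq_triangle[OF mf measA[OF gA] mu] lim])
  then have "Lq_conv \<Omega> w q (f \<circ> r) u" using u(1) fs by (simp add: Lq_conv_iff)
  then show ?thesis using r(1) by blast
qed

text \<open>Two elements with the same image in \<open>L\<^sup>q\<close> have representing sequences whose difference is Cauchy and
  tends to zero in \<open>L\<^sup>q\<close>; so injectivity follows from the closability of the seminorm.\<close>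

lemma compact_imbedding_if_closable:
  assumes closable: "\<And>D. (\<And>k. D k \<in> A) \<Longrightarrow>
      (\<And>e. e > 0 \<Longrightarrow> \<exists>K. \<forall>j\<ge>K. \<forall>k\<ge>K. p (\<lambda>x. D j x - D k x) < e) \<Longrightarrow>
      (\<lambda>k. Iq (D k)) \<longlonglongrightarrow> 0 \<Longrightarrow> (\<lambda>k. p (D k)) \<longlonglongrightarrow> 0"
  shows "compact_imbedding A p \<Omega> w q"
proof -
  have "X = Y" if X: "X \<in> completion A p" and Y: "Y \<in> completion A p"
    and fX: "represents \<Omega> w q X f" and fY: "represents \<Omega> w q Y f" for X Y f
  proof -
    obtain V where V: "V \<in> X" using completion_ex[OF X] by blast
    obtain W where W: "W \<in> Y" using completion_ex[OF Y] by blast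
    have VC: "V \<in> CS" and WC: "W \<in> CS" using completion_CS X Y V W by auto
    note VA = CS_D(1)[OF VC] and WA = CS_D(1)[OF WC]
    have cV: "(\<lambda>k. Iq (\<lambda>x. V k x - f x)) \<longlonglongrightarrow> 0" and cW: "(\<lambda>k. Iq (\<lambda>x. W k x - f x)) \<longlonglongrightarrow> 0" and mf: "meas f"
      using fX fY unfolding represents_iff[OF X V] represents_iff[OF Y W] Lq_conv_iff Lq_finite_iff by auto
    have "(\<lambda>k. ennreal (2 powr q) * (Iq (\<lambda>x. V k x - f x) + Iq (\<lambda>x. W k x - f x))) \<longlonglongrightarrow> ennreal (2 powr q) * (0 + 0)"
      by (intro tendsto_mult_ennreal tendsto_add cV cW tendsto_const) auto
    then have lim: "(\<lambda>k. ennreal (2 powr q) * (Iq (\<lambda>x. V k x - f x) + Iq (\<lambda>x. W k x - f x))) \<longlonglongrightarrow> 0" by simp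
    have le: "Iq (\<lambda>x. V k x - W k x) \<le> ennreal (2 powr q) * (Iq (\<lambda>x. V k x - f x) + Iq (\<lambda>x. W k x - f x))" for k
      using Iq_triangle[OF measA[OF VA[of k]] mf measA[OF WA[of k]]] by (simp only: Iq_minus_commute[of f "W k"])
    have I0: "(\<lambda>k. Iq (\<lambda>x. V k x - W k x)) \<longlonglongrightarrow> 0"
      by (rule tendsto_0_squeeze[OF zero_le le lim])
    have "(\<lambda>k. p (\<lambda>x. V k x - W k x)) \<longlonglongrightarrow> 0"
    proof (rule closable[OF diffA[OF VA WA] _ I0])
      fix e :: real assume e: "e > 0"
      obtain K where K: "\<And>j k. j \<ge> K \<Longrightarrow> k \<ge> K \<Longrightarrow> p (\<lambda>x. V j x - V k x) < e / 2" using CS_D(2)[OF VC, of "e / 2"] e by auto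
      obtain K' where K': "\<And>j k. j \<ge> K' \<Longrightarrow> k \<ge> K' \<Longrightarrow> p (\<lambda>x. W j x - W k x) < e / 2" using CS_D(2)[OF WC, of "e / 2"] e by auto
      have "p (\<lambda>x. V j x - W j x - (V k x - W k x)) < e" if "j \<ge> max K K'" "k \<ge> max K K'" for j k
      proof -
        have "p (\<lambda>x. (V j x - V k x) - (W j x - W k x)) \<le> p (\<lambda>x. (V j x - V k x) - 0) + p (\<lambda>x. 0 - (W j x - W k x))"
          by (rule p_triangle[OF diffA[OF VA VA] zeroA diffA[OF WA WA]])
        also have "p (\<lambda>x. 0 - (W j x - W k x)) = p (\<lambda>x. (W j x - W k x) - 0)"
          by (rule p_commute[OF zeroA diffA[OF WA WA]])
        finally have le: "p (\<lambda>x. (V j x - V k x) - (W j x - W k x)) \<le> p (\<lambda>x. V j x - V k x) + p (\<lambda>x. W j x - W k x)"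
          by (simp only: diff_zero)
        have "j \<ge> K" "k \<ge> K" "j \<ge> K'" "k \<ge> K'" using that by auto
        then have "p (\<lambda>x. (V j x - V k x) - (W j x - W k x)) < e" using le K[of j k] K'[of j k] by linarith
        moreover have "(\<lambda>x. (V j x - V k x) - (W j x - W k x)) = (\<lambda>x. V j x - W j x - (V k x - W k x))" by auto
        ultimately show ?thesis by simp
      qed
      then show "\<exists>K. \<forall>j\<ge>K. \<forall>k\<ge>K. p (\<lambda>x. V j x - W j x - (V k x - W k x)) < e" by blast
    qed
    then have "(V, W) \<in> rel" by (rule rel_I[OF VC WC])
    then show ?thesis by (rule completion_eqI[OF X Y V W])
  qed
  then have inj: "\<forall>X\<in>completion A p. \<forall>Y\<in>completion A p. \<forall>f. represents \<Omega> w q X f \<and> represents \<Omega> w q Y f \<longrightarrow> X = Y"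
    by blast
  have "\<forall>X f. bounded_seq_in A p X \<and> (\<forall>n. represents \<Omega> w q (X n) (f n)) \<longrightarrow>
      (\<exists>r u. strict_mono r \<and> Lq_conv \<Omega> w q (f \<circ> r) u)"
    using represents_compact by blast
  with represents_bounded inj show ?thesis
    unfolding compact_imbedding_def by (intro conjI ballI[OF represents_ex])
qed

end

section \<open>The imbeddings of the weighted space\<close>

text \<open>On a bounded set the weight \<open>|x| powr - s\<close> is dominated by the strongest admissible one,
  \<open>|x| powr - (a * q)\<close>, which turns \<open>v\<close> into \<open>u\<close>.\<close>

lemma powr_weight_le:
  fixes x :: "'a::real_normed_vector" and z :: real
  assumes x: "x \<noteq> 0" "norm x < R" and s: "s \<le> a * q"
  shows "norm x powr - s * \<bar>z\<bar> powr q \<le> R powr (a * q - s) * (norm x powr - a * \<bar>z\<bar>) powr q"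
proof -
  have "norm x powr - s = norm x powr (a * q - s) * norm x powr - (a * q)" by (simp flip: powr_add)
  also have "\<dots> \<le> R powr (a * q - s) * norm x powr - (a * q)"
    using assms by (intro mult_right_mono powr_mono2) auto
  finally have "norm x powr - s * \<bar>z\<bar> powr q \<le> R powr (a * q - s) * norm x powr - (a * q) * \<bar>z\<bar> powr q"
    by (rule mult_right_mono) simp
  then show ?thesis by (simp add: powr_mult powr_powr)
qed

abbreviation weighted_power :: "real \<Rightarrow> real \<Rightarrow> (real^'n::finite \<Rightarrow> real) \<Rightarrow> ennreal" where
  "weighted_power s q v \<equiv> \<integral>\<^sup>+x. ennreal (norm x powr - s * \<bar>v x\<bar> powr q) \<partial>lborel"

text \<open>The bound for functions of energy at most one is homogenised by scaling. Exponents below \<open>2\<close> are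
  reduced to \<open>2\<close> on the bounded set.\<close>

lemma weighted_embedding:
  fixes \<Omega> :: "(real^'n::finite) set"
  defines "N \<equiv> real CARD('n)"
  assumes N3: "CARD('n) \<ge> 3" and \<Omega>: "\<Omega> \<subseteq> ball 0 R" and R: "R > 0" and q: "1 \<le> q" "q < 2 * N / (N - 2)"
    and s: "s \<le> (N - 2) / 2 * q"
  shows "\<exists>C\<ge>0. \<forall>v\<in>C0_inf \<Omega>.
    weighted_power s q v \<le> ennreal (C * norm_Ht \<Omega> v powr q)"
proof -
  have N: "N \<ge> 3" using N3 by (simp add: N_def)
  define a where "a = (N - 2) / 2"
  have a': "- (N - 2) / 2 = - a" by (simp add: a_def field_simps)
  define q' where "q' = max 2 q"
  have q': "2 \<le> q'" "q' < 2 * N / (N - 2)" "q \<le> q'" using q(2) N by (auto simp: q'_def field_simps)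
  obtain C where C: "C \<ge> 0" and Cv: "\<And>v. v \<in> C0_inf \<Omega> \<Longrightarrow> norm_Ht \<Omega> v \<le> 1 \<Longrightarrow>
      (\<integral>\<^sup>+x. ennreal ((norm x powr - a * \<bar>v x\<bar>) powr q') \<partial>lborel) \<le> ennreal C"
    using weighted_Sobolev_bound[OF N3 \<Omega> q'(1) q'(2)[unfolded N_def], folded N_def] unfolding a' by blast
  define G where "G = R powr (a * q - s)"
  have G: "G > 0" using R by (simp add: G_def)
  define C1 where "C1 = G * (measure lborel (ball (0::real^'n) R) + C)"
  have C1: "C1 \<ge> 0" using G C by (simp add: C1_def)
  have unit: "weighted_power s q v \<le> ennreal C1"
    if v: "v \<in> C0_inf \<Omega>" and v1: "norm_Ht \<Omega> v \<le> 1" for v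
  proof -
    have [measurable]: "v \<in> borel_measurable borel" using borel_measurable_C0_inf[OF v] by simp
    have "weighted_power s q v \<le>
      (\<integral>\<^sup>+x. ennreal G * (indicator (ball 0 R) x + ennreal ((norm x powr - a * \<bar>v x\<bar>) powr q')) \<partial>lborel)"
    proof (rule nn_integral_mono)
      fix x
      let ?u = "norm x powr - a * \<bar>v x\<bar>"
      consider "x = 0" | "x \<notin> ball 0 R" | "x \<noteq> 0" "x \<in> ball 0 R" by blast
      then show "ennreal (norm x powr - s * \<bar>v x\<bar> powr q) \<le> ennreal G * (indicator (ball 0 R) x + ennreal (?u powr q'))"
      proof cases
        case 2
        then have "v x = 0" using C0_inf_D(4)[OF v, of x] \<Omega> by blast
        then show ?thesis by simp
      next
        case 3
        have "?u powr q \<le> 1 + ?u powr q'"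
        proof (cases "?u \<le> 1")
          case True
          then have "?u powr q \<le> 1" using q(1) by (intro powr_le1) auto
          then show ?thesis by (smt (verit) powr_ge_zero)
        next
          case False
          then have "?u powr q \<le> ?u powr q'" using q'(3) by (intro powr_mono) auto
          then show ?thesis by simp
        qed
        then have "norm x powr - s * \<bar>v x\<bar> powr q \<le> G * (1 + ?u powr q')"
          using powr_weight_le[OF 3(1) _ s[folded a_def], of R "v x"] 3(2) G unfolding G_def
          by (meson mem_ball_0 mult_left_mono order_trans powr_ge_zero)
        then have "ennreal (norm x powr - s * \<bar>v x\<bar> powr q) \<le> ennreal (G * (1 + ?u powr q'))" by (rule ennreal_leI)
        also have "\<dots> = ennreal G * (indicator (ball 0 R) x + ennreal (?u powr q'))"
          using 3 G by (simp add: ennreal_mult' ennreal_plus)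
        finally show ?thesis .
      qed simp
    qed
    also have "\<dots> = ennreal G * (emeasure lborel (ball (0::real^'n) R) + (\<integral>\<^sup>+x. ennreal ((norm x powr - a * \<bar>v x\<bar>) powr q') \<partial>lborel))"
    proof -
      have [measurable]: "(\<lambda>x. indicator (ball (0::real^'n) R) x :: ennreal) \<in> borel_measurable borel"
        by (intro borel_measurable_indicator) simp
      show ?thesis by (simp add: nn_integral_cmult nn_integral_add)
    qed
    also have "\<dots> \<le> ennreal G * (emeasure lborel (ball (0::real^'n) R) + ennreal C)"
      by (intro mult_left_mono add_left_mono Cv v v1) simp
    also have "\<dots> = ennreal C1"
      using C G emeasure_eq_ennreal_measure[of lborel "ball (0::real^'n) R"] emeasure_lborel_ball_finite[of "0::real^'n" R]
      by (simp add: C1_def ennreal_mult' ennreal_plus)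
    finally show ?thesis .
  qed
  have "weighted_power s q v \<le> ennreal (C1 * norm_Ht \<Omega> v powr q)"
    if v: "v \<in> C0_inf \<Omega>" for v
  proof -
    have [measurable]: "v \<in> borel_measurable borel" using borel_measurable_C0_inf[OF v] by simp
    note n0 = norm_Ht_square(2)[OF v]
    \<comment> \<open>scaling by a number slightly larger than the norm covers functions of norm zero\<close>
    have scaled: "weighted_power s q v \<le> ennreal (C1 * e powr q)"
      if e: "e > 0" "norm_Ht \<Omega> v \<le> e" for e
    proof -
      have ve: "(\<lambda>x. 1 / e * v x) \<in> C0_inf \<Omega>" by (rule C0_inf_mult[OF v C_k_const])
      have "norm_Ht \<Omega> (\<lambda>x. 1 / e * v x) \<le> 1"
        unfolding norm_Ht_cmult[OF v] using e by (simp add: field_simps)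
      from unit[OF ve this]
      have "ennreal (e powr q) * weighted_power s q (\<lambda>x. 1 / e * v x) \<le> ennreal (e powr q) * ennreal C1"
        by (rule mult_left_mono) simp
      also have "ennreal (e powr q) * weighted_power s q (\<lambda>x. 1 / e * v x) =
        weighted_power s q v"
      proof -
        have "e powr q * (norm x powr - s * \<bar>1 / e * v x\<bar> powr q) = norm x powr - s * \<bar>v x\<bar> powr q" for x
          using e by (simp add: abs_mult powr_divide)
        note eq = this
        have "ennreal (e powr q) * weighted_power s q (\<lambda>x. 1 / e * v x) =
          (\<integral>\<^sup>+x. ennreal (e powr q) * ennreal (norm x powr - s * \<bar>1 / e * v x\<bar> powr q) \<partial>lborel)"
          by (rule nn_integral_cmult[symmetric]) measurable
        then show ?thesis by (simp only: ennreal_mult'[OF powr_ge_zero, symmetric] eq)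
      qed
      finally show ?thesis using C1 by (simp add: mult.commute flip: ennreal_mult')
    qed
    have lim: "(\<lambda>k. ennreal (C1 * (norm_Ht \<Omega> v + inverse (real (Suc k))) powr q)) \<longlonglongrightarrow> ennreal (C1 * (norm_Ht \<Omega> v + 0) powr q)"
      using q(1) n0 by (intro tendsto_ennrealI tendsto_mult tendsto_powr' tendsto_add tendsto_const LIMSEQ_inverse_real_of_nat) auto
    have "weighted_power s q v \<le> ennreal (C1 * (norm_Ht \<Omega> v + 0) powr q)"
    proof (rule LIMSEQ_le_const[OF lim], intro exI[of _ 0] allI impI scaled)
      show "0 < norm_Ht \<Omega> v + inverse (real (Suc k))" for k using n0 by (simp add: add_nonneg_pos)
    qed simp
    then show ?thesis by simp
  qed
  then show ?thesis using C1 by blast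
qed

text \<open>Let \<open>u = |x| powr - a * |D|\<close> for a difference \<open>D\<close> of two members. Where \<open>u \<ge> M\<close>, the bound with the
  larger exponent \<open>q'\<close> gains a negative power of \<open>M\<close>; where \<open>u < M\<close>, the ball of radius \<open>\<rho>\<close> contributes little
  because it is small, and outside of it the weight is bounded and the \<open>L\<^sup>1\<close> norm of \<open>D\<close> takes over. The
  parameters are fixed in the order \<open>M\<close>, \<open>\<rho>\<close>, index.\<close>

lemma weighted_compactness:
  fixes \<Omega> :: "(real^'n::finite) set" and V :: "nat \<Rightarrow> real^'n \<Rightarrow> real"
  defines "N \<equiv> real CARD('n)"
  assumes N3: "CARD('n) \<ge> 3" and \<Omega>: "\<Omega> \<subseteq> ball 0 R" and R: "R > 0" and q: "1 \<le> q" "q < 2 * N / (N - 2)"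
    and s: "s \<le> (N - 2) / 2 * q"
    and V: "\<And>n. V n \<in> C0_inf \<Omega>" and B: "\<And>n. norm_Ht \<Omega> (V n) \<le> B"
  shows "\<exists>r. strict_mono (r :: nat \<Rightarrow> nat) \<and> (\<forall>e>0. \<exists>K. \<forall>j\<ge>K. \<forall>k\<ge>K.
    weighted_power s q (\<lambda>x. V (r j) x - V (r k) x) \<le> ennreal e)"
proof -
  have N: "N \<ge> 3" using N3 by (simp add: N_def)
  define a where "a = (N - 2) / 2"
  have a: "a > 0" using N by (simp add: a_def)
  define q' where "q' = (q + 2 * N / (N - 2)) / 2"
  have q': "1 \<le> q'" "q' < 2 * N / (N - 2)" "q < q'" using q by (auto simp: q'_def)
  obtain C where C: "C \<ge> 0" and Cv: "\<And>v. v \<in> C0_inf \<Omega> \<Longrightarrow>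
      weighted_power (a * q') q' v \<le> ennreal (C * norm_Ht \<Omega> v powr q')"
    using weighted_embedding[OF N3 \<Omega> R q'(1) q'(2)[unfolded N_def], of "a * q'"] unfolding a_def N_def by auto
  obtain r where r: "strict_mono (r :: nat \<Rightarrow> nat)" and L1: "\<And>e. e > 0 \<Longrightarrow> \<exists>K. \<forall>j\<ge>K. \<forall>k\<ge>K.
      (\<integral>\<^sup>+x. ennreal \<bar>V (r j) x - V (r k) x\<bar> \<partial>lborel) \<le> ennreal e"
    by (rule L1_compactness[OF N3 \<Omega> R V B]) (rule that)
  have B0: "B \<ge> 0" using norm_Ht_square(2)[OF V, of 0] B[of 0] by linarith
  define C2 where "C2 = C * (2 * B) powr q'"
  have C2: "C2 \<ge> 0" using C by (simp add: C2_def)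
  define G where "G = R powr (a * q - s)"
  have G: "G > 0" using R by (simp add: G_def)
  have "\<exists>K. \<forall>j\<ge>K. \<forall>k\<ge>K. weighted_power s q (\<lambda>x. V (r j) x - V (r k) x) \<le> ennreal e"
    if e: "e > 0" for e
  proof -
    define M where "M = (1 + 3 * G * C2 / e) powr (1 / (q' - q))"
    have M1: "M \<ge> 1" using G C2 e q' by (auto simp: M_def intro!: ge_one_powr_ge_zero)
    have MC: "G * (M powr (q - q') * C2) \<le> e / 3"
    proof -
      have "M powr (q' - q) = 1 + 3 * G * C2 / e"
        using q' G C2 e by (simp add: M_def powr_powr add_nonneg_nonneg)
      then have "M powr (q - q') = 1 / (1 + 3 * G * C2 / e)"
        using powr_minus_divide[of M "q' - q"] by simp
      moreover have "1 + 3 * G * C2 / e > 0" using G C2 e by (simp add: add_pos_nonneg)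
      ultimately have "M powr (q - q') * (e + 3 * (G * C2)) = e" using e by (simp add: field_simps)
      then have "3 * (G * (M powr (q - q') * C2)) = e - e * M powr (q - q')" by (simp add: algebra_simps)
      moreover have "0 \<le> e * M powr (q - q')" using e by simp
      ultimately show ?thesis by linarith
    qed
    define \<Theta> where "\<Theta> = G * M powr q * (unit_ball_vol N + 1)"
    have ub: "unit_ball_vol N \<ge> 0" using N by simp
    have Th: "\<Theta> > 0" unfolding \<Theta>_def using G M1 ub by (intro mult_pos_pos) auto
    define \<rho> where "\<rho> = min 1 (e / (3 * \<Theta>))"
    have rho: "\<rho> > 0" "\<rho> \<le> 1" "\<rho> \<le> e / (3 * \<Theta>)" using e Th by (auto simp: \<rho>_def)
    have ball: "G * (M powr q * (unit_ball_vol N * \<rho> ^ CARD('n))) \<le> e / 3"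
    proof -
      have "\<rho> ^ CARD('n) \<le> \<rho> ^ 1" using rho N3 by (intro power_decreasing) auto
      then have "unit_ball_vol N * \<rho> ^ CARD('n) \<le> (unit_ball_vol N + 1) * \<rho>" using rho ub by (intro mult_mono) auto
      then have "G * (M powr q * (unit_ball_vol N * \<rho> ^ CARD('n))) \<le> G * (M powr q * ((unit_ball_vol N + 1) * \<rho>))"
        using G by (intro mult_left_mono) auto
      also have "\<dots> = \<Theta> * \<rho>" by (simp add: \<Theta>_def)
      also have "\<dots> \<le> \<Theta> * (e / (3 * \<Theta>))" using rho Th by (intro mult_left_mono) auto
      also have "\<dots> = e / 3" using Th by simp
      finally show ?thesis .
    qed
    define H where "H = G * (M powr (q - 1) * \<rho> powr - a)"
    have H: "H > 0" using G M1 rho by (simp add: H_def)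
    obtain K where K: "\<And>j k. j \<ge> K \<Longrightarrow> k \<ge> K \<Longrightarrow> (\<integral>\<^sup>+x. ennreal \<bar>V (r j) x - V (r k) x\<bar> \<partial>lborel) \<le> ennreal (e / (3 * H))"
      using L1[of "e / (3 * H)"] e H by auto
    have "weighted_power s q (\<lambda>x. V (r j) x - V (r k) x) \<le> ennreal e"
      if jk: "j \<ge> K" "k \<ge> K" for j k
    proof -
      define D where "D x = V (r j) x - V (r k) x" for x
      have D: "D \<in> C0_inf \<Omega>" unfolding D_def[abs_def] by (intro C0_inf_diff V)
      have [measurable]: "D \<in> borel_measurable borel" using borel_measurable_C0_inf[OF D] by simp
      have "norm_Ht \<Omega> D \<le> 2 * B"
        using norm_Ht_diff_le[OF V V N3, of "r j" "r k"] B[of "r j"] B[of "r k"] unfolding D_def[abs_def] by linarith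
      then have "C * norm_Ht \<Omega> D powr q' \<le> C2"
        unfolding C2_def using C q' norm_Ht_square(2)[OF D] by (intro mult_left_mono powr_mono2) auto
      then have D2: "weighted_power (a * q') q' D \<le> ennreal C2"
        using Cv[OF D] by (meson ennreal_leI order_trans)
      have "weighted_power s q D \<le>
        (\<integral>\<^sup>+x. ennreal (G * M powr (q - q')) * ennreal (norm x powr - (a * q') * \<bar>D x\<bar> powr q')
            + ennreal H * ennreal \<bar>D x\<bar> + ennreal (G * M powr q) * indicator (ball 0 \<rho>) x \<partial>lborel)"
      proof (rule nn_integral_mono)
        fix x
        let ?u = "norm x powr - a * \<bar>D x\<bar>"
        consider "x = 0" | "x \<notin> ball 0 R" | "x \<noteq> 0" "x \<in> ball 0 R" by blast
        then show "ennreal (norm x powr - s * \<bar>D x\<bar> powr q) \<le> ennreal (G * M powr (q - q')) * ennreal (norm x powr - (a * q') * \<bar>D x\<bar> powr q')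
            + ennreal H * ennreal \<bar>D x\<bar> + ennreal (G * M powr q) * indicator (ball 0 \<rho>) x"
        proof cases
          case 2
          then have "D x = 0" using C0_inf_D(4)[OF D, of x] \<Omega> by blast
          then show ?thesis by simp
        next
          case 3
          have u0: "?u \<ge> 0" by simp
          have upos: "?u powr q \<le> M powr (q - q') * ?u powr q' + M powr (q - 1) * \<rho> powr - a * \<bar>D x\<bar> + M powr q * indicator (ball 0 \<rho>) x"
          proof -
            consider "?u \<ge> M" | "?u < M" "x \<in> ball 0 \<rho>" | "?u < M" "x \<notin> ball 0 \<rho>" by linarith
            then show ?thesis
            proof cases
              case 1
              have "?u powr q = ?u powr (q - q') * ?u powr q'" by (simp flip: powr_add)
              also have "\<dots> \<le> M powr (q - q') * ?u powr q'"
                using 1 M1 q' by (intro mult_right_mono powr_mono2') auto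
              finally show ?thesis by (simp add: add_increasing2)
            next
              case 2
              have "?u powr q \<le> M powr q" using 2 q by (intro powr_mono2) auto
              then show ?thesis using 2 by (simp add: add_increasing)
            next
              case 3
              have "?u powr q = ?u powr (q - 1) * ?u"
                using u0 by (cases "?u = 0") (auto simp: powr_diff)
              also have "\<dots> \<le> M powr (q - 1) * (\<rho> powr - a * \<bar>D x\<bar>)"
                using 3 q rho a by (intro mult_mono powr_mono2 mult_right_mono powr_mono2') auto
              finally show ?thesis by (simp add: add_increasing add_increasing2 mult.assoc)
            qed
          qed
          have "norm x powr - s * \<bar>D x\<bar> powr q \<le> G * ?u powr q"
            unfolding G_def using 3 s by (intro powr_weight_le) (auto simp: a_def)
          also have "\<dots> \<le> G * (M powr (q - q') * ?u powr q' + M powr (q - 1) * \<rho> powr - a * \<bar>D x\<bar> + M powr q * indicator (ball 0 \<rho>) x)"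
            using G by (intro mult_left_mono upos) auto
          also have "\<dots> = G * M powr (q - q') * (norm x powr - (a * q') * \<bar>D x\<bar> powr q') + H * \<bar>D x\<bar> + G * M powr q * indicator (ball 0 \<rho>) x"
            by (simp add: H_def algebra_simps powr_mult powr_powr)
          finally have "ennreal (norm x powr - s * \<bar>D x\<bar> powr q) \<le> ennreal \<dots>" by (rule ennreal_leI)
          also have "\<dots> = ennreal (G * M powr (q - q')) * ennreal (norm x powr - (a * q') * \<bar>D x\<bar> powr q')
            + ennreal H * ennreal \<bar>D x\<bar> + ennreal (G * M powr q) * indicator (ball 0 \<rho>) x"
            using G H by (simp add: ennreal_plus ennreal_mult indicator_def)
          finally show ?thesis .
        qed simp
      qed
      also have "\<dots> = ennreal (G * M powr (q - q')) * weighted_power (a * q') q' D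
          + ennreal H * (\<integral>\<^sup>+x. ennreal \<bar>D x\<bar> \<partial>lborel) + ennreal (G * M powr q) * emeasure lborel (ball (0::real^'n) \<rho>)"
      proof -
        have [measurable]: "(\<lambda>x. indicator (ball (0::real^'n) \<rho>) x :: ennreal) \<in> borel_measurable borel"
          by (intro borel_measurable_indicator) simp
        show ?thesis by (simp add: nn_integral_add nn_integral_cmult)
      qed
      also have "\<dots> \<le> ennreal (G * M powr (q - q')) * ennreal C2 + ennreal H * ennreal (e / (3 * H)) + ennreal (G * M powr q) * ennreal (unit_ball_vol N * \<rho> ^ CARD('n))"
        using K[OF jk] rho by (intro add_mono mult_left_mono D2) (auto simp: D_def emeasure_ball N_def)
      also have "\<dots> = ennreal (G * (M powr (q - q') * C2) + e / 3 + G * (M powr q * (unit_ball_vol N * \<rho> ^ CARD('n))))"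
        using G C2 H e rho ub by (simp add: ennreal_plus mult.assoc flip: ennreal_mult')
      also have "\<dots> \<le> ennreal e" using MC ball by (intro ennreal_leI) linarith
      finally show ?thesis by (simp add: D_def)
    qed
    then show ?thesis by blast
  qed
  then show ?thesis using r by blast
qed

text \<open>On a bounded set \<open>|D| \<le> t + t powr (1 - q) * |D| powr q\<close> for every \<open>t > 0\<close>, and the weight is bounded below.\<close>

lemma tendsto_0_of_weighted:
  fixes \<Omega> :: "(real^'n::finite) set" and D :: "nat \<Rightarrow> real^'n \<Rightarrow> real"
  assumes N3: "CARD('n) \<ge> 3" and \<Omega>: "\<Omega> \<subseteq> ball 0 R" and R: "R > 0" and q: "1 \<le> q" and s: "0 \<le> s"
    and D: "\<And>k. D k \<in> C0_inf \<Omega>"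
    and lim: "(\<lambda>k. \<integral>\<^sup>+x. ennreal (norm x powr - s * \<bar>D k x\<bar> powr q) \<partial>lborel) \<longlonglongrightarrow> 0"
  shows "(\<lambda>k. \<integral>x. \<bar>D k x\<bar> \<partial>lborel) \<longlonglongrightarrow> 0"
proof (rule LIMSEQ_I)
  fix e :: real assume e: "e > 0"
  define b where "b = measure lborel (ball (0::real^'n) R)"
  have b: "b \<ge> 0" "emeasure lborel (ball (0::real^'n) R) = ennreal b"
    using emeasure_lborel_ball_finite[of "0::real^'n" R] by (auto simp: b_def emeasure_eq_ennreal_measure)
  define t where "t = e / (3 * (b + 1))"
  have t: "t > 0" using e b by (simp add: t_def)
  have tb: "t * b \<le> e / 3"
  proof -
    have "t * b \<le> t * (b + 1)" using t by simp
    also have "\<dots> = e / 3"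
    proof -
      have "e / (3 * c) * c = e / 3" if "c > 0" for c :: real using that by simp
      from this[of "b + 1"] b show ?thesis by (simp only: t_def)
    qed
    finally show ?thesis .
  qed
  define H where "H = t powr (1 - q) * R powr s"
  have H: "H > 0" using t R by (simp add: H_def)
  have "\<forall>\<^sub>F k in sequentially. weighted_power s q (D k) < ennreal (e / (3 * H))"
    using e H by (intro order_tendstoD[OF lim]) simp
  then obtain K where K: "\<And>k. k \<ge> K \<Longrightarrow> weighted_power s q (D k) < ennreal (e / (3 * H))"
    by (auto simp: eventually_sequentially)
  have "norm ((\<integral>x. \<bar>D k x\<bar> \<partial>lborel) - 0) < e" if k: "k \<ge> K" for k
  proof -
    have [measurable]: "D k \<in> borel_measurable borel" using borel_measurable_C0_inf[OF D] by simp
    have int: "integrable lborel (D k)"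
      by (rule integrable_compact_supp[OF C0_inf_D(7)[OF D] bounded_supp_C0_inf[OF D]])
    have "(\<integral>\<^sup>+x. ennreal \<bar>D k x\<bar> \<partial>lborel) \<le> (\<integral>\<^sup>+x. ennreal t * indicator (ball 0 R) x + ennreal H * ennreal (norm x powr - s * \<bar>D k x\<bar> powr q) \<partial>lborel)"
    proof (rule nn_integral_mono_AE)
      show "AE x in lborel. ennreal \<bar>D k x\<bar> \<le> ennreal t * indicator (ball 0 R) x + ennreal H * ennreal (norm x powr - s * \<bar>D k x\<bar> powr q)"
        using AE_lborel_singleton[of "0::real^'n"]
      proof eventually_elim
        case (elim x)
        show ?case
        proof (cases "x \<in> ball 0 R")
          case False
          then have "D k x = 0" using C0_inf_D(4)[OF D, of x] \<Omega> by blast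
          then show ?thesis by simp
        next
          case True
          have "\<bar>D k x\<bar> \<le> t + t powr (1 - q) * \<bar>D k x\<bar> powr q"
          proof (cases "\<bar>D k x\<bar> \<le> t")
            case False
            then have "\<bar>D k x\<bar> = \<bar>D k x\<bar> powr (1 - q) * \<bar>D k x\<bar> powr q" using t by (simp flip: powr_add)
            also have "\<dots> \<le> t powr (1 - q) * \<bar>D k x\<bar> powr q"
              using False t q by (intro mult_right_mono powr_mono2') auto
            finally show ?thesis using t by simp
          qed (simp add: add_increasing2)
          also have "\<bar>D k x\<bar> powr q \<le> R powr s * (norm x powr - s * \<bar>D k x\<bar> powr q)"
          proof -
            have "norm x powr s \<le> R powr s" using True s by (intro powr_mono2) auto
            then have "norm x powr s * norm x powr - s \<le> R powr s * norm x powr - s" by (rule mult_right_mono) simp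
            then have "1 \<le> R powr s * norm x powr - s" using elim by (simp flip: powr_add)
            then have "1 * \<bar>D k x\<bar> powr q \<le> R powr s * norm x powr - s * \<bar>D k x\<bar> powr q" by (rule mult_right_mono) simp
            then show ?thesis by (simp add: mult.assoc)
          qed
          finally have "\<bar>D k x\<bar> \<le> t + H * (norm x powr - s * \<bar>D k x\<bar> powr q)"
            by (simp add: H_def mult.assoc mult_left_mono)
          then have "ennreal \<bar>D k x\<bar> \<le> ennreal (t + H * (norm x powr - s * \<bar>D k x\<bar> powr q))" by (rule ennreal_leI)
          then show ?thesis using True t H by (simp add: ennreal_plus ennreal_mult')
        qed
      qed
    qed
    also have "\<dots> = ennreal t * ennreal b + ennreal H * weighted_power s q (D k)"
    proof -
      have [measurable]: "(\<lambda>x. indicator (ball (0::real^'n) R) x :: ennreal) \<in> borel_measurable borel"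
        by (intro borel_measurable_indicator) simp
      show ?thesis by (simp add: nn_integral_add nn_integral_cmult b(2))
    qed
    also have "\<dots> \<le> ennreal t * ennreal b + ennreal H * ennreal (e / (3 * H))"
      by (intro add_left_mono mult_left_mono less_imp_le[OF K[OF k]]) simp
    also have "\<dots> = ennreal (t * b + e / 3)"
      using t b H e by (simp add: ennreal_plus flip: ennreal_mult')
    also have "(\<integral>\<^sup>+x. ennreal \<bar>D k x\<bar> \<partial>lborel) = ennreal (\<integral>x. \<bar>D k x\<bar> \<partial>lborel)"
      using int by (intro nn_integral_eq_integral) auto
    finally have "(\<integral>x. \<bar>D k x\<bar> \<partial>lborel) \<le> t * b + e / 3" using t b e by (subst (asm) ennreal_le_iff) auto
    moreover have "0 \<le> (\<integral>x. \<bar>D k x\<bar> \<partial>lborel)" by (rule Bochner_Integration.integral_nonneg) simp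
    ultimately show ?thesis using tb e by simp
  qed
  then show "\<exists>K. \<forall>k\<ge>K. norm ((\<integral>x. \<bar>D k x\<bar> \<partial>lborel) - 0) < e" by blast
qed

lemma seminormed_core_Ht:
  fixes \<Omega> :: "(real^'n::finite) set"
  assumes N3: "CARD('n) \<ge> 3"
  shows "seminormed_core (C0_inf \<Omega>) (norm_Ht \<Omega>)"
  by unfold_locales (auto intro: C0_inf_zero C0_inf_diff norm_Ht_square(2) norm_Ht_0 norm_Ht_minus_commute norm_Ht_triangle[OF _ _ _ N3])

lemma Lq_weight_powr:
  fixes \<Omega> :: "(real^'n::finite) set"
  assumes "q \<ge> 1" "open \<Omega>"
  shows "Lq_weight \<Omega> (\<lambda>x. norm x powr - s) q"
proof
  show "\<Omega> \<in> sets lebesgue" using assms(2) by (intro sets_completionI_sets) simp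
  have "(\<lambda>x::real^'n. norm x powr - s) \<in> borel_measurable borel" by measurable
  then show "(\<lambda>x::real^'n. norm x powr - s) \<in> borel_measurable lebesgue"
    by (intro measurable_completion) simp
  show "AE x in lebesgue. x \<in> \<Omega> \<longrightarrow> 0 < norm x powr - s"
    by (rule AE_completion) (use AE_lborel_singleton[of "0::real^'n"] in \<open>auto elim!: eventually_mono\<close>)
qed (use assms in auto)

lemma Lq_weight_1:
  fixes \<Omega> :: "(real^'n::finite) set"
  assumes "q \<ge> 1" "open \<Omega>"
  shows "Lq_weight \<Omega> (\<lambda>_. 1) q"
  by unfold_locales (use assms in auto)

lemma compact_core_Ht:
  fixes \<Omega> :: "(real^'n::finite) set"
  defines "N \<equiv> real CARD('n)"
  assumes N3: "CARD('n) \<ge> 3" and op: "open \<Omega>" and \<Omega>: "\<Omega> \<subseteq> ball 0 R" and R: "R > 0"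
    and q: "1 \<le> q" "q < 2 * N / (N - 2)" and s: "s \<le> (N - 2) / 2 * q"
  shows "compact_core \<Omega> (\<lambda>x. norm x powr - s) q (C0_inf \<Omega>) (norm_Ht \<Omega>)"
proof -
  interpret Lq_weight \<Omega> "\<lambda>x. norm x powr - s" q by (rule Lq_weight_powr[OF q(1) op])
  interpret seminormed_core "C0_inf \<Omega>" "norm_Ht \<Omega>" by (rule seminormed_core_Ht[OF N3])
  have dens: "dens f x = norm x powr - s * \<bar>f x\<bar> powr q" if "f \<in> C0_inf \<Omega>" for f x
    using C0_inf_D(4)[OF that, of x] by (cases "x \<in> \<Omega>") (auto simp: dens_eq)
  have Iq: "Iq f = weighted_power s q f" if "f \<in> C0_inf \<Omega>" for f
    unfolding Iq_def nn_integral_completion by (simp add: dens[OF that])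
  have ms: "meas f" if "f \<in> C0_inf \<Omega>" for f
  proof -
    have "f \<in> borel_measurable lebesgue"
      using borel_measurable_C0_inf(1)[OF that] by (intro measurable_completion) simp
    then show ?thesis unfolding set_borel_measurable_def using \<Omega>m by measurable
  qed
  show ?thesis
  proof
    show bd: "\<exists>C\<ge>0. \<forall>f\<in>C0_inf \<Omega>. Iq f \<le> ennreal (C * norm_Ht \<Omega> f powr q)"
      using weighted_embedding[OF N3 \<Omega> R q[unfolded N_def] s[unfolded N_def]] by (auto simp: Iq)
    show "f \<in> Lq_space \<Omega> (\<lambda>x. norm x powr - s) q" if f: "f \<in> C0_inf \<Omega>" for f
    proof -
      have "Iq f < \<infinity>" using bd f by (auto intro: le_less_trans)
      then have "Lq_finite \<Omega> (\<lambda>x. norm x powr - s) q f" using ms[OF f] by (simp add: Lq_finite_iff)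
      moreover have "Lq_finite \<Omega> (\<lambda>x. norm x powr - s) q (\<lambda>x. f x - f x)" using calculation by (intro Lq_finite_diff)
      ultimately show ?thesis unfolding Lq_space_def using f Lq_norm_0 by (auto intro!: bexI[of _ f])
    qed
    show "\<exists>r. strict_mono (r :: nat \<Rightarrow> nat) \<and> Lq_Cauchy (V \<circ> r)"
      if V: "\<And>n. V n \<in> C0_inf \<Omega>" "\<And>n. norm_Ht \<Omega> (V n) \<le> B" for V B
      using weighted_compactness[OF N3 \<Omega> R q[unfolded N_def] s[unfolded N_def] V]
      unfolding Lq_Cauchy_def by (simp add: Iq C0_inf_diff V)
  qed
qed

lemma compact_imbedding_Ht:
  fixes \<Omega> :: "(real^'n::finite) set"
  defines "N \<equiv> real CARD('n)"
  assumes N3: "CARD('n) \<ge> 3" and op: "open \<Omega>" and \<Omega>: "\<Omega> \<subseteq> ball 0 R" and R: "R > 0"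
    and q: "1 \<le> q" "q < 2 * N / (N - 2)" and s: "0 \<le> s" "s \<le> (N - 2) / 2 * q"
  shows "compact_imbedding (C0_inf \<Omega>) (norm_Ht \<Omega>) \<Omega> (\<lambda>x. norm x powr - s) q"
proof -
  interpret compact_core \<Omega> "\<lambda>x. norm x powr - s" q "C0_inf \<Omega>" "norm_Ht \<Omega>"
    using compact_core_Ht[OF N3 op \<Omega> R q[unfolded N_def] s(2)[unfolded N_def]] .
  show ?thesis
  proof (rule compact_imbedding_if_closable)
    fix D assume D: "\<And>k. D k \<in> C0_inf \<Omega>"
      and Cau: "\<And>e. e > 0 \<Longrightarrow> \<exists>K. \<forall>j\<ge>K. \<forall>k\<ge>K. norm_Ht \<Omega> (\<lambda>x. D j x - D k x) < e"
      and lim: "(\<lambda>k. Iq (D k)) \<longlonglongrightarrow> 0"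
    have "dens (D k) x = norm x powr - s * \<bar>D k x\<bar> powr q" for k x
      using C0_inf_D(4)[OF D, of x] by (cases "x \<in> \<Omega>") (auto simp: dens_eq)
    then have "(\<lambda>k. \<integral>\<^sup>+x. ennreal (norm x powr - s * \<bar>D k x\<bar> powr q) \<partial>lborel) \<longlonglongrightarrow> 0"
      using lim by (simp add: Iq_def nn_integral_completion)
    then have L1: "(\<lambda>k. \<integral>x. \<bar>D k x\<bar> \<partial>lborel) \<longlonglongrightarrow> 0"
      by (rule tendsto_0_of_weighted[OF N3 \<Omega> R q(1) s(1) D])
    show "(\<lambda>k. norm_Ht \<Omega> (D k)) \<longlonglongrightarrow> 0"
      by (rule norm_Ht_closable[OF N3 D _ L1]) (rule Cau)
  qed
qed

section \<open>The isometry between the two spaces\<close>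

lemma grad_cong_open:
  assumes "open S" "x \<in> S" "\<And>y. y \<in> S \<Longrightarrow> f y = g y" "g differentiable (at x)"
  shows "grad f x = grad g x"
proof -
  have "(f has_derivative frechet_derivative g (at x)) (at x)"
    by (rule has_derivative_transform_within_open[OF has_derivative_frechet[OF assms(4)] assms(1,2)]) (simp add: assms(3))
  from partial_deriv_eq[OF this] show ?thesis
    by (simp add: grad_def vec_eq_iff) (simp add: partial_deriv_def)
qed

lemma to_u_diff: "(\<lambda>x. to_u f x - to_u g x) = to_u (\<lambda>x. f x - g x)"
  by (simp add: to_u_def right_diff_distrib)

text \<open>Multiplying back gives \<open>v\<close> except possibly at the origin, where \<open>0 powr b = 0\<close>. There the weight
  in the energy vanishes by the same convention, so the integrands agree everywhere.\<close>

lemma norm_H_to_u: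
  assumes v: "v \<in> C0_inf \<Omega>"
  shows "norm_H \<Omega> (to_u v) = norm_Ht \<Omega> v"
proof -
  let ?v = "\<lambda>x. norm x powr ((real CARD('a) - 2) / 2) * to_u v x"
  have eq: "?v y = v y" if "y \<in> - {0}" for y
  proof -
    have "norm y powr ((real CARD('a) - 2) / 2) * norm y powr (- (real CARD('a) - 2) / 2) = norm y powr 0"
      unfolding powr_add[symmetric] by (rule arg_cong2[where f="(powr)"]) (simp_all add: field_simps)
    then show ?thesis using that by (simp add: to_u_def flip: mult.assoc)
  qed
  have g: "grad ?v x = grad v x" if "x \<noteq> 0" for x
    by (rule grad_cong_open[OF open_Compl[OF closed_singleton, of 0]]) (use that eq C0_inf_D(6)[OF v] in auto)
  have "(\<lambda>x. norm x powr (- (real CARD('a) - 2)) * (norm (grad ?v x))\<^sup>2) = (\<lambda>x. norm x powr (- (real CARD('a) - 2)) * (norm (grad v x))\<^sup>2)"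
  proof
    fix x show "norm x powr (- (real CARD('a) - 2)) * (norm (grad ?v x))\<^sup>2 = norm x powr (- (real CARD('a) - 2)) * (norm (grad v x))\<^sup>2"
      using g[of x] by (cases "x = 0") auto
  qed
  then show ?thesis unfolding norm_H_def norm_Ht_def by simp
qed

lemma seminormed_core_H:
  fixes \<Omega> :: "(real^'n::finite) set"
  assumes N3: "CARD('n) \<ge> 3"
  shows "seminormed_core (core_H \<Omega>) (norm_H \<Omega>)"
proof -
  interpret Ht: seminormed_core "C0_inf \<Omega>" "norm_Ht \<Omega>" by (rule seminormed_core_Ht[OF N3])
  have z: "to_u (\<lambda>x::real^'n. 0) = (\<lambda>x. 0)" by (simp add: to_u_def)
  show ?thesis
  proof
    show "(\<lambda>x. 0) \<in> core_H \<Omega>" 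
      using imageI[OF C0_inf_zero[of \<Omega>], of to_u] by (simp only: core_H_def z)
    show "norm_H \<Omega> (\<lambda>x. 0) = 0" using norm_H_to_u[OF C0_inf_zero[of \<Omega>]] Ht.p_0 by (simp only: z)
  qed (auto simp: core_H_def to_u_diff norm_H_to_u C0_inf_diff Ht.p_nonneg intro: Ht.p_commute Ht.p_triangle)
qed

text \<open>The integral of \<open>|u| powr q\<close> is the weighted integral of \<open>v\<close> with \<open>s = a * q\<close>, so bound and compactness are those of
  the test functions. But \<open>u\<close> is in general singular at the origin, hence no test function; it lies in the closure
  of the test functions as the limit of \<open>(|x|\<^sup>2 + \<epsilon>) powr (- a / 2) * v\<close>.\<close>

lemma compact_core_H:
  fixes \<Omega> :: "(real^'n::finite) set"
  defines "N \<equiv> real CARD('n)"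
  assumes N3: "CARD('n) \<ge> 3" and op: "open \<Omega>" and \<Omega>: "\<Omega> \<subseteq> ball 0 R" and R: "R > 0"
    and q: "1 \<le> q" "q < 2 * N / (N - 2)"
  shows "compact_core \<Omega> (\<lambda>_. 1) q (core_H \<Omega>) (norm_H \<Omega>)"
proof -
  define a where "a = (N - 2) / 2"
  have N: "N \<ge> 3" using N3 by (simp add: N_def)
  have a0: "a \<ge> 0" using N by (simp add: a_def)
  interpret Lq_weight \<Omega> "\<lambda>_. 1" q by (rule Lq_weight_1[OF q(1) op])
  interpret seminormed_core "core_H \<Omega>" "norm_H \<Omega>" by (rule seminormed_core_H[OF N3])
  have tu: "to_u v x = norm x powr - a * v x" for v and x :: "real^'n"
  proof -
    have "- (real CARD('n) - 2) / 2 = - a" by (simp add: a_def N_def field_simps)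
    then show ?thesis unfolding to_u_def by simp
  qed
  have dens: "dens (to_u f) x = norm x powr - (a * q) * \<bar>f x\<bar> powr q" if "f \<in> C0_inf \<Omega>" for f x
    using C0_inf_D(4)[OF that, of x] by (cases "x \<in> \<Omega>") (auto simp: dens_eq tu abs_mult powr_mult powr_powr)
  have Iq: "Iq (to_u f) = weighted_power (a * q) q f" if "f \<in> C0_inf \<Omega>" for f
    unfolding Iq_def nn_integral_completion by (simp add: dens[OF that])
  have msb: "meas f" if "f \<in> borel_measurable borel" for f
  proof -
    have "f \<in> borel_measurable lebesgue" using that by (intro measurable_completion) simp
    then show ?thesis unfolding set_borel_measurable_def using \<Omega>m by measurable
  qed
  have mst: "meas (to_u f)" if "f \<in> C0_inf \<Omega>" for f
  proof (rule msb)
    have [measurable]: "f \<in> borel_measurable borel" using borel_measurable_C0_inf[OF that] by simp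
    show "to_u f \<in> borel_measurable borel" unfolding tu[abs_def] by measurable
  qed
  have s: "a * q \<le> (real CARD('n) - 2) / 2 * q" by (simp add: a_def N_def)
  have bd: "\<exists>C\<ge>0. \<forall>f\<in>C0_inf \<Omega>. Iq (to_u f) \<le> ennreal (C * norm_Ht \<Omega> f powr q)"
    using weighted_embedding[OF N3 \<Omega> R q[unfolded N_def] s] by (auto simp: Iq)
  show ?thesis
  proof
    show "\<exists>C\<ge>0. \<forall>f\<in>core_H \<Omega>. Iq f \<le> ennreal (C * norm_H \<Omega> f powr q)"
      using bd by (auto simp: core_H_def norm_H_to_u)
    show "\<exists>r. strict_mono (r :: nat \<Rightarrow> nat) \<and> Lq_Cauchy (U \<circ> r)"
      if U: "\<And>n. U n \<in> core_H \<Omega>" "\<And>n. norm_H \<Omega> (U n) \<le> B" for U B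
    proof -
      have "\<exists>v. \<forall>n. v n \<in> C0_inf \<Omega> \<and> U n = to_u (v n)"
        using U(1) unfolding core_H_def by (intro choice) blast
      then obtain v where v: "\<And>n. v n \<in> C0_inf \<Omega>" "\<And>n. U n = to_u (v n)" by blast
      have "norm_Ht \<Omega> (v n) \<le> B" for n using U(2)[of n] by (simp add: v norm_H_to_u)
      from weighted_compactness[OF N3 \<Omega> R q[unfolded N_def] s v(1) this]
      show ?thesis unfolding Lq_Cauchy_def by (simp add: v(2) to_u_diff Iq C0_inf_diff v(1))
    qed
    show "u \<in> Lq_space \<Omega> (\<lambda>_. 1) q" if u: "u \<in> core_H \<Omega>" for u
    proof -
      obtain v where v: "v \<in> C0_inf \<Omega>" "u = to_u v" using u by (auto simp: core_H_def)
      have fin: "Iq (to_u v) < \<infinity>" using bd v(1) by (auto intro: le_less_trans)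
      have Lu: "Lq_finite \<Omega> (\<lambda>_. 1) q (to_u v)" using fin mst[OF v(1)] by (simp add: Lq_finite_iff)
      define h :: "nat \<Rightarrow> real" where "h n = inverse (Suc n)" for n
      have h: "(h n)\<^sup>2 > 0" for n by (auto simp: h_def field_simps)
      have h0: "h \<longlonglongrightarrow> 0" unfolding h_def by (rule LIMSEQ_inverse_real_of_nat)
      define \<phi> where "\<phi> n x = reg_powr 0 ((h n)\<^sup>2) (- a / 2) x * v x" for n x
      have \<phi>: "\<phi> n \<in> C0_inf \<Omega>" for n unfolding \<phi>_def[abs_def] by (intro C0_inf_mult v(1) C_k_reg_powr h)
      have regle: "reg_powr 0 ((h n)\<^sup>2) (- a / 2) x \<le> norm x powr - a" if "x \<noteq> 0" for n and x :: "real^'n"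
        using reg_powr_le[of "(h n)\<^sup>2" "- a / 2" x 0] that a0 by simp
      have reg0: "0 \<le> reg_powr 0 ((h n)\<^sup>2) (- a / 2) x" for n and x :: "real^'n" by (simp add: reg_powr_def)
      have meas\<phi>: "meas (\<phi> n)" for n by (rule msb) (use borel_measurable_C0_inf[OF \<phi>] in simp)
      have fin\<phi>: "Lq_finite \<Omega> (\<lambda>_. 1) q (\<phi> n)" for n
      proof -
        have "Iq (\<phi> n) \<le> Iq (to_u v)"
          unfolding Iq_def
        proof (rule nn_integral_mono_AE, rule AE_completion)
          show "AE x in lborel. ennreal (dens (\<phi> n) x) \<le> ennreal (dens (to_u v) x)"
            using AE_lborel_singleton[of "0::real^'n"]
          proof eventually_elim
            case (elim x)
            have "\<bar>\<phi> n x\<bar> \<le> \<bar>to_u v x\<bar>"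
              unfolding \<phi>_def tu abs_mult using regle[OF elim, of n] reg0[of n x] by (intro mult_right_mono) auto
            then show ?case unfolding dens_eq using q(1) by (intro ennreal_leI mult_left_mono powr_mono2) auto
          qed
        qed
        then show ?thesis using fin meas\<phi> by (simp add: Lq_finite_iff)
      qed
      have "(\<lambda>n. Iq (\<lambda>x. \<phi> n x - to_u v x)) \<longlonglongrightarrow> (\<integral>\<^sup>+x. 0 \<partial>(lebesgue :: (real^'n) measure))"
        unfolding Iq_def
      proof (rule nn_integral_dominated_convergence[where w="\<lambda>x. ennreal (dens (to_u v) x)"])
        show "(\<integral>\<^sup>+x. ennreal (dens (to_u v) x) \<partial>lebesgue) < \<infinity>" using fin by (simp add: Iq_def)
        show "AE x in lebesgue. ennreal (dens (\<lambda>x. \<phi> n x - to_u v x) x) \<le> ennreal (dens (to_u v) x)" for n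
        proof (rule AE_completion)
          show "AE x in lborel. ennreal (dens (\<lambda>x. \<phi> n x - to_u v x) x) \<le> ennreal (dens (to_u v) x)"
            using AE_lborel_singleton[of "0::real^'n"]
          proof eventually_elim
            case (elim x)
            have "\<bar>\<phi> n x - to_u v x\<bar> \<le> \<bar>to_u v x\<bar>"
              unfolding \<phi>_def tu left_diff_distrib[symmetric] abs_mult using regle[OF elim, of n] reg0[of n x] by (intro mult_right_mono) auto
            then show ?case unfolding dens_eq using q(1) by (intro ennreal_leI mult_left_mono powr_mono2) auto
          qed
        qed
        show "AE x in lebesgue. (\<lambda>n. ennreal (dens (\<lambda>x. \<phi> n x - to_u v x) x)) \<longlonglongrightarrow> 0"
        proof (rule AE_completion)
          show "AE x in lborel. (\<lambda>n. ennreal (dens (\<lambda>x. \<phi> n x - to_u v x) x)) \<longlonglongrightarrow> 0"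
            using AE_lborel_singleton[of "0::real^'n"]
          proof eventually_elim
            case (elim x)
            have "(\<lambda>n. reg_powr 0 ((h n)\<^sup>2) (- a / 2) x) \<longlonglongrightarrow> norm x powr - a"
              using tendsto_reg_powr[OF h0 elim, of "- a / 2"] by simp
            then have "(\<lambda>n. \<bar>\<phi> n x - to_u v x\<bar>) \<longlonglongrightarrow> \<bar>norm x powr - a * v x - to_u v x\<bar>"
              unfolding \<phi>_def by (intro tendsto_intros)
            then have "(\<lambda>n. \<bar>\<phi> n x - to_u v x\<bar> powr q) \<longlonglongrightarrow> 0 powr q"
              using q(1) by (intro tendsto_powr' tendsto_const) (auto simp: tu)
            then have "(\<lambda>n. indicator \<Omega> x * (1 * \<bar>\<phi> n x - to_u v x\<bar> powr q)) \<longlonglongrightarrow> indicator \<Omega> x * (1 * 0 powr q)"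
              by (intro tendsto_mult tendsto_const)
            then have "(\<lambda>n. dens (\<lambda>x. \<phi> n x - to_u v x) x) \<longlonglongrightarrow> 0" by (simp add: dens_eq)
            then show ?case using tendsto_ennrealI by fastforce
          qed
        qed
      qed (use dens_measurable meas_diff mst[OF v(1)] meas\<phi> in auto)
      then have lim: "(\<lambda>n. Iq (\<lambda>x. \<phi> n x - to_u v x)) \<longlonglongrightarrow> 0" by simp
      have "\<phi> n \<in> Lq_space \<Omega> (\<lambda>_. 1) q" for n
        unfolding Lq_space_def using \<phi>[of n] fin\<phi>[of n] Lq_norm_0 Lq_finite_diff[OF fin\<phi> fin\<phi>, of n n] by (auto intro!: bexI[of _ "\<phi> n"])
      then show ?thesis unfolding v(2) by (rule Lq_space_limit[OF _ Lu lim])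
    qed
  qed
qed

text \<open>The termwise images of equivalent sequences are equivalent, so the image of a class under the map is
  contained in a single class, namely that of the image of any representative.\<close>

lemma to_u_class:
  fixes \<Omega> :: "(real^'n::finite) set"
  assumes N3: "CARD('n) \<ge> 3" and X: "X \<in> completion (C0_inf \<Omega>) (norm_Ht \<Omega>)"
  shows "to_u_class \<Omega> X \<in> completion (core_H \<Omega>) (norm_H \<Omega>)" (is ?A)
    and "completion_norm (norm_H \<Omega>) (to_u_class \<Omega> X) = completion_norm (norm_Ht \<Omega>) X" (is ?B)
proof -
  interpret Ht: seminormed_core "C0_inf \<Omega>" "norm_Ht \<Omega>" by (rule seminormed_core_Ht[OF N3])
  interpret H: seminormed_core "core_H \<Omega>" "norm_H \<Omega>" by (rule seminormed_core_H[OF N3])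
  let ?T = "\<lambda>(V :: nat \<Rightarrow> real^'n \<Rightarrow> real) k. to_u (V k)"
  have T: "?T V \<in> H.CS" if "V \<in> Ht.CS" for V
  proof -
    have "norm_H \<Omega> (\<lambda>x. to_u (V j) x - to_u (V k) x) = norm_Ht \<Omega> (\<lambda>x. V j x - V k x)" for j k
      unfolding to_u_diff by (intro norm_H_to_u C0_inf_diff Ht.CS_D(1)[OF that])
    then show ?thesis using that by (auto simp: Cauchy_seqs_def core_H_def)
  qed
  have Trel: "(?T V, ?T W) \<in> H.rel" if r: "(V, W) \<in> Ht.rel" for V W
  proof (rule H.rel_I[OF T T])
    have "norm_H \<Omega> (\<lambda>x. to_u (V k) x - to_u (W k) x) = norm_Ht \<Omega> (\<lambda>x. V k x - W k x)" for k
      unfolding to_u_diff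
      by (intro norm_H_to_u C0_inf_diff Ht.CS_D(1)[OF Ht.rel_D(1)[OF r]] Ht.CS_D(1)[OF Ht.rel_D(2)[OF r]])
    then show "(\<lambda>k. norm_H \<Omega> (\<lambda>x. to_u (V k) x - to_u (W k) x)) \<longlonglongrightarrow> 0" using Ht.rel_D(3)[OF r] by simp
  qed (use Ht.rel_D[OF r] in auto)
  obtain V where V: "V \<in> X" using Ht.completion_ex[OF X] by blast
  have VC: "V \<in> Ht.CS" by (rule Ht.completion_CS[OF X V])
  have eq: "to_u_class \<Omega> X = H.rel `` {?T V}"
  proof -
    have "H.rel `` {?T W} = H.rel `` {?T V}" if "W \<in> X" for W
      using Trel[of V W] Ht.completion_rel_iff[OF X V, of W] that equiv_class_eq[OF H.equiv_rel] by metis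
    then show ?thesis unfolding to_u_class_def using V by blast
  qed
  show A: ?A unfolding eq by (rule H.completion_class[OF T[OF VC]])
  have "?T V \<in> to_u_class \<Omega> X" unfolding eq using equiv_class_self[OF H.equiv_rel T[OF VC]] .
  from H.completion_norm_limit[OF A this]
  have "(\<lambda>k. norm_Ht \<Omega> (V k)) \<longlonglongrightarrow> completion_norm (norm_H \<Omega>) (to_u_class \<Omega> X)"
    by (simp add: norm_H_to_u[OF Ht.CS_D(1)[OF VC]])
  then show ?B using Ht.completion_norm_limit[OF X V] LIMSEQ_unique by blast
qed

theorem corollary4p1:
  fixes \<Omega> :: "(real^'n::finite) set" and N :: real
  defines "N \<equiv> real CARD('n)"
  assumes "CARD('n) \<ge> 3"
    and "open \<Omega>" and "connected \<Omega>" and "bounded \<Omega>" and "0 \<in> \<Omega>"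
  shows
    "(\<forall>v. bounded_seq_in (C0_inf \<Omega>) (norm_Ht \<Omega>) v \<longrightarrow>
        bounded_seq_in (core_H \<Omega>) (norm_H \<Omega>) (\<lambda>n. to_u_class \<Omega> (v n)) \<and>
        (\<forall>q. 1 \<le> q \<and> q < 2 * N / (N - 2) \<longrightarrow>
           (\<exists>u_fun r u. (\<forall>n. represents \<Omega> (\<lambda>_. 1) q (to_u_class \<Omega> (v n)) (u_fun n)) \<and>
              strict_mono r \<and> Lq_conv \<Omega> (\<lambda>_. 1) q (u_fun \<circ> r) u))) \<and>
     (\<forall>q. 1 \<le> q \<and> q < 2 * N / (N - 2) \<longrightarrow>
        compact_imbedding (C0_inf \<Omega>) (norm_Ht \<Omega>) \<Omega> (\<lambda>x. norm x powr (- (q * (N - 2) / 2))) q) \<and>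
     (\<forall>q s. 1 \<le> q \<and> q < 2 * N / (N - 2) \<and> 0 \<le> s \<and> s \<le> (N - 2) / 2 * q \<longrightarrow>
        compact_imbedding (C0_inf \<Omega>) (norm_Ht \<Omega>) \<Omega> (\<lambda>x. norm x powr (- s)) q)"
proof -
  note N3 = assms(2) and op = assms(3)
  have N: "N \<ge> 3" using N3 by (simp add: N_def)
  obtain R where R: "R > 0" "\<Omega> \<subseteq> ball 0 R"
    using bounded_subset_ballD[OF assms(5), of 0] by blast
  have imb: "compact_imbedding (C0_inf \<Omega>) (norm_Ht \<Omega>) \<Omega> (\<lambda>x. norm x powr (- s)) q"
    if "1 \<le> q" "q < 2 * N / (N - 2)" "0 \<le> s" "s \<le> (N - 2) / 2 * q" for q s
    using compact_imbedding_Ht[OF N3 op R(2) R(1)] that unfolding N_def by blast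
  have part1: "bounded_seq_in (core_H \<Omega>) (norm_H \<Omega>) (\<lambda>n. to_u_class \<Omega> (v n))"
    if "bounded_seq_in (C0_inf \<Omega>) (norm_Ht \<Omega>) v" for v
    using that to_u_class[OF N3] unfolding bounded_seq_in_def by auto
  have part2: "\<exists>u_fun r u. (\<forall>n. represents \<Omega> (\<lambda>_. 1) q (to_u_class \<Omega> (v n)) (u_fun n)) \<and>
              strict_mono r \<and> Lq_conv \<Omega> (\<lambda>_. 1) q (u_fun \<circ> r) u"
    if v: "bounded_seq_in (C0_inf \<Omega>) (norm_Ht \<Omega>) v" and q: "1 \<le> q" "q < 2 * N / (N - 2)" for v q
  proof -
    interpret H: compact_core \<Omega> "\<lambda>_. 1" q "core_H \<Omega>" "norm_H \<Omega>"
      using compact_core_H[OF N3 op R(2) R(1) q[unfolded N_def]] .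
    have "\<forall>n. \<exists>f. represents \<Omega> (\<lambda>_. 1) q (to_u_class \<Omega> (v n)) f"
      using part1[OF v] H.represents_ex unfolding bounded_seq_in_def by blast
    then obtain f where f: "\<And>n. represents \<Omega> (\<lambda>_. 1) q (to_u_class \<Omega> (v n)) (f n)" by metis
    from H.represents_compact[OF part1[OF v] f] f show ?thesis by blast
  qed
  have imb': "compact_imbedding (C0_inf \<Omega>) (norm_Ht \<Omega>) \<Omega> (\<lambda>x. norm x powr (- (q * (N - 2) / 2))) q"
    if "1 \<le> q" "q < 2 * N / (N - 2)" for q
    using imb[OF that, of "q * (N - 2) / 2"] that N by simp
  show ?thesis using part1 part2 imb imb' by blast
qed

end
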